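(* Let $d\ge 3$, let $V$ be a nonnegative potential on $\mathbb{R}^d$, not identically zero, satisfying a reverse Hölder inequality of some exponent $s>d/2$, with critical radius function $\rho$ and region $N=\{(x,y):|x-y|\le\rho(x)\}$. Let $X$ be a Banach space and $2\le q<\infty$. Assume that $g^{\Delta,q}$ maps $L^p_X(\mathbb{R}^d)$ into $L^p(\mathbb{R}^d)$ for some $p$, $1<p<\infty$ (resp. $L^1_X(\mathbb{R}^d)$ into weak-$L^1(\mathbb{R}^d)$). Then the operator $f\longmapsto t\partial_tP_t(\chi_N(x,\cdot)f(\cdot))(x)$, $x\in\mathbb{R}^d$, $t>0$, maps $L^p_X(\mathbb{R}^d)$ into $L^p_{L^q_X((0,\infty),\frac{dt}{t})}(\mathbb{R}^d)$ (resp. $L^1_X(\mathbb{R}^d)$ into weak-$L^1_{L^q_X((0,\infty),\frac{dt}{t})}(\mathbb{R}^d)$). In particular $g^{\Delta,q}_{\mathrm{loc}}$ maps $L^p_X(\mathbb{R}^d)$ into $L^p(\mathbb{R}^d)$ (resp. $L^1_X(\mathbb{R}^d)$ into weak-$L^1(\mathbb{R}^d)$). Moreover, if for every function $f\in L^1_X(\mathbb{R}^d)$ we have $g^{\Delta,q}f(x)<\infty$ for almost all $x\in\mathbb{R}^d$, then for every $f\in L^1_X(\mathbb{R}^d)$ we have $\left\|t\partial_tP_t(\chi_N(x,\cdot)f(\cdot))(x)\right\|_{L^q_X((0,\infty),\frac{dt}{t})}<\infty$ for almost all $x\in\mathbb{R}^d$.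
   Context: Reverse Hölder inequality: $V\ge 0$ is locally integrable and there is a constant $C$ with $\left(\frac1{|B|}\int_B V^s\,dy\right)^{1/s}\le \frac{C}{|B|}\int_B V\,dy$ for all balls $B\subset\mathbb{R}^d$. Critical radius: $\rho(x)=\sup\{r>0: \frac{1}{r^{d-2}}\int_{B(x,r)}V(y)\,dy\le 1\}$ (so $0<\rho(x)<\infty$). Classical Poisson semigroup: $P_tf(x)=P_t*f(x)$ with $P_t(x)=c_d\frac{t}{(t^2+|x|^2)^{(d+1)/2}}$, where $c_d$ normalizes $\int P_t=1$; it acts on $X$-valued functions. The square function is $g^{\Delta,q}f(x)=\left(\int_0^\infty\|t\,\partial_tP_tf(x)\|_X^q\,\frac{dt}{t}\right)^{1/q}=\|t\partial_tP_tf(x)\|_{L^q_X((0,\infty),\frac{dt}{t})}$. Localization: $t\partial_tP_t(\chi_N(x,\cdot)f(\cdot))(x)=\int_{|x-y|\le\rho(x)}t\,\partial_tP_t(x-y)f(y)\,dy$. Also $g^{\Delta,q}_{\mathrm{glob}}f(x)=g^{\Delta,q}(\chi_{N^c}(x,\cdot)f(\cdot))(x)$ (the cut-off function $y\mapsto\chi_{N^c}(x,y)f(y)$ depends on the same point $x$ at which the square function is evaluated) and $g^{\Delta,q}_{\mathrm{loc}}f(x)=g^{\Delta,q}f(x)-g^{\Delta,q}_{\mathrm{glob}}f(x)$. $L^p_Y(\mathbb{R}^d)$ is the Bochner–Lebesgue space with values in the Banach space $Y$; weak-$L^1_Y(\mathbb{R}^d)$ consists of $Y$-valued $F$ with $\sup_{\lambda>0}\lambda\,|\{x:\|F(x)\|_Y>\lambda\}|<\infty$.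 "Maps $E$ into $F$" means boundedly, with a norm (quasi-norm) inequality with constant independent of $f$. *)

theory Defs
  imports "HOL-Analysis.Analysis"
begin

section \<open>Bochner--Lebesgue spaces over an arbitrary Banach space\<close>

text \<open>
  The Bochner integral of the library needs a second countable codomain.  The Banach space
  \<open>X\<close> is arbitrary here, so measurability is replaced by strong measurability (approximation by
  simple functions).

  A (semi)normed space is a carrier together with an extended-real norm.  Hence the
  Bochner--Lebesgue construction can be iterated, as in \<open>L\<^sup>p\<close> with values in \<open>L\<^sup>q\<^sub>X\<close>.  The elements of
  \<open>L\<^sup>q\<^sub>X\<close> are represented by functions; classes modulo null functions are not formed.
\<close>

type_synonym 'y nspace = "'y set \<times> ('y \<Rightarrow> ennreal)"

abbreviation carrier_of :: "'y nspace \<Rightarrow> 'y set" where "carrier_of \<equiv> fst"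
abbreviation norm_of :: "'y nspace \<Rightarrow> 'y \<Rightarrow> ennreal" where "norm_of \<equiv> snd"

definition banach_space :: "'x::banach nspace" where
  "banach_space = (UNIV, \<lambda>v. ennreal (norm v))"

text \<open>Only used for exponents \<open>r > 0\<close>.\<close>
definition epowr :: "ennreal \<Rightarrow> real \<Rightarrow> ennreal" where
  "epowr a r = (if a = top then top else ennreal (enn2real a powr r))"

definition Lp_norm :: "real \<Rightarrow> 'm measure \<Rightarrow> ('y \<Rightarrow> ennreal) \<Rightarrow> ('m \<Rightarrow> 'y) \<Rightarrow> ennreal" where
  "Lp_norm r M N F = epowr (\<integral>\<^sup>+x. epowr (N (F x)) r \<partial>M) (1 / r)"

definition weak_L1_norm :: "'m measure \<Rightarrow> ('y \<Rightarrow> ennreal) \<Rightarrow> ('m \<Rightarrow> 'y) \<Rightarrow> ennreal" where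
  "weak_L1_norm M N F =
     (SUP l\<in>{0::real<..}. ennreal l * emeasure M {x \<in> space M. N (F x) > ennreal l})"

text \<open>The condition \<open>F x \<in> Y\<close> is not implied by the convergence when the elements of \<open>Y\<close> are
  themselves measurable functions: \<open>N\<close> is then a lower integral outside of \<open>Y\<close>.\<close>
definition strongly_measurable ::
    "'m measure \<Rightarrow> 'y::minus nspace \<Rightarrow> ('m \<Rightarrow> 'y) \<Rightarrow> bool" where
  "strongly_measurable M Y F \<longleftrightarrow>
     (AE x in M. F x \<in> carrier_of Y) \<and>
     (\<exists>s. (\<forall>i. simple_function M (s i) \<and> (\<forall>x\<in>space M. s i x \<in> carrier_of Y)) \<and>
          (AE x in M. (\<lambda>i. norm_of Y (F x - s i x)) \<longlonglongrightarrow> 0))"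

definition bochner_Lp :: "real \<Rightarrow> 'm measure \<Rightarrow> 'y::minus nspace \<Rightarrow> ('m \<Rightarrow> 'y) nspace" where
  "bochner_Lp r M Y =
     ({F. strongly_measurable M Y F \<and> Lp_norm r M (norm_of Y) F < \<infinity>}, Lp_norm r M (norm_of Y))"

definition bochner_weak_L1 :: "'m measure \<Rightarrow> 'y::minus nspace \<Rightarrow> ('m \<Rightarrow> 'y) nspace" where
  "bochner_weak_L1 M Y =
     ({F. strongly_measurable M Y F \<and> weak_L1_norm M (norm_of Y) F < \<infinity>},
      weak_L1_norm M (norm_of Y))"

text \<open>Scalar spaces.  The values are extended reals because square functions may be infinite on a
  null set.\<close>
definition scalar_Lp :: "real \<Rightarrow> 'm measure \<Rightarrow> ('m \<Rightarrow> ereal) nspace" where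
  "scalar_Lp r M =
     ({F \<in> borel_measurable M. Lp_norm r M (\<lambda>z. e2ennreal \<bar>z\<bar>) F < \<infinity>},
      Lp_norm r M (\<lambda>z. e2ennreal \<bar>z\<bar>))"

definition scalar_weak_L1 :: "'m measure \<Rightarrow> ('m \<Rightarrow> ereal) nspace" where
  "scalar_weak_L1 M =
     ({F \<in> borel_measurable M. weak_L1_norm M (\<lambda>z. e2ennreal \<bar>z\<bar>) F < \<infinity>},
      weak_L1_norm M (\<lambda>z. e2ennreal \<bar>z\<bar>))"

definition maps_into :: "('e \<Rightarrow> 'f) \<Rightarrow> 'e nspace \<Rightarrow> 'f nspace \<Rightarrow> bool" where
  "maps_into T E F \<longleftrightarrow>
     (\<forall>f\<in>carrier_of E. T f \<in> carrier_of F) \<and>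
     (\<exists>C::real. 0 \<le> C \<and> (\<forall>f\<in>carrier_of E. norm_of F (T f) \<le> ennreal C * norm_of E f))"

text \<open>\<open>has_bochner_integral\<close> and \<open>lebesgue_integral\<close> of the library, with Borel measurability
  replaced by strong measurability.\<close>
definition has_banach_integral :: "'m measure \<Rightarrow> ('m \<Rightarrow> 'x::banach) \<Rightarrow> 'x \<Rightarrow> bool" where
  "has_banach_integral M f I \<longleftrightarrow>
     strongly_measurable M banach_space f \<and>
     (\<exists>s. (\<forall>i. Bochner_Integration.simple_bochner_integrable M (s i)) \<and>
          (\<lambda>i. \<integral>\<^sup>+x. ennreal (norm (f x - s i x)) \<partial>M) \<longlonglongrightarrow> 0 \<and>
          (\<lambda>i. Bochner_Integration.simple_bochner_integral M (s i)) \<longlonglongrightarrow> I)"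

definition banach_integral :: "'m measure \<Rightarrow> ('m \<Rightarrow> 'x::banach) \<Rightarrow> 'x" where
  "banach_integral M f =
     (if \<exists>I. has_banach_integral M f I then THE I. has_banach_integral M f I else 0)"

section \<open>The potential and its critical radius\<close>

definition locally_integrable :: "('a::euclidean_space \<Rightarrow> real) \<Rightarrow> bool" where
  "locally_integrable V \<longleftrightarrow> (\<forall>K. compact K \<longrightarrow> set_integrable lebesgue K V)"

text \<open>Integrability of \<open>V\<^sup>s\<close> on balls is spelled out: it is the finiteness of the left-hand side of
  the inequality.\<close>
definition reverse_hoelder :: "real \<Rightarrow> ('a::euclidean_space \<Rightarrow> real) \<Rightarrow> bool" where
  "reverse_hoelder s V \<longleftrightarrow>
     (\<forall>x. 0 \<le> V x) \<and> locally_integrable V \<and>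
     (\<exists>C. \<forall>x r. r > 0 \<longrightarrow>
        set_integrable lebesgue (ball x r) (\<lambda>y. V y powr s) \<and>
        (1 / measure lebesgue (ball x r) * (LINT y:ball x r|lebesgue. V y powr s)) powr (1 / s)
          \<le> C / measure lebesgue (ball x r) * (LINT y:ball x r|lebesgue. V y))"

definition critical_radius :: "('a::euclidean_space \<Rightarrow> real) \<Rightarrow> 'a \<Rightarrow> real" where
  "critical_radius V x =
     Sup {r. r > 0 \<and> 1 / r ^ (DIM('a) - 2) * (LINT y:ball x r|lebesgue. V y) \<le> 1}"

definition local_region :: "('a::euclidean_space \<Rightarrow> real) \<Rightarrow> ('a \<times> 'a) set" where
  "local_region V = {(x, y). norm (x - y) \<le> critical_radius V x}"

section \<open>The Poisson semigroup and its square functions\<close>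

text \<open>By dilation, normalizing the kernel at \<open>t = 1\<close> normalizes it for every \<open>t > 0\<close>.\<close>
definition poisson_const :: "'a::euclidean_space itself \<Rightarrow> real" where
  "poisson_const _ =
     1 / (LINT x|(lebesgue :: 'a measure). 1 / (1 + (norm x)\<^sup>2) powr ((real DIM('a) + 1) / 2))"

definition poisson_kernel :: "real \<Rightarrow> 'a::euclidean_space \<Rightarrow> real" where
  "poisson_kernel t x =
     poisson_const TYPE('a) * (t / (t\<^sup>2 + (norm x)\<^sup>2) powr ((real DIM('a) + 1) / 2))"

definition poisson :: "real \<Rightarrow> ('a::euclidean_space \<Rightarrow> 'x::banach) \<Rightarrow> 'a \<Rightarrow> 'x" where
  "poisson t f x = banach_integral lebesgue (\<lambda>y. poisson_kernel t (x - y) *\<^sub>R f y)"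

definition t_deriv_poisson :: "('a::euclidean_space \<Rightarrow> 'x::banach) \<Rightarrow> 'a \<Rightarrow> real \<Rightarrow> 'x" where
  "t_deriv_poisson f x t = t *\<^sub>R vector_derivative (\<lambda>u. poisson u f x) (at t)"

definition dt_over_t :: "real measure" where
  "dt_over_t = density (restrict_space lebesgue {0<..}) (\<lambda>t. ennreal (1 / t))"

abbreviation LqX :: "real \<Rightarrow> (real \<Rightarrow> 'x::banach) nspace" where
  "LqX q \<equiv> bochner_Lp q dt_over_t banach_space"

definition square_fun :: "real \<Rightarrow> ('a::euclidean_space \<Rightarrow> 'x::banach) \<Rightarrow> 'a \<Rightarrow> ennreal" where
  "square_fun q f x = norm_of (LqX q) (t_deriv_poisson f x)"

text \<open>In the next two definitions the cut-off depends on the point \<open>x\<close> at which the operator is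
  evaluated.  For \<open>f\<close> in \<open>L\<^sup>p\<^sub>X\<close>, differentiation under the integral sign turns the first one into the
  integral over \<open>\<bar>x - y\<bar> \<le> \<rho>(x)\<close> of \<open>t \<partial>\<^sub>tP\<^sub>t(x - y) f(y)\<close>.\<close>

definition local_t_deriv_poisson ::
    "('a::euclidean_space \<Rightarrow> real) \<Rightarrow> ('a \<Rightarrow> 'x::banach) \<Rightarrow> 'a \<Rightarrow> real \<Rightarrow> 'x" where
  "local_t_deriv_poisson V f x =
     t_deriv_poisson (\<lambda>y. indicat_real (local_region V) (x, y) *\<^sub>R f y) x"

definition square_fun_glob ::
    "('a::euclidean_space \<Rightarrow> real) \<Rightarrow> real \<Rightarrow> ('a \<Rightarrow> 'x::banach) \<Rightarrow> 'a \<Rightarrow> ennreal" where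
  "square_fun_glob V q f x =
     square_fun q (\<lambda>y. indicat_real (- local_region V) (x, y) *\<^sub>R f y) x"

text \<open>The difference is formed in the extended reals, where \<open>\<infinity> - \<infinity> = \<infinity>\<close>; so any \<open>x\<close> at which one of
  the two terms is infinite counts as a point of infinite modulus.\<close>
definition square_fun_loc ::
    "('a::euclidean_space \<Rightarrow> real) \<Rightarrow> real \<Rightarrow> ('a \<Rightarrow> 'x::banach) \<Rightarrow> 'a \<Rightarrow> ereal" where
  "square_fun_loc V q f x = enn2ereal (square_fun q f x) - enn2ereal (square_fun_glob V q f x)"

end

theory Submission
  imports Defs
begin

text \<open>
  The critical radius \<open>\<rho>\<close> is comparable at \<open>x\<close> and \<open>y\<close> whenever \<open>norm (x - y)\<close> is bounded by a multiple
  of \<open>\<rho> x\<close>: the reverse Hoelder inequality makes the measure \<open>V dx\<close> doubling and makes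
  \<open>r\<^sup>2\<^sup>-\<^sup>d \<integral>\<^bsub>B(x,r)\<^esub> V\<close> grow at least like a positive power of \<open>r\<close>.  Hence the space is covered by
  countably many balls \<open>B(z, \<rho> z)\<close> whose dilates \<open>Q(z) = B(z, A \<rho> z)\<close> have bounded overlap.
  For \<open>x\<close> in \<open>B(z, \<rho> z)\<close> the function \<open>\<chi>\<^sub>N(x, \<cdot>) f\<close> differs from \<open>\<chi>\<^bsub>Q(z)\<^esub> f\<close> only at points whose distance to
  \<open>x\<close> is comparable to \<open>\<rho> z\<close>; there the kernel \<open>t \<partial>\<^sub>t P\<^sub>t(x - y)\<close> has \<open>L\<^sup>q(dt/t)\<close>-norm at most a constant times
  \<open>(\<rho> z)\<^sup>-\<^sup>d\<close>, so the difference is at most a constant times the mean of \<open>norm f\<close> over \<open>Q(z)\<close>.  The hypothesis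
  applied to the functions \<open>\<chi>\<^bsub>Q(z)\<^esub> f\<close> and summation over \<open>z\<close> give the boundedness of the local operator, and
  \<open>g\<^sub>l\<^sub>o\<^sub>c\<close> is dominated by it through the triangle inequality.  Strong measurability with values in
  \<open>L\<^sup>q\<^sub>X\<close> follows from Pettis' criterion, step functions with values in a countable set being dense.
\<close>

section \<open>Powers and Minkowski's inequality\<close>

text \<open>The cut-off moves with the point of evaluation, so the local operator is not
  \<open>t_deriv_poisson\<close> of any one function, and the hypothesis on
  \<open>square_fun\<close> does not apply to it as it stands; freezing the cut-off on each ball of
  the cover repairs this. The size of the kernel alone cannot give the result: its
  \<open>L^q(dt/t)\<close> norm is of order \<open>|x - y|^(-d)\<close>, which is not integrable
  near the diagonal. All cancellation there has to come from the hypothesis, and only the part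
  beyond the distance \<open>\<rho> x\<close> is estimated absolutely. The moving cut-off also makes
  measurability in \<open>x\<close> a real question. It needs \<open>\<rho>\<close> to be Borel,
  which is why the semicontinuity of \<open>\<rho>\<close> is proved. It is settled for simple
  functions, whose Poisson integrals are finite sums of vectors with scalar coefficients, before
  passing to the limit. Continuity in \<open>t\<close> away from 0 then reduces statements about
  functions of \<open>x\<close> and \<open>t\<close> to countably many times.\<close>

lemma epowr_ennreal: "0 \<le> a \<Longrightarrow> epowr (ennreal a) r = ennreal (a powr r)"
  by (simp add: epowr_def)

lemma epowr_top [simp]: "epowr top r = top"
  by (simp add: epowr_def)

lemma epowr_0 [simp]: "epowr 0 r = 0"
  by (simp add: epowr_def)

lemma epowr_one [simp]: "epowr a 1 = a"
  by (cases a) (simp_all add: epowr_ennreal)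

lemma epowr_mono: "a \<le> b \<Longrightarrow> 0 \<le> r \<Longrightarrow> epowr a r \<le> epowr b r"
  by (cases a; cases b) (auto simp: epowr_ennreal top_unique intro!: ennreal_leI powr_mono2)

lemma epowr_epowr: "epowr (epowr a r) s = epowr a (r * s)"
  by (cases a) (simp_all add: epowr_ennreal powr_powr)

lemma epowr_inverse [simp]: "0 < r \<Longrightarrow> epowr (epowr a r) (1 / r) = a"
  "0 < r \<Longrightarrow> epowr (epowr a (1 / r)) r = a"
  by (simp_all add: epowr_epowr)

text \<open>The product of 0 and \<open>top\<close> causes no exception: \<open>0 powr r = 0\<close>
  for every \<open>r\<close>, so both sides vanish, while a positive finite factor keeps a positive
  power.\<close>

lemma epowr_mult: "epowr (a * b) r = epowr a r * epowr b r"
proof (cases a; cases b)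
  fix x y :: real assume "a = ennreal x" "b = ennreal y" "0 \<le> x" "0 \<le> y"
  then show ?thesis
    by (simp add: epowr_ennreal powr_mult flip: ennreal_mult)
next
  fix x :: real assume "a = ennreal x" "b = top" "0 \<le> x"
  then show ?thesis
    by (cases "x = 0") (simp_all add: epowr_ennreal ennreal_mult_top)
next
  fix x :: real assume "b = ennreal x" "a = top" "0 \<le> x"
  then show ?thesis
    by (cases "x = 0") (simp_all add: epowr_ennreal ennreal_top_mult)
qed simp_all

lemma epowr_less_top [simp]: "epowr a r < top \<longleftrightarrow> a < top"
  by (cases a) (simp_all add: epowr_ennreal)

lemma epowr_eq_0 [simp]: "epowr a r = 0 \<longleftrightarrow> a = 0"
  by (cases a) (simp_all add: epowr_ennreal ennreal_eq_0_iff)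

lemma measurable_epowr [measurable]: "(\<lambda>x. epowr x r) \<in> borel_measurable borel"
  unfolding epowr_def by measurable

text \<open>Convexity of the power, applied to \<open>a + b\<close> written as the convex
  combination \<open>l * (a / l) + (1 - l) * (b / (1 - l))\<close>. The weight \<open>l\<close>
  stays free so that it can be optimized after integration, which yields the triangle inequality
  with constant 1.\<close>

lemma powr_add_le:
  fixes a b p l :: real
  assumes "1 \<le> p" "0 \<le> a" "0 \<le> b" "0 < l" "l < 1"
  shows "(a + b) powr p \<le> l powr (1 - p) * a powr p + (1 - l) powr (1 - p) * b powr p"
proof -
  have A: "l powr (1 - p) * a powr p = l * (a / l) powr p"
    using assms by (simp add: powr_divide powr_diff)
  have B: "(1 - l) powr (1 - p) * b powr p = (1 - l) * (b / (1 - l)) powr p"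
    using assms by (simp add: powr_divide powr_diff)
  consider "a = 0" | "b = 0" | "0 < a" "0 < b" using assms by linarith
  then show ?thesis
  proof cases
    case 1
    have "1 powr (1 - p) \<le> (1 - l) powr (1 - p)"
      by (rule powr_mono2') (use assms in auto)
    then have "1 * b powr p \<le> (1 - l) powr (1 - p) * b powr p"
      by (intro mult_right_mono) auto
    then show ?thesis using 1 assms by simp
  next
    case 2
    have "1 powr (1 - p) \<le> l powr (1 - p)"
      by (rule powr_mono2') (use assms in auto)
    then have "1 * a powr p \<le> l powr (1 - p) * a powr p"
      by (intro mult_right_mono) auto
    then show ?thesis using 2 assms by simp
  next
    case 3
    have "((1 - (1 - l)) *\<^sub>R (a / l) + (1 - l) *\<^sub>R (b / (1 - l))) powr p
        \<le> (1 - (1 - l)) * (a / l) powr p + (1 - l) * (b / (1 - l)) powr p"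
      using 3 assms by (intro convex_onD[OF powr_convex]) auto
    then show ?thesis unfolding A B using assms by simp
  qed
qed

lemma epowr_add_le:
  assumes "1 \<le> p" "0 < l" "l < 1"
  shows "epowr (a + b) p \<le> ennreal (l powr (1 - p)) * epowr a p + ennreal ((1 - l) powr (1 - p)) * epowr b p"
proof (cases a; cases b)
  fix x y :: real assume *: "a = ennreal x" "b = ennreal y" "0 \<le> x" "0 \<le> y"
  have "epowr (a + b) p = ennreal ((x + y) powr p)"
    using * by (simp add: epowr_ennreal flip: ennreal_plus)
  also have "\<dots> \<le> ennreal (l powr (1 - p) * x powr p + (1 - l) powr (1 - p) * y powr p)"
    using powr_add_le[OF assms(1) *(3,4) assms(2,3)] by (rule ennreal_leI)
  also have "\<dots> = ennreal (l powr (1 - p)) * epowr a p + ennreal ((1 - l) powr (1 - p)) * epowr b p"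
    using * by (simp add: epowr_ennreal ennreal_plus ennreal_mult)
  finally show ?thesis .
qed (use assms in \<open>simp_all add: ennreal_mult_top\<close>)

lemma epowr_add_le2:
  assumes "1 \<le> p"
  shows "epowr (a + b) p \<le> ennreal (2 powr (p - 1)) * (epowr a p + epowr b p)"
proof -
  have "(1/2) powr (1 - p) = (2::real) powr (p - 1)"
    by (simp add: powr_divide powr_diff)
  then show ?thesis
    using epowr_add_le[of p "1/2" a b] assms by (simp add: distrib_left)
qed

text \<open>For finite positive norms \<open>A\<close> and \<open>B\<close> of \<open>u\<close> and
  \<open>v\<close> the choice \<open>l = A / (A + B)\<close> in \<open>epowr_add_le\<close> makes
  the integrated bound equal to the \<open>p\<close>-th power of \<open>A + B\<close>. Zero norms
  are treated apart because \<open>l\<close> must lie strictly between 0 and 1.\<close>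

lemma epowr_nn_integral_add_le:
  assumes p: "1 \<le> p" and [measurable]: "u \<in> borel_measurable M" "v \<in> borel_measurable M"
  shows "epowr (\<integral>\<^sup>+x. epowr (u x + v x) p \<partial>M) (1 / p)
      \<le> epowr (\<integral>\<^sup>+x. epowr (u x) p \<partial>M) (1 / p) + epowr (\<integral>\<^sup>+x. epowr (v x) p \<partial>M) (1 / p)"
proof -
  define A where "A = epowr (\<integral>\<^sup>+x. epowr (u x) p \<partial>M) (1 / p)"
  define B where "B = epowr (\<integral>\<^sup>+x. epowr (v x) p \<partial>M) (1 / p)"
  have p0: "0 < p" using p by simp
  have A': "(\<integral>\<^sup>+x. epowr (u x) p \<partial>M) = epowr A p" and B': "(\<integral>\<^sup>+x. epowr (v x) p \<partial>M) = epowr B p"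
    using p0 by (simp_all add: A_def B_def)
  have main: "(\<integral>\<^sup>+x. epowr (u x + v x) p \<partial>M) \<le> epowr (A + B) p"
  proof -
    consider "A = top \<or> B = top" | "A = 0" | "B = 0"
      | a b where "A = ennreal a" "B = ennreal b" "0 < a" "0 < b"
      by (cases A; cases B) (auto simp: less_le)
    then show ?thesis
    proof cases
      case 1
      then have "epowr (A + B) p = top" by auto
      then show ?thesis by simp
    next
      case 2
      then have "AE x in M. u x = 0"
        using A' by (simp add: nn_integral_0_iff_AE)
      then have "(\<integral>\<^sup>+x. epowr (u x + v x) p \<partial>M) = (\<integral>\<^sup>+x. epowr (v x) p \<partial>M)"
        by (intro nn_integral_cong_AE) auto
      then show ?thesis using 2 B' by simp
    next
      case 3
      then have "AE x in M. v x = 0"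
        using B' by (simp add: nn_integral_0_iff_AE)
      then have "(\<integral>\<^sup>+x. epowr (u x + v x) p \<partial>M) = (\<integral>\<^sup>+x. epowr (u x) p \<partial>M)"
        by (intro nn_integral_cong_AE) auto
      then show ?thesis using 3 A' by simp
    next
      case 4
      define l where "l = a / (a + b)"
      have l: "0 < l" "l < 1" "1 - l = b / (a + b)"
        using 4 by (auto simp: l_def field_simps)
      have "(\<integral>\<^sup>+x. epowr (u x + v x) p \<partial>M)
          \<le> (\<integral>\<^sup>+x. ennreal (l powr (1 - p)) * epowr (u x) p + ennreal ((1 - l) powr (1 - p)) * epowr (v x) p \<partial>M)"
        by (intro nn_integral_mono epowr_add_le p l)
      also have "\<dots> = ennreal (l powr (1 - p)) * epowr A p + ennreal ((1 - l) powr (1 - p)) * epowr B p"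
        by (subst nn_integral_add) (simp_all add: nn_integral_cmult A' B')
      also have "\<dots> = ennreal (l powr (1 - p) * a powr p + (1 - l) powr (1 - p) * b powr p)"
        using 4 by (simp add: epowr_ennreal ennreal_plus ennreal_mult)
      also have "l powr (1 - p) * a powr p + (1 - l) powr (1 - p) * b powr p
          = l * (a / l) powr p + (1 - l) * (b / (1 - l)) powr p"
        using l(1,2) 4 by (simp add: powr_divide powr_diff)
      also have "a / l = a + b" using 4 by (simp add: l_def)
      also have "b / (1 - l) = a + b" using 4 by (simp add: l(3))
      also have "l * (a + b) powr p + (1 - l) * (a + b) powr p = (a + b) powr p"
        by (simp add: algebra_simps)
      also have "ennreal ((a + b) powr p) = epowr (A + B) p"
        using 4 by (simp add: epowr_ennreal flip: ennreal_plus)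
      finally show ?thesis .
    qed
  qed
  have "epowr (\<integral>\<^sup>+x. epowr (u x + v x) p \<partial>M) (1 / p) \<le> epowr (epowr (A + B) p) (1 / p)"
    using main p0 by (intro epowr_mono) auto
  then show ?thesis using p0 by (simp add: A_def B_def)
qed

section \<open>Strong measurability\<close>

lemma strongly_measurable_banach_iff:
  "strongly_measurable M banach_space f \<longleftrightarrow>
    (\<exists>s. (\<forall>i. simple_function M (s i)) \<and> (AE x in M. (\<lambda>i. s i x) \<longlonglongrightarrow> f x))"
proof -
  have "(\<lambda>i. ennreal (norm (f x - s i x))) \<longlonglongrightarrow> 0 \<longleftrightarrow> (\<lambda>i. s i x) \<longlonglongrightarrow> f x" for s x
  proof -
    have "(\<lambda>i. ennreal (norm (f x - s i x))) \<longlonglongrightarrow> 0 \<longleftrightarrow> (\<lambda>i. norm (f x - s i x)) \<longlonglongrightarrow> 0"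
      using tendsto_ennreal_iff[of "\<lambda>i. norm (f x - s i x)" sequentially 0] by simp
    also have "\<dots> \<longleftrightarrow> (\<lambda>i. s i x) \<longlonglongrightarrow> f x"
      by (subst (2) tendsto_dist_iff) (simp add: dist_norm norm_minus_commute)
    finally show ?thesis .
  qed
  then show ?thesis
    by (simp add: strongly_measurable_def banach_space_def)
qed

text \<open>Completeness enters here: the preimages under \<open>f\<close> and \<open>g\<close>
  differ only on a null set, and such a difference is measurable.\<close>

lemma (in complete_measure) borel_measurable_AE_cong:
  assumes f: "f \<in> borel_measurable M" and ae: "AE x in M. f x = g x"
  shows "g \<in> borel_measurable M"
proof (rule measurableI)
  fix A :: "'b set" assume A: "A \<in> sets borel"
  have 1: "f -` A \<inter> space M \<in> sets M" using f A by (rule measurable_sets)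
  have 2: "AE x in M. x \<in> f -` A \<inter> space M \<longleftrightarrow> x \<in> g -` A \<inter> space M"
    using ae by eventually_elim auto
  show "g -` A \<inter> space M \<in> sets M"
    by (rule in_sets_AE[OF 2 1]) auto
qed simp

lemma (in complete_measure) borel_measurable_LIMSEQ_AE:
  fixes f :: "nat \<Rightarrow> 'a \<Rightarrow> real"
  assumes [measurable]: "\<And>i. f i \<in> borel_measurable M" and lim: "AE x in M. (\<lambda>i. f i x) \<longlonglongrightarrow> g x"
  shows "g \<in> borel_measurable M"
proof (rule borel_measurable_AE_cong)
  show "(\<lambda>x. lim (\<lambda>i. f i x)) \<in> borel_measurable M" by measurable
  show "AE x in M. lim (\<lambda>i. f i x) = g x"
    using lim by eventually_elim (rule limI)
qed

text \<open>Pettis' criterion: project onto the nearest of the first \<open>n\<close> points of a dense sequence.\<close>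

lemma strongly_measurableI_dense:
  fixes d :: "nat \<Rightarrow> 'y::minus"
  assumes d: "\<And>i. d i \<in> carrier_of Y"
    and meas [measurable]: "\<And>i. (\<lambda>x. norm_of Y (F x - d i)) \<in> borel_measurable M"
    and carr: "AE x in M. F x \<in> carrier_of Y"
    and dense: "AE x in M. \<forall>e>0. \<exists>i. norm_of Y (F x - d i) < e"
  shows "strongly_measurable M Y F"
proof -
  \<comment> \<open>Among the nearest of the points \<open>d 0, ..., d n\<close> the one of least
    index is taken. This fixes the choice measurably, and as the index is at most \<open>n\<close>
    the projection has finite range.\<close>
  define k where "k n x = (LEAST i. i \<le> n \<and> (\<forall>j\<le>n. norm_of Y (F x - d i) \<le> norm_of Y (F x - d j)))" for n :: nat and x
  have k: "k n x \<le> n \<and> (\<forall>j\<le>n. norm_of Y (F x - d (k n x)) \<le> norm_of Y (F x - d j))" for n x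
  proof -
    let ?v = "\<lambda>i. norm_of Y (F x - d i)"
    have "\<exists>i. i \<le> n \<and> (\<forall>j\<le>n. ?v i \<le> ?v j)"
    proof -
      have "Min (?v ` {..n}) \<in> ?v ` {..n}" by (intro Min_in) auto
      then obtain i where i: "Min (?v ` {..n}) = ?v i" "i \<in> {..n}" by (rule imageE)
      have "?v i \<le> ?v j" if "j \<le> n" for j
        unfolding i(1)[symmetric] using that by (intro Min_le) auto
      then show ?thesis using i by auto
    qed
    then show ?thesis unfolding k_def by (rule LeastI_ex)
  qed
  have [measurable]: "k n \<in> measurable M (count_space UNIV)" for n
    unfolding k_def by measurable
  have simple: "simple_function M (\<lambda>x. d (k n x))" for n
  proof -
    have "finite (k n ` space M)"
      by (rule finite_subset[of _ "{..n}"]) (use k in auto)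
    moreover have "k n -` {i} \<inter> space M \<in> sets M" for i
      by (rule measurable_sets[where A = "count_space UNIV"]) auto
    ultimately have "simple_function M (k n)" by (simp add: simple_function_def)
    from simple_function_compose[OF this, of d] show ?thesis by (simp add: comp_def)
  qed
  have "AE x in M. (\<lambda>n. norm_of Y (F x - d (k n x))) \<longlonglongrightarrow> 0"
    using dense
  proof eventually_elim
    case (elim x)
    show ?case
    proof (rule order_tendstoI)
      fix e :: ennreal assume "0 < e"
      then obtain i where i: "norm_of Y (F x - d i) < e" using elim by auto
      have "norm_of Y (F x - d (k n x)) < e" if "i \<le> n" for n
        using k[of n x] that i by (meson le_less_trans)
      then show "\<forall>\<^sub>F n in sequentially. norm_of Y (F x - d (k n x)) < e"
        by (auto simp: eventually_sequentially)
    qed simp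
  qed
  then show ?thesis
    unfolding strongly_measurable_def using carr simple d
    by (intro conjI exI[of _ "\<lambda>n x. d (k n x)"]) auto
qed

text \<open>The essential separability of the range: simple functions have finite ranges, so
  countably many of them have a countable union of ranges.
  \<open>strongly_measurable_banachI\<close> goes the opposite way.\<close>

lemma strongly_measurable_AE_closure:
  assumes "strongly_measurable M banach_space f"
  obtains D where "countable D" "AE x in M. f x \<in> closure D"
proof -
  obtain s where s: "\<And>i. simple_function M (s i)" and lim: "AE x in M. (\<lambda>i. s i x) \<longlonglongrightarrow> f x"
    using assms by (auto simp: strongly_measurable_banach_iff)
  have "countable (\<Union>i. s i ` space M)"
    using s by (auto simp: simple_function_def intro: countable_finite)
  moreover have "AE x in M. f x \<in> closure (\<Union>i. s i ` space M)"
    using lim AE_space by eventually_elim (force simp: closure_sequential)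
  ultimately show ?thesis using that by blast
qed

section \<open>Closure properties of strong measurability\<close>

context
  fixes M :: "'m measure"
begin

lemma strongly_measurable_simple:
  "simple_function M f \<Longrightarrow> strongly_measurable M banach_space f"
  unfolding strongly_measurable_banach_iff by (intro exI[of _ "\<lambda>_. f"]) auto

lemma strongly_measurable_const [simp]: "strongly_measurable M banach_space (\<lambda>_. c)"
  by (rule strongly_measurable_simple) simp

lemma strongly_measurable_add:
  assumes "strongly_measurable M banach_space f" "strongly_measurable M banach_space g"
  shows "strongly_measurable M banach_space (\<lambda>x. f x + g x)"
proof -
  obtain s where s: "\<And>i. simple_function M (s i)" "AE x in M. (\<lambda>i. s i x) \<longlonglongrightarrow> f x"
    using assms(1) by (auto simp: strongly_measurable_banach_iff)
  obtain u where u: "\<And>i. simple_function M (u i)" "AE x in M. (\<lambda>i. u i x) \<longlonglongrightarrow> g x"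
    using assms(2) by (auto simp: strongly_measurable_banach_iff)
  have "AE x in M. (\<lambda>i. s i x + u i x) \<longlonglongrightarrow> f x + g x"
    using s(2) u(2) by eventually_elim (rule tendsto_add)
  then show ?thesis
    unfolding strongly_measurable_banach_iff using s(1) u(1)
    by (intro exI[of _ "\<lambda>i x. s i x + u i x"]) auto
qed

lemma strongly_measurable_scaleR:
  fixes c :: "'m \<Rightarrow> real"
  assumes c: "c \<in> borel_measurable M" and f: "strongly_measurable M banach_space f"
  shows "strongly_measurable M banach_space (\<lambda>x. c x *\<^sub>R f x)"
proof -
  obtain s where s: "\<And>i. simple_function M (s i)" "AE x in M. (\<lambda>i. s i x) \<longlonglongrightarrow> f x"
    using f by (auto simp: strongly_measurable_banach_iff)
  obtain u where u: "\<And>i. simple_function M (u i)" "\<forall>x\<in>space M. (\<lambda>i. u i x) \<longlonglongrightarrow> c x"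
    using borel_measurable_implies_sequence_metric[OF c, of 0] by auto
  have "AE x in M. (\<lambda>i. u i x *\<^sub>R s i x) \<longlonglongrightarrow> c x *\<^sub>R f x"
    using s(2) AE_space by eventually_elim (use u(2) in \<open>auto intro: tendsto_scaleR\<close>)
  moreover have "simple_function M (\<lambda>x. u i x *\<^sub>R s i x)" for i
    by (rule simple_function_compose2[OF u(1) s(1)])
  ultimately show ?thesis
    unfolding strongly_measurable_banach_iff
    by (intro exI[of _ "\<lambda>i x. u i x *\<^sub>R s i x"]) auto
qed

lemma strongly_measurable_diff:
  assumes "strongly_measurable M banach_space f" "strongly_measurable M banach_space g"
  shows "strongly_measurable M banach_space (\<lambda>x. f x - g x)"
  using strongly_measurable_add[OF assms(1) strongly_measurable_scaleR[OF _ assms(2), of "\<lambda>_. -1"]]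
  by simp

lemma strongly_measurable_sum:
  assumes "finite I" "\<And>i. i \<in> I \<Longrightarrow> strongly_measurable M banach_space (f i)"
  shows "strongly_measurable M banach_space (\<lambda>x. \<Sum>i\<in>I. f i x)"
  using assms by (induction I rule: finite_induct) (auto intro: strongly_measurable_add)

end

lemma (in complete_measure) strongly_measurable_norm:
  assumes "strongly_measurable M banach_space f"
  shows "(\<lambda>x. norm (f x)) \<in> borel_measurable M"
proof -
  obtain s where s: "\<And>i. simple_function M (s i)" "AE x in M. (\<lambda>i. s i x) \<longlonglongrightarrow> f x"
    using assms by (auto simp: strongly_measurable_banach_iff)
  show ?thesis
  proof (rule borel_measurable_LIMSEQ_AE)
    show "(\<lambda>x. norm (s i x)) \<in> borel_measurable M" for i
      by (rule borel_measurable_simple_function[OF simple_function_compose1[OF s(1)]])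
    show "AE x in M. (\<lambda>i. norm (s i x)) \<longlonglongrightarrow> norm (f x)"
      using s(2) by eventually_elim (rule tendsto_norm)
  qed
qed

lemma strongly_measurable_banachI:
  fixes f :: "'m \<Rightarrow> 'x::banach"
  assumes D: "countable D" and ae: "AE x in M. f x \<in> closure D"
    and meas: "\<And>v. (\<lambda>x. norm (f x - v)) \<in> borel_measurable M"
  shows "strongly_measurable M banach_space f"
proof (cases "D = {}")
  case True
  then have "AE x in M. False" using ae by simp
  then show ?thesis unfolding strongly_measurable_banach_iff
    by (intro exI[of _ "\<lambda>_ _. 0"]) (auto elim: eventually_mono)
next
  case False
  show ?thesis
  proof (rule strongly_measurableI_dense)
    show "from_nat_into D i \<in> carrier_of banach_space" for i :: nat
      by (simp add: banach_space_def)
    show "(\<lambda>x. norm_of banach_space (f x - from_nat_into D i)) \<in> borel_measurable M" for i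
      using meas by (simp add: banach_space_def)
    show "AE x in M. \<forall>e>0. \<exists>i. norm_of banach_space (f x - from_nat_into D i) < e"
      using ae
    proof eventually_elim
      case (elim x)
      show ?case
      proof (intro allI impI)
        fix e :: ennreal assume "0 < e"
        then obtain e' where e': "0 < e'" "ennreal e' \<le> e"
          by (cases e) (auto intro: that[of 1])
        then obtain y where y: "y \<in> D" "dist y (f x) < e'"
          using elim by (auto simp: closure_approachable)
        then obtain i where "y = from_nat_into D i"
          using from_nat_into_surj[OF D] by metis
        moreover have "ennreal (norm (f x - y)) < ennreal e'"
          using y by (simp add: dist_norm norm_minus_commute ennreal_less_iff)
        ultimately have "norm_of banach_space (f x - from_nat_into D i) < e"
          using e' by (auto simp: banach_space_def)
        then show "\<exists>i. norm_of banach_space (f x - from_nat_into D i) < e" ..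
      qed
    qed
  qed (simp add: banach_space_def)
qed

text \<open>Convergence is only pointwise and without a rate, so simple approximants of the
  \<open>f i\<close> cannot simply be selected along a diagonal. The two conditions of Pettis'
  criterion, an essentially separable range and measurable distances, do pass to the limit.\<close>

lemma (in complete_measure) strongly_measurable_LIMSEQ:
  assumes f: "\<And>i. strongly_measurable M banach_space (f i)"
    and lim: "AE x in M. (\<lambda>i. f i x) \<longlonglongrightarrow> g x"
  shows "strongly_measurable M banach_space g"
proof -
  have "\<exists>D. countable D \<and> (AE x in M. f i x \<in> closure D)" for i
    using strongly_measurable_AE_closure[OF f] by metis
  then obtain D where D: "\<And>i. countable (D i)" "\<And>i. AE x in M. f i x \<in> closure (D i)"
    by metis
  show ?thesis
  proof (rule strongly_measurable_banachI)
    show "countable (\<Union>i. D i)" using D by auto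
    have "AE x in M. \<forall>i. f i x \<in> closure (D i)" using D by (simp add: AE_all_countable)
    then show "AE x in M. g x \<in> closure (\<Union>i. D i)"
      using lim
    proof eventually_elim
      case (elim x)
      have "closure (D i) \<subseteq> closure (\<Union>i. D i)" for i by (rule closure_mono) auto
      then have "f i x \<in> closure (\<Union>i. D i)" for i using elim by blast
      then show ?case using elim(2) by (rule closed_sequentially[OF closed_closure])
    qed
    show "(\<lambda>x. norm (g x - v)) \<in> borel_measurable M" for v
    proof (rule borel_measurable_LIMSEQ_AE)
      show "(\<lambda>x. norm (f i x - v)) \<in> borel_measurable M" for i
        by (intro strongly_measurable_norm strongly_measurable_diff f strongly_measurable_const)
      show "AE x in M. (\<lambda>i. norm (f i x - v)) \<longlonglongrightarrow> norm (g x - v)"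
        using lim by eventually_elim (intro tendsto_intros)
    qed
  qed
qed

lemma (in complete_measure) strongly_measurable_dominated_sequence:
  assumes f: "strongly_measurable M banach_space f"
  obtains s where "\<And>i. simple_function M (s i)" "AE x in M. (\<lambda>i. s i x) \<longlonglongrightarrow> f x"
    "\<And>i x. x \<in> space M \<Longrightarrow> norm (s i x) \<le> 2 * norm (f x)"
proof -
  obtain s where s: "\<And>i. simple_function M (s i)" "AE x in M. (\<lambda>i. s i x) \<longlonglongrightarrow> f x"
    using f by (auto simp: strongly_measurable_banach_iff)
  \<comment> \<open>The factor 2 leaves a strict margin: where \<open>f x\<close> is nonzero the
    truncation is eventually inactive because the norms converge, and where \<open>f x = 0\<close>
    it forces the value 0.\<close>
  define u where "u i x = (if norm (s i x) \<le> 2 * norm (f x) then s i x else 0)" for i x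
  show ?thesis
  proof (rule that)
    have [measurable]: "(\<lambda>x. norm (f x)) \<in> borel_measurable M"
      by (rule strongly_measurable_norm[OF f])
    have [measurable]: "(\<lambda>x. norm (s i x)) \<in> borel_measurable M" for i
      by (rule borel_measurable_simple_function[OF simple_function_compose1[OF s(1)]])
    show "simple_function M (u i)" for i
      unfolding u_def by (intro simple_function_If s) simp_all
    show "norm (u i x) \<le> 2 * norm (f x)" for i x
      by (simp add: u_def)
    show "AE x in M. (\<lambda>i. u i x) \<longlonglongrightarrow> f x"
      using s(2)
    proof eventually_elim
      case (elim x)
      show ?case
      proof (cases "f x = 0")
        case True
        then have "u i x = 0" for i by (auto simp: u_def)
        then show ?thesis using True by simp
      next
        case False
        then have "\<forall>\<^sub>F i in sequentially. norm (s i x) < 2 * norm (f x)"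
          using order_tendstoD(2)[OF tendsto_norm[OF elim], of "2 * norm (f x)"] by simp
        then have "\<forall>\<^sub>F i in sequentially. s i x = u i x"
          by eventually_elim (simp add: u_def)
        then show ?thesis using elim by (rule Lim_transform_eventually[rotated])
      qed
    qed
  qed
qed

section \<open>The Bochner integral\<close>

definition bochner_integrable :: "'m measure \<Rightarrow> ('m \<Rightarrow> 'x::banach) \<Rightarrow> bool" where
  "bochner_integrable M f \<longleftrightarrow>
    strongly_measurable M banach_space f \<and> (\<integral>\<^sup>+x. ennreal (norm (f x)) \<partial>M) < \<infinity>"

abbreviation "simple_bochner_integrable \<equiv> Bochner_Integration.simple_bochner_integrable"
abbreviation "simple_bochner_integral \<equiv> Bochner_Integration.simple_bochner_integral"

context complete_measure
begin

lemma measurable_norm_diff_simple: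
  assumes "strongly_measurable M banach_space f" "simple_bochner_integrable M s"
  shows "(\<lambda>x. norm (f x - s x)) \<in> borel_measurable M"
proof -
  have "simple_function M s" using assms(2) by (auto elim: simple_bochner_integrable.cases)
  then show ?thesis
    by (intro strongly_measurable_norm strongly_measurable_diff assms(1) strongly_measurable_simple)
qed

text \<open>With \<open>f\<close> as intermediary this single estimate gives uniqueness of the
  integral, its norm bound (for \<open>t = 0\<close>) and the Cauchy property that yields
  existence.\<close>

lemma simple_bochner_integral_dist_le:
  assumes f: "strongly_measurable M banach_space f"
    and s: "simple_bochner_integrable M s" and t: "simple_bochner_integrable M t"
  shows "ennreal (norm (simple_bochner_integral M s - simple_bochner_integral M t)) \<le>
    (\<integral>\<^sup>+ x. ennreal (norm (f x - s x)) \<partial>M) + (\<integral>\<^sup>+ x. ennreal (norm (f x - t x)) \<partial>M)"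
    (is "ennreal (norm (?s - ?t)) \<le> ?S + ?T")
proof -
  note [measurable] = measurable_norm_diff_simple[OF f s] measurable_norm_diff_simple[OF f t]
  have "ennreal (norm (?s - ?t)) = norm (simple_bochner_integral M (\<lambda>x. s x - t x))"
    using s t by (subst simple_bochner_integral_diff) auto
  also have "\<dots> \<le> simple_bochner_integral M (\<lambda>x. norm (s x - t x))"
    using simple_bochner_integrable_compose2[of "(-)" M "s" "t"] s t
    by (auto intro!: simple_bochner_integral_norm_bound)
  also have "\<dots> = (\<integral>\<^sup>+x. norm (s x - t x) \<partial>M)"
    using simple_bochner_integrable_compose2[of "\<lambda>x y. norm (x - y)" M "s" "t"] s t
    by (auto intro!: simple_bochner_integral_eq_nn_integral)
  also have "\<dots> \<le> (\<integral>\<^sup>+x. ennreal (norm (f x - s x)) + ennreal (norm (f x - t x)) \<partial>M)"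
  proof (rule nn_integral_mono)
    fix x
    have "norm (s x - t x) \<le> norm (f x - s x) + norm (f x - t x)"
      by (metis dual_order.refl norm_diff_triangle_le norm_minus_commute)
    then show "ennreal (norm (s x - t x)) \<le> ennreal (norm (f x - s x)) + ennreal (norm (f x - t x))"
      by (simp flip: ennreal_plus)
  qed
  also have "\<dots> = ?S + ?T"
    by (rule nn_integral_add) auto
  finally show ?thesis .
qed

lemma has_banach_integral_unique:
  assumes "has_banach_integral M f I" "has_banach_integral M f J"
  shows "I = J"
proof -
  obtain s where f: "strongly_measurable M banach_space f"
    and s: "\<And>i. simple_bochner_integrable M (s i)"
      "(\<lambda>i. \<integral>\<^sup>+x. ennreal (norm (f x - s i x)) \<partial>M) \<longlonglongrightarrow> 0"
      "(\<lambda>i. simple_bochner_integral M (s i)) \<longlonglongrightarrow> I"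
    using assms(1) unfolding has_banach_integral_def by blast
  obtain t where t: "\<And>i. simple_bochner_integrable M (t i)"
      "(\<lambda>i. \<integral>\<^sup>+x. ennreal (norm (f x - t i x)) \<partial>M) \<longlonglongrightarrow> 0"
      "(\<lambda>i. simple_bochner_integral M (t i)) \<longlonglongrightarrow> J"
    using assms(2) unfolding has_banach_integral_def by blast
  let ?d = "\<lambda>i. norm (simple_bochner_integral M (s i) - simple_bochner_integral M (t i))"
  have "(\<lambda>i. ennreal (?d i)) \<longlonglongrightarrow> 0"
  proof (rule tendsto_sandwich[OF _ _ tendsto_const])
    show "\<forall>\<^sub>F i in sequentially. ennreal (?d i) \<le>
        (\<integral>\<^sup>+x. ennreal (norm (f x - s i x)) \<partial>M) + (\<integral>\<^sup>+x. ennreal (norm (f x - t i x)) \<partial>M)"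
      by (intro always_eventually allI simple_bochner_integral_dist_le f s t)
    show "(\<lambda>i. (\<integral>\<^sup>+x. ennreal (norm (f x - s i x)) \<partial>M) + (\<integral>\<^sup>+x. ennreal (norm (f x - t i x)) \<partial>M)) \<longlonglongrightarrow> 0"
      using tendsto_add[OF s(2) t(2)] by simp
  qed simp
  then have "?d \<longlonglongrightarrow> 0"
    by (simp flip: ennreal_0)
  moreover have "?d \<longlonglongrightarrow> norm (I - J)"
    by (intro tendsto_intros s t)
  ultimately have "norm (I - J) = 0" by (rule LIMSEQ_unique[rotated])
  then show ?thesis by simp
qed

lemma banach_integral_eq: "has_banach_integral M f I \<Longrightarrow> banach_integral M f = I"
  unfolding banach_integral_def using has_banach_integral_unique by (auto intro!: the_equality)

lemma has_banach_integral_norm_le: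
  assumes "has_banach_integral M f I"
  shows "ennreal (norm I) \<le> (\<integral>\<^sup>+x. ennreal (norm (f x)) \<partial>M)"
proof -
  obtain s where f: "strongly_measurable M banach_space f"
    and s: "\<And>i. simple_bochner_integrable M (s i)"
      "(\<lambda>i. \<integral>\<^sup>+x. ennreal (norm (f x - s i x)) \<partial>M) \<longlonglongrightarrow> 0"
      "(\<lambda>i. simple_bochner_integral M (s i)) \<longlonglongrightarrow> I"
    using assms unfolding has_banach_integral_def by blast
  have 0: "simple_bochner_integrable M (\<lambda>_. 0)"
    by (auto intro: simple_bochner_integrable.intros)
  have [simp]: "simple_bochner_integral M (\<lambda>_. 0) = 0"
    by (auto simp: simple_bochner_integral_def intro!: sum.neutral)
  have "(\<lambda>i. ennreal (norm (simple_bochner_integral M (s i)))) \<longlonglongrightarrow> ennreal (norm I)"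
    by (intro tendsto_intros s)
  moreover have "(\<lambda>i. (\<integral>\<^sup>+x. ennreal (norm (f x - s i x)) \<partial>M) + (\<integral>\<^sup>+x. ennreal (norm (f x)) \<partial>M))
      \<longlonglongrightarrow> 0 + (\<integral>\<^sup>+x. ennreal (norm (f x)) \<partial>M)"
    by (intro tendsto_add s tendsto_const)
  moreover have "ennreal (norm (simple_bochner_integral M (s i)))
      \<le> (\<integral>\<^sup>+x. ennreal (norm (f x - s i x)) \<partial>M) + (\<integral>\<^sup>+x. ennreal (norm (f x)) \<partial>M)" for i
    using simple_bochner_integral_dist_le[OF f s(1) 0, of i] by simp
  ultimately have "ennreal (norm I) \<le> 0 + (\<integral>\<^sup>+x. ennreal (norm (f x)) \<partial>M)"
    by (intro LIMSEQ_le[of "\<lambda>i. ennreal (norm (simple_bochner_integral M (s i)))"]) blast+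
  then show ?thesis by simp
qed

lemma has_banach_integral_add:
  assumes "has_banach_integral M f I" "has_banach_integral M g J"
  shows "has_banach_integral M (\<lambda>x. f x + g x) (I + J)"
proof -
  obtain s where f: "strongly_measurable M banach_space f"
    and s: "\<And>i. simple_bochner_integrable M (s i)"
      "(\<lambda>i. \<integral>\<^sup>+x. ennreal (norm (f x - s i x)) \<partial>M) \<longlonglongrightarrow> 0"
      "(\<lambda>i. simple_bochner_integral M (s i)) \<longlonglongrightarrow> I"
    using assms(1) unfolding has_banach_integral_def by blast
  obtain t where g: "strongly_measurable M banach_space g"
    and t: "\<And>i. simple_bochner_integrable M (t i)"
      "(\<lambda>i. \<integral>\<^sup>+x. ennreal (norm (g x - t i x)) \<partial>M) \<longlonglongrightarrow> 0"
      "(\<lambda>i. simple_bochner_integral M (t i)) \<longlonglongrightarrow> J"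
    using assms(2) unfolding has_banach_integral_def by blast
  note [measurable] = measurable_norm_diff_simple[OF f s(1)] measurable_norm_diff_simple[OF g t(1)]
  have "(\<lambda>i. \<integral>\<^sup>+x. ennreal (norm (f x + g x - (s i x + t i x))) \<partial>M) \<longlonglongrightarrow> 0"
  proof (rule tendsto_sandwich[OF _ _ tendsto_const])
    show "\<forall>\<^sub>F i in sequentially. (\<integral>\<^sup>+x. ennreal (norm (f x + g x - (s i x + t i x))) \<partial>M) \<le>
        (\<integral>\<^sup>+x. ennreal (norm (f x - s i x)) \<partial>M) + (\<integral>\<^sup>+x. ennreal (norm (g x - t i x)) \<partial>M)"
    proof (intro always_eventually allI)
      fix i
      have "(\<integral>\<^sup>+x. ennreal (norm (f x + g x - (s i x + t i x))) \<partial>M)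
          \<le> (\<integral>\<^sup>+x. ennreal (norm (f x - s i x)) + ennreal (norm (g x - t i x)) \<partial>M)"
        by (auto intro!: nn_integral_mono norm_diff_triangle_ineq simp flip: ennreal_plus)
      then show "(\<integral>\<^sup>+x. ennreal (norm (f x + g x - (s i x + t i x))) \<partial>M) \<le>
          (\<integral>\<^sup>+x. ennreal (norm (f x - s i x)) \<partial>M) + (\<integral>\<^sup>+x. ennreal (norm (g x - t i x)) \<partial>M)"
        by (simp add: nn_integral_add)
    qed
    show "(\<lambda>i. (\<integral>\<^sup>+x. ennreal (norm (f x - s i x)) \<partial>M) + (\<integral>\<^sup>+x. ennreal (norm (g x - t i x)) \<partial>M)) \<longlonglongrightarrow> 0"
      using tendsto_add[OF s(2) t(2)] by simp
  qed simp
  moreover have "(\<lambda>i. simple_bochner_integral M (\<lambda>x. s i x + t i x)) \<longlonglongrightarrow> I + J"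
    using tendsto_add[OF s(3) t(3)] s t by (simp add: simple_bochner_integral_add)
  moreover have "simple_bochner_integrable M (\<lambda>x. s i x + t i x)" for i
    using s t by (simp add: simple_bochner_integrable_compose2)
  ultimately show ?thesis
    unfolding has_banach_integral_def using strongly_measurable_add[OF f g]
    by (intro conjI exI[of _ "\<lambda>i x. s i x + t i x"]) auto
qed

lemma has_banach_integral_scaleR:
  assumes "has_banach_integral M f I"
  shows "has_banach_integral M (\<lambda>x. c *\<^sub>R f x) (c *\<^sub>R I)"
proof -
  obtain s where f: "strongly_measurable M banach_space f"
    and s: "\<And>i. simple_bochner_integrable M (s i)"
      "(\<lambda>i. \<integral>\<^sup>+x. ennreal (norm (f x - s i x)) \<partial>M) \<longlonglongrightarrow> 0"
      "(\<lambda>i. simple_bochner_integral M (s i)) \<longlonglongrightarrow> I"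
    using assms unfolding has_banach_integral_def by blast
  note [measurable] = measurable_norm_diff_simple[OF f s(1)]
  have "(\<lambda>i. ennreal \<bar>c\<bar> * (\<integral>\<^sup>+x. ennreal (norm (f x - s i x)) \<partial>M)) \<longlonglongrightarrow> ennreal \<bar>c\<bar> * 0"
    by (intro ennreal_tendsto_cmult s) simp
  then have "(\<lambda>i. \<integral>\<^sup>+x. ennreal (norm (c *\<^sub>R f x - c *\<^sub>R s i x)) \<partial>M) \<longlonglongrightarrow> 0"
    by (simp add: scaleR_diff_right[symmetric] ennreal_mult nn_integral_cmult)
  moreover have "(\<lambda>i. simple_bochner_integral M (\<lambda>x. c *\<^sub>R s i x)) \<longlonglongrightarrow> c *\<^sub>R I"
  proof -
    have "simple_bochner_integral M (\<lambda>x. c *\<^sub>R s i x) = c *\<^sub>R simple_bochner_integral M (s i)" for i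
      by (rule simple_bochner_integral_linear[OF _ s(1)]) simp
    then show ?thesis using s(3) by (auto intro: tendsto_intros)
  qed
  moreover have "simple_bochner_integrable M (\<lambda>x. c *\<^sub>R s i x)" for i
    using simple_bochner_integrable_compose2[of "\<lambda>x y. c *\<^sub>R x" M "s i" "s i"] s by simp
  ultimately show ?thesis
    unfolding has_banach_integral_def using strongly_measurable_scaleR[OF _ f, of "\<lambda>_. c"]
    by (intro conjI exI[of _ "\<lambda>i x. c *\<^sub>R s i x"]) auto
qed

text \<open>The bridge to scalar integration: scalar simple approximants of \<open>k\<close> times
  the fixed vector \<open>v\<close> are again simple. Through it the Poisson integral of a simple
  function becomes a finite sum with scalar coefficients.\<close>

lemma has_banach_integral_real_scaleR:
  fixes k :: "'a \<Rightarrow> real"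
  assumes "integrable M k"
  shows "has_banach_integral M (\<lambda>x. k x *\<^sub>R v) (integral\<^sup>L M k *\<^sub>R v)"
proof -
  have "has_bochner_integral M k (integral\<^sup>L M k)"
    using assms by (rule has_bochner_integral_integrable)
  then obtain s where k[measurable]: "k \<in> borel_measurable M"
    and s: "\<And>i. simple_bochner_integrable M (s i)"
      "(\<lambda>i. \<integral>\<^sup>+x. ennreal (norm (k x - s i x)) \<partial>M) \<longlonglongrightarrow> 0"
      "(\<lambda>i. simple_bochner_integral M (s i)) \<longlonglongrightarrow> integral\<^sup>L M k"
    unfolding has_bochner_integral.simps by blast
  have [measurable]: "s i \<in> borel_measurable M" for i
    using s(1)[of i] by (auto intro: borel_measurable_simple_function elim: simple_bochner_integrable.cases)
  have "(\<lambda>i. ennreal (norm v) * (\<integral>\<^sup>+x. ennreal (norm (k x - s i x)) \<partial>M)) \<longlonglongrightarrow> ennreal (norm v) * 0"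
    by (intro ennreal_tendsto_cmult s) simp
  then have "(\<lambda>i. \<integral>\<^sup>+x. ennreal (norm (k x *\<^sub>R v - s i x *\<^sub>R v)) \<partial>M) \<longlonglongrightarrow> 0"
    by (simp add: scaleR_diff_left[symmetric] ennreal_mult nn_integral_cmult mult.commute[of "ennreal \<bar>_\<bar>"])
  moreover have "(\<lambda>i. simple_bochner_integral M (\<lambda>x. s i x *\<^sub>R v)) \<longlonglongrightarrow> integral\<^sup>L M k *\<^sub>R v"
  proof -
    have "simple_bochner_integral M (\<lambda>x. s i x *\<^sub>R v) = simple_bochner_integral M (s i) *\<^sub>R v" for i
      by (rule simple_bochner_integral_linear[OF _ s(1)]) simp
    then show ?thesis using s(3) by (auto intro: tendsto_intros)
  qed
  moreover have "simple_bochner_integrable M (\<lambda>x. s i x *\<^sub>R v)" for i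
    using simple_bochner_integrable_compose2[of "\<lambda>x y. x *\<^sub>R v" M "s i" "s i"] s by simp
  ultimately show ?thesis
    unfolding has_banach_integral_def using strongly_measurable_scaleR[OF k, of "\<lambda>_. v"]
    by (intro conjI exI[of _ "\<lambda>i x. s i x *\<^sub>R v"]) auto
qed

lemma has_banach_integral_integrable:
  assumes "bochner_integrable M f"
  shows "has_banach_integral M f (banach_integral M f)"
proof -
  have f: "strongly_measurable M banach_space f" and fin: "(\<integral>\<^sup>+x. ennreal (norm (f x)) \<partial>M) < \<infinity>"
    using assms by (auto simp: bochner_integrable_def)
  obtain s where s: "\<And>i. simple_function M (s i)" "AE x in M. (\<lambda>i. s i x) \<longlonglongrightarrow> f x"
    "\<And>i x. x \<in> space M \<Longrightarrow> norm (s i x) \<le> 2 * norm (f x)"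
    using strongly_measurable_dominated_sequence[OF f] by blast
  have [measurable]: "(\<lambda>x. norm (f x)) \<in> borel_measurable M"
    by (rule strongly_measurable_norm[OF f])
  have int: "simple_bochner_integrable M (s i)" for i
  proof (rule simple_bochner_integrableI_bounded[OF s(1)])
    have "(\<integral>\<^sup>+x. ennreal (norm (s i x)) \<partial>M) \<le> (\<integral>\<^sup>+x. 2 * ennreal (norm (f x)) \<partial>M)"
    proof (rule nn_integral_mono)
      fix x assume "x \<in> space M"
      then have "ennreal (norm (s i x)) \<le> ennreal (2 * norm (f x))"
        by (intro ennreal_leI s(3))
      then show "ennreal (norm (s i x)) \<le> 2 * ennreal (norm (f x))"
        by (simp add: ennreal_mult)
    qed
    also have "\<dots> < \<infinity>" using fin by (simp add: nn_integral_cmult ennreal_mult_less_top)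
    finally show "(\<integral>\<^sup>+x. ennreal (norm (s i x)) \<partial>M) < \<infinity>" .
  qed
  note [measurable] = measurable_norm_diff_simple[OF f int]
  \<comment> \<open>The approximants are bounded by \<open>2 * norm (f x)\<close>, so their distance
    to \<open>f\<close> is dominated by \<open>3 * norm (f x)\<close>.\<close>
  have lim: "(\<lambda>i. \<integral>\<^sup>+x. ennreal (norm (f x - s i x)) \<partial>M) \<longlonglongrightarrow> (\<integral>\<^sup>+x. 0 \<partial>M)"
  proof (rule nn_integral_dominated_convergence[where w = "\<lambda>x. 3 * ennreal (norm (f x))"])
    show "AE x in M. ennreal (norm (f x - s i x)) \<le> 3 * ennreal (norm (f x))" for i
      using AE_space
    proof eventually_elim
      case (elim x)
      have "norm (f x - s i x) \<le> 3 * norm (f x)"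
        using norm_triangle_ineq4[of "f x" "s i x"] s(3)[OF elim, of i] by linarith
      then have "ennreal (norm (f x - s i x)) \<le> ennreal (3 * norm (f x))"
        by (rule ennreal_leI)
      then show ?case by (simp add: ennreal_mult)
    qed
    show "(\<integral>\<^sup>+x. 3 * ennreal (norm (f x)) \<partial>M) < \<infinity>"
      using fin by (simp add: nn_integral_cmult ennreal_mult_less_top)
    show "AE x in M. (\<lambda>i. ennreal (norm (f x - s i x))) \<longlonglongrightarrow> 0"
      using s(2)
    proof eventually_elim
      case (elim x)
      have "(\<lambda>i. ennreal (norm (f x - s i x))) \<longlonglongrightarrow> ennreal (norm (f x - f x))"
        by (intro tendsto_intros elim)
      then show ?case by simp
    qed
  qed auto
  \<comment> \<open>Completeness of the Banach space is used here: no candidate for the limit of the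
    integrals is known in advance.\<close>
  have "Cauchy (\<lambda>i. simple_bochner_integral M (s i))"
  proof (rule CauchyI)
    fix e :: real assume "0 < e"
    then have "\<forall>\<^sub>F i in sequentially. (\<integral>\<^sup>+x. ennreal (norm (f x - s i x)) \<partial>M) < ennreal (e / 2)"
      using lim by (intro order_tendstoD(2)) auto
    then obtain N where N: "\<And>i. N \<le> i \<Longrightarrow> (\<integral>\<^sup>+x. ennreal (norm (f x - s i x)) \<partial>M) < ennreal (e / 2)"
      by (auto simp: eventually_sequentially)
    have "norm (simple_bochner_integral M (s m) - simple_bochner_integral M (s n)) < e" if "N \<le> m" "N \<le> n" for m n
    proof -
      have "ennreal (norm (simple_bochner_integral M (s m) - simple_bochner_integral M (s n)))
          < ennreal (e / 2) + ennreal (e / 2)"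
        using simple_bochner_integral_dist_le[OF f int int, of m n] N[OF that(1)] N[OF that(2)]
        by (meson add_strict_mono le_less_trans)
      then show ?thesis using \<open>0 < e\<close> by (simp add: ennreal_less_iff flip: ennreal_plus)
    qed
    then show "\<exists>N. \<forall>m\<ge>N. \<forall>n\<ge>N. norm (simple_bochner_integral M (s m) - simple_bochner_integral M (s n)) < e"
      by blast
  qed
  then obtain I where "(\<lambda>i. simple_bochner_integral M (s i)) \<longlonglongrightarrow> I"
    using Cauchy_convergent by (auto simp: convergent_def)
  then have "has_banach_integral M f I"
    unfolding has_banach_integral_def using f int lim by auto
  then show ?thesis using banach_integral_eq by metis
qed

lemma bochner_integrable_add:
  assumes "bochner_integrable M f" "bochner_integrable M g"
  shows "bochner_integrable M (\<lambda>x. f x + g x)"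
proof -
  have f: "strongly_measurable M banach_space f" and g: "strongly_measurable M banach_space g"
    using assms by (auto simp: bochner_integrable_def)
  note [measurable] = strongly_measurable_norm[OF f] strongly_measurable_norm[OF g]
  have "(\<integral>\<^sup>+x. ennreal (norm (f x + g x)) \<partial>M) \<le> (\<integral>\<^sup>+x. ennreal (norm (f x)) + ennreal (norm (g x)) \<partial>M)"
    by (intro nn_integral_mono) (simp add: norm_triangle_ineq flip: ennreal_plus)
  also have "\<dots> < \<infinity>" using assms by (simp add: nn_integral_add bochner_integrable_def)
  finally show ?thesis by (simp add: bochner_integrable_def strongly_measurable_add[OF f g])
qed

lemma bochner_integrable_scaleR:
  assumes "bochner_integrable M f"
  shows "bochner_integrable M (\<lambda>x. c *\<^sub>R f x)"
proof -
  have f: "strongly_measurable M banach_space f" using assms by (auto simp: bochner_integrable_def)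
  note [measurable] = strongly_measurable_norm[OF f]
  have "(\<integral>\<^sup>+x. ennreal (norm (c *\<^sub>R f x)) \<partial>M) < \<infinity>"
    using assms by (simp add: nn_integral_cmult ennreal_mult bochner_integrable_def ennreal_mult_less_top)
  then show ?thesis
    using strongly_measurable_scaleR[OF _ f, of "\<lambda>_. c"] by (simp add: bochner_integrable_def)
qed

lemma banach_integral_add:
  assumes "bochner_integrable M f" "bochner_integrable M g"
  shows "banach_integral M (\<lambda>x. f x + g x) = banach_integral M f + banach_integral M g"
  using assms by (intro banach_integral_eq has_banach_integral_add has_banach_integral_integrable)

lemma banach_integral_scaleR:
  assumes "bochner_integrable M f"
  shows "banach_integral M (\<lambda>x. c *\<^sub>R f x) = c *\<^sub>R banach_integral M f"
  using assms by (intro banach_integral_eq has_banach_integral_scaleR has_banach_integral_integrable)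

lemma bochner_integrable_diff:
  assumes "bochner_integrable M f" "bochner_integrable M g"
  shows "bochner_integrable M (\<lambda>x. f x - g x)"
  using bochner_integrable_add[OF assms(1) bochner_integrable_scaleR[OF assms(2), of "-1"]] by simp

lemma banach_integral_diff:
  assumes "bochner_integrable M f" "bochner_integrable M g"
  shows "banach_integral M (\<lambda>x. f x - g x) = banach_integral M f - banach_integral M g"
  using banach_integral_add[OF assms(1) bochner_integrable_scaleR[OF assms(2), of "-1"]]
    banach_integral_scaleR[OF assms(2), of "-1"] by simp

lemma norm_banach_integral_le:
  assumes "bochner_integrable M f"
  shows "ennreal (norm (banach_integral M f)) \<le> (\<integral>\<^sup>+x. ennreal (norm (f x)) \<partial>M)"
  using assms by (intro has_banach_integral_norm_le has_banach_integral_integrable)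

lemma banach_integral_LIMSEQ:
  assumes f: "bochner_integrable M f" and s: "\<And>i. bochner_integrable M (s i)"
    and lim: "(\<lambda>i. \<integral>\<^sup>+x. ennreal (norm (s i x - f x)) \<partial>M) \<longlonglongrightarrow> 0"
  shows "(\<lambda>i. banach_integral M (s i)) \<longlonglongrightarrow> banach_integral M f"
proof -
  have "(\<lambda>i. ennreal (norm (banach_integral M (s i) - banach_integral M f))) \<longlonglongrightarrow> 0"
  proof (rule tendsto_sandwich[OF _ _ tendsto_const lim])
    show "\<forall>\<^sub>F i in sequentially. ennreal (norm (banach_integral M (s i) - banach_integral M f))
        \<le> (\<integral>\<^sup>+x. ennreal (norm (s i x - f x)) \<partial>M)"
      using norm_banach_integral_le[OF bochner_integrable_diff[OF s f]]
      by (simp add: banach_integral_diff[OF s f])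
  qed simp
  then have "(\<lambda>i. norm (banach_integral M (s i) - banach_integral M f)) \<longlonglongrightarrow> 0"
    by (simp flip: ennreal_0)
  then show ?thesis by (simp add: LIM_zero_iff tendsto_norm_zero_iff)
qed

lemma has_banach_integral_sum:
  fixes f :: "'i \<Rightarrow> 'a \<Rightarrow> 'x::banach"
  assumes "finite I" "\<And>i. i \<in> I \<Longrightarrow> has_banach_integral M (f i) (J i)"
  shows "has_banach_integral M (\<lambda>x. \<Sum>i\<in>I. f i x) (\<Sum>i\<in>I. J i)"
  using assms
proof (induction I rule: finite_induct)
  case empty
  have "has_banach_integral M (\<lambda>x. 0 *\<^sub>R (0::'x)) (integral\<^sup>L M (\<lambda>x. 0) *\<^sub>R 0)"
    by (rule has_banach_integral_real_scaleR) simp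
  then show ?case by simp
qed (auto intro: has_banach_integral_add)

end

section \<open>The Poisson kernel\<close>

text \<open>Up to normalization the Poisson kernel at \<open>z\<close>, for \<open>A = |z|^2\<close>
  and \<open>m = (d + 1) / 2\<close>. Treating \<open>A\<close> as a parameter makes all bounds in
  \<open>t\<close> uniform in the space variable.\<close>

definition pk :: "real \<Rightarrow> real \<Rightarrow> real \<Rightarrow> real" where
  "pk m A t = t * (t\<^sup>2 + A) powr - m"

definition pk_deriv :: "real \<Rightarrow> real \<Rightarrow> real \<Rightarrow> real" where
  "pk_deriv m A t = (t\<^sup>2 + A) powr - m - 2 * m * t\<^sup>2 * (t\<^sup>2 + A) powr (- m - 1)"

definition pk_deriv2 :: "real \<Rightarrow> real \<Rightarrow> real \<Rightarrow> real" where
  "pk_deriv2 m A t =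
     - 6 * m * t * (t\<^sup>2 + A) powr (- m - 1) + 4 * m * (m + 1) * t ^ 3 * (t\<^sup>2 + A) powr (- m - 2)"

lemma has_field_derivative_sq_powr:
  assumes "0 \<le> A" "0 < t"
  shows "((\<lambda>t. (t\<^sup>2 + A) powr k) has_real_derivative (2 * k * t * (t\<^sup>2 + A) powr (k - 1))) (at t within S)"
proof -
  have "0 < t\<^sup>2 + A" using assms by (simp add: add_pos_nonneg)
  from has_real_derivative_powr[OF this]
  have "((\<lambda>x. x powr k) has_real_derivative k * (t\<^sup>2 + A) powr (k - 1)) (at (t\<^sup>2 + A))" .
  moreover have "((\<lambda>t. t\<^sup>2 + A) has_real_derivative 2 * t) (at t within S)"
    by (rule derivative_eq_intros refl)+ simp
  ultimately show ?thesis
    by (rule DERIV_cong[OF DERIV_chain2]) simp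
qed

lemma pk_has_derivative:
  assumes "0 \<le> A" "0 < t"
  shows "(pk m A has_real_derivative pk_deriv m A t) (at t within S)"
  unfolding pk_def pk_deriv_def
  by (rule derivative_eq_intros has_field_derivative_sq_powr assms refl)+
    (simp add: power2_eq_square algebra_simps)

lemma pk_deriv_has_derivative:
  assumes "0 \<le> A" "0 < t"
  shows "(pk_deriv m A has_real_derivative pk_deriv2 m A t) (at t within S)"
  unfolding pk_deriv_def pk_deriv2_def
  by (rule derivative_eq_intros has_field_derivative_sq_powr assms refl)+
    (simp add: power2_eq_square power3_eq_cube algebra_simps)

text \<open>The reason why each derivative in \<open>t\<close> costs only a factor of order
  \<open>1 / t\<close>: a factor \<open>t\<^sup>2\<close> absorbs one negative power of
  \<open>t\<^sup>2 + A\<close>.\<close>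

lemma powr_sq_step:
  assumes "0 \<le> A" "0 < (t::real)"
  shows "t\<^sup>2 * (t\<^sup>2 + A) powr (k - 1) \<le> (t\<^sup>2 + A) powr k"
proof -
  have pos: "0 < t\<^sup>2 + A" using assms by (simp add: add_pos_nonneg)
  have "t\<^sup>2 * (t\<^sup>2 + A) powr (k - 1) \<le> (t\<^sup>2 + A) * (t\<^sup>2 + A) powr (k - 1)"
    using assms by (intro mult_right_mono) auto
  also have "\<dots> = (t\<^sup>2 + A) powr k" using pos by (simp add: powr_diff)
  finally show ?thesis .
qed

lemma pk_deriv_bound:
  assumes "0 \<le> A" "0 < t" "0 \<le> m"
  shows "\<bar>pk_deriv m A t\<bar> \<le> (1 + 2 * m) * (t\<^sup>2 + A) powr - m"
proof -
  have "2 * m * (t\<^sup>2 * (t\<^sup>2 + A) powr (- m - 1)) \<le> 2 * m * (t\<^sup>2 + A) powr - m"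
    using assms by (intro mult_left_mono powr_sq_step) auto
  moreover have "0 \<le> 2 * m * (t\<^sup>2 * (t\<^sup>2 + A) powr (- m - 1))" using assms by simp
  moreover have "0 \<le> (t\<^sup>2 + A) powr - m" "0 \<le> 2 * m * (t\<^sup>2 + A) powr - m" using assms by simp_all
  ultimately show ?thesis
    unfolding pk_deriv_def distrib_right mult.assoc[of "2 * m"] by linarith
qed

lemma pk_deriv2_bound:
  assumes A: "0 \<le> A" and t: "0 < t" and m: "0 \<le> m"
  shows "\<bar>pk_deriv2 m A t\<bar> \<le> (6 * m + 4 * m * (m + 1)) / t * (t\<^sup>2 + A) powr - m"
proof -
  define w where "w = (t\<^sup>2 + A) powr - m"
  define a where "a = t * (t\<^sup>2 + A) powr (- m - 1)"
  define b where "b = t ^ 3 * (t\<^sup>2 + A) powr (- m - 2)"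
  have a: "a \<le> w / t"
    using powr_sq_step[OF A t, of "- m"] t by (simp add: a_def w_def field_simps power2_eq_square)
  have "t * (t * (t\<^sup>2 * (t\<^sup>2 + A) powr ((- m - 1) - 1))) \<le> t * (t * (t\<^sup>2 + A) powr (- m - 1))"
    using t by (intro mult_left_mono powr_sq_step A) auto
  also have "\<dots> \<le> w" using powr_sq_step[OF A t, of "- m"] by (simp add: w_def power2_eq_square mult.assoc)
  finally have b: "b \<le> w / t"
    using t by (simp add: b_def w_def field_simps power2_eq_square power3_eq_cube)
  have "\<bar>pk_deriv2 m A t\<bar> = \<bar>- (6 * m * a) + 4 * m * (m + 1) * b\<bar>"
    by (simp add: pk_deriv2_def a_def b_def)
  also have "\<dots> \<le> 6 * m * a + 4 * m * (m + 1) * b"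
  proof -
    have "0 \<le> 6 * m * a" "0 \<le> 4 * m * (m + 1) * b" using t m by (simp_all add: a_def b_def)
    then show ?thesis by linarith
  qed
  also have "\<dots> \<le> 6 * m * (w / t) + 4 * m * (m + 1) * (w / t)"
    using a b m by (intro add_mono mult_left_mono) auto
  also have "\<dots> = (6 * m + 4 * m * (m + 1)) * (w / t)"
    by (simp only: distrib_right)
  finally show ?thesis by (simp add: w_def)
qed

lemma square_powr_half:
  assumes "0 < (t::real)"
  shows "(t\<^sup>2) powr - ((a + 1) / 2) = t powr - (a + 1)"
proof -
  have "(t\<^sup>2) powr - ((a + 1) / 2) = t powr (2 * - ((a + 1) / 2))"
    using assms by (simp add: powr_powr flip: powr_numeral)
  also have "2 * - ((a + 1) / 2) = - (a + 1)" by (simp add: field_simps)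
  finally show ?thesis .
qed

text \<open>The first factor is the constant of \<open>pk_deriv2_bound\<close>. The factors
  \<open>2 / t\<close> and \<open>4 powr m\<close> are the price of replacing a time
  \<open>v \<ge> t / 2\<close> by \<open>t\<close>, in the quotient and in the power
  respectively.\<close>

definition pk_const :: "real \<Rightarrow> real \<Rightarrow> real" where
  "pk_const m t = (6 * m + 4 * m * (m + 1)) * (2 / t) * 4 powr m"

lemma pk_deriv_lipschitz:
  assumes A: "0 \<le> A" and t: "0 < t" and m: "0 \<le> m" and u: "\<bar>u - t\<bar> \<le> t / 2"
  shows "\<bar>pk_deriv m A u - pk_deriv m A t\<bar> \<le> pk_const m t * (t\<^sup>2 + A) powr - m * \<bar>u - t\<bar>"
proof -
  have "norm (pk_deriv m A u - pk_deriv m A t) \<le> (pk_const m t * (t\<^sup>2 + A) powr - m) * norm (u - t)"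
  proof (rule field_differentiable_bound[where S = "{t/2..3*t/2}"])
    fix v assume v: "v \<in> {t/2..3*t/2}"
    then have v0: "0 < v" using t by auto
    show "(pk_deriv m A has_real_derivative pk_deriv2 m A v) (at v within {t/2..3*t/2})"
      by (rule pk_deriv_has_derivative[OF A v0])
    have "(t / 2)\<^sup>2 \<le> v\<^sup>2" using v t by (intro power_mono) auto
    then have "(t\<^sup>2 + A) / 4 \<le> v\<^sup>2 + A" using A by (simp add: power_divide)
    then have "(v\<^sup>2 + A) powr - m \<le> ((t\<^sup>2 + A) / 4) powr - m"
      using A t m by (intro powr_mono2') (auto simp: add_pos_nonneg)
    also have "\<dots> = 4 powr m * (t\<^sup>2 + A) powr - m"
      by (simp add: powr_divide powr_minus field_simps)
    finally have w: "(v\<^sup>2 + A) powr - m \<le> 4 powr m * (t\<^sup>2 + A) powr - m" .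
    have "\<bar>pk_deriv2 m A v\<bar> \<le> (6 * m + 4 * m * (m + 1)) / v * (v\<^sup>2 + A) powr - m"
      by (rule pk_deriv2_bound[OF A v0 m])
    also have "\<dots> \<le> (6 * m + 4 * m * (m + 1)) * (2 / t) * (4 powr m * (t\<^sup>2 + A) powr - m)"
    proof (rule mult_mono[OF _ w])
      have "(6 * m + 4 * m * (m + 1)) / v \<le> (6 * m + 4 * m * (m + 1)) / (t / 2)"
        using v t m by (intro divide_left_mono) auto
      then show "(6 * m + 4 * m * (m + 1)) / v \<le> (6 * m + 4 * m * (m + 1)) * (2 / t)"
        by simp
    qed (use t m in auto)
    finally show "norm (pk_deriv2 m A v) \<le> pk_const m t * (t\<^sup>2 + A) powr - m"
      by (simp add: pk_const_def mult.assoc)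
  next
    have "u - t \<le> t / 2" "- (u - t) \<le> t / 2" using u by linarith+
    then show "u \<in> {t/2..3*t/2}" by simp
    show "t \<in> {t/2..3*t/2}" using t by simp
  qed auto
  then show ?thesis by simp
qed

lemma pk_const_nonneg: "0 < t \<Longrightarrow> 0 \<le> m \<Longrightarrow> 0 \<le> pk_const m t"
  by (simp add: pk_const_def)

text \<open>The function \<open>pk m A v - v * pk_deriv m A t\<close> of \<open>v\<close> has the
  derivative \<open>pk_deriv m A v - pk_deriv m A t\<close>, which the Lipschitz bound makes small.
  The error contains the power at the fixed time \<open>t\<close> only, so it can be integrated
  against one and the same weight for all nearby \<open>u\<close>.\<close>

lemma pk_taylor:
  assumes A: "0 \<le> A" and t: "0 < t" and m: "0 \<le> m" and u: "\<bar>u - t\<bar> \<le> t / 2"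
  shows "\<bar>pk m A u - pk m A t - (u - t) * pk_deriv m A t\<bar> \<le> pk_const m t * (t\<^sup>2 + A) powr - m * (u - t)\<^sup>2"
proof -
  let ?g = "\<lambda>v. pk m A v - v * pk_deriv m A t"
  have "norm (?g u - ?g t) \<le> (pk_const m t * (t\<^sup>2 + A) powr - m * \<bar>u - t\<bar>) * norm (u - t)"
  proof (rule field_differentiable_bound[where S = "closed_segment t u"])
    fix v assume v: "v \<in> closed_segment t u"
    then have vt: "\<bar>v - t\<bar> \<le> \<bar>u - t\<bar>"
      by (auto simp: closed_segment_eq_real_ivl split: if_splits)
    then have v2: "\<bar>v - t\<bar> \<le> t / 2" using u by linarith
    then have v0: "0 < v" using t by linarith
    show "(?g has_real_derivative (pk_deriv m A v - pk_deriv m A t)) (at v within closed_segment t u)"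
      by (rule derivative_eq_intros pk_has_derivative[OF A v0] refl)+ simp
    have "\<bar>pk_deriv m A v - pk_deriv m A t\<bar> \<le> pk_const m t * (t\<^sup>2 + A) powr - m * \<bar>v - t\<bar>"
      by (rule pk_deriv_lipschitz[OF A t m v2])
    also have "\<dots> \<le> pk_const m t * (t\<^sup>2 + A) powr - m * \<bar>u - t\<bar>"
      using vt pk_const_nonneg[OF t m] by (intro mult_left_mono) auto
    finally show "norm (pk_deriv m A v - pk_deriv m A t) \<le> pk_const m t * (t\<^sup>2 + A) powr - m * \<bar>u - t\<bar>"
      by simp
  qed auto
  moreover have "?g u - ?g t = pk m A u - pk m A t - (u - t) * pk_deriv m A t"
    by (simp add: algebra_simps)
  moreover have "\<bar>u - t\<bar> * \<bar>u - t\<bar> = (u - t)\<^sup>2"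
    by (simp add: power2_eq_square)
  ultimately show ?thesis by (simp add: mult.assoc)
qed

text \<open>The common majorant, up to constants depending on \<open>t\<close>, of the kernel, its
  time derivative and the increments of both. It is bounded and decays like
  \<open>|z|^(-(d + 1))\<close>, one order better than the volume of balls grows.\<close>

definition weight :: "real \<Rightarrow> 'a::euclidean_space \<Rightarrow> real" where
  "weight t z = (t\<^sup>2 + (norm z)\<^sup>2) powr - ((real DIM('a) + 1) / 2)"

definition poisson_kernel_deriv :: "real \<Rightarrow> 'a::euclidean_space \<Rightarrow> real" where
  "poisson_kernel_deriv t z =
     poisson_const TYPE('a) * pk_deriv ((real DIM('a) + 1) / 2) ((norm z)\<^sup>2) t"

lemma poisson_kernel_eq:
  "poisson_kernel t (z::'a::euclidean_space) =
     poisson_const TYPE('a) * pk ((real DIM('a) + 1) / 2) ((norm z)\<^sup>2) t"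
  by (simp add: poisson_kernel_def pk_def powr_minus_divide)

definition kernel_const :: "'a::euclidean_space itself \<Rightarrow> real" where
  "kernel_const _ = \<bar>poisson_const TYPE('a)\<bar> * (real DIM('a) + 2)"

definition taylor_const :: "'a::euclidean_space itself \<Rightarrow> real \<Rightarrow> real" where
  "taylor_const _ t = \<bar>poisson_const TYPE('a)\<bar> * pk_const ((real DIM('a) + 1) / 2) t"

lemma kernel_const_nonneg: "0 \<le> kernel_const TYPE('a::euclidean_space)"
  by (simp add: kernel_const_def)

lemma taylor_const_nonneg: "0 < t \<Longrightarrow> 0 \<le> taylor_const TYPE('a::euclidean_space) t"
  by (simp add: taylor_const_def pk_const_nonneg)

lemma weight_nonneg [simp]: "0 \<le> weight t z"
  by (simp add: weight_def)

context
  fixes z :: "'a::euclidean_space" and t :: real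
  assumes t: "0 < t"
begin

lemma poisson_kernel_bound: "\<bar>poisson_kernel t z\<bar> \<le> \<bar>poisson_const TYPE('a)\<bar> * t * weight t z"
  using t by (simp add: poisson_kernel_eq pk_def weight_def abs_mult)

lemma poisson_kernel_deriv_bound: "\<bar>poisson_kernel_deriv t z\<bar> \<le> kernel_const TYPE('a) * weight t z"
proof -
  have "\<bar>pk_deriv ((real DIM('a) + 1) / 2) ((norm z)\<^sup>2) t\<bar>
      \<le> (1 + 2 * ((real DIM('a) + 1) / 2)) * weight t z"
    unfolding weight_def using t by (intro pk_deriv_bound) auto
  also have "1 + 2 * ((real DIM('a) + 1) / 2) = real DIM('a) + 2" by simp
  finally show ?thesis
    by (simp add: poisson_kernel_deriv_def kernel_const_def abs_mult mult.assoc mult_left_mono)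
qed

lemma poisson_kernel_taylor:
  assumes u: "\<bar>u - t\<bar> \<le> t / 2"
  shows "\<bar>poisson_kernel u z - poisson_kernel t z - (u - t) * poisson_kernel_deriv t z\<bar>
      \<le> taylor_const TYPE('a) t * (u - t)\<^sup>2 * weight t z"
proof -
  let ?m = "(real DIM('a) + 1) / 2" and ?c = "poisson_const TYPE('a)" and ?A = "(norm z)\<^sup>2"
  have "\<bar>poisson_kernel u z - poisson_kernel t z - (u - t) * poisson_kernel_deriv t z\<bar>
      = \<bar>?c\<bar> * \<bar>pk ?m ?A u - pk ?m ?A t - (u - t) * pk_deriv ?m ?A t\<bar>"
    by (simp add: poisson_kernel_eq poisson_kernel_deriv_def right_diff_distrib mult.left_commute flip: abs_mult)
  also have "\<dots> \<le> \<bar>?c\<bar> * (pk_const ?m t * (t\<^sup>2 + ?A) powr - ?m * (u - t)\<^sup>2)"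
    by (intro mult_left_mono pk_taylor t u) auto
  finally show ?thesis by (simp add: taylor_const_def weight_def mult_ac)
qed

lemma poisson_kernel_deriv_lipschitz:
  assumes u: "\<bar>u - t\<bar> \<le> t / 2"
  shows "\<bar>poisson_kernel_deriv u z - poisson_kernel_deriv t z\<bar>
      \<le> taylor_const TYPE('a) t * \<bar>u - t\<bar> * weight t z"
proof -
  let ?m = "(real DIM('a) + 1) / 2" and ?c = "poisson_const TYPE('a)" and ?A = "(norm z)\<^sup>2"
  have "\<bar>poisson_kernel_deriv u z - poisson_kernel_deriv t z\<bar>
      = \<bar>?c\<bar> * \<bar>pk_deriv ?m ?A u - pk_deriv ?m ?A t\<bar>"
    by (simp add: poisson_kernel_deriv_def right_diff_distrib flip: abs_mult)
  also have "\<dots> \<le> \<bar>?c\<bar> * (pk_const ?m t * (t\<^sup>2 + ?A) powr - ?m * \<bar>u - t\<bar>)"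
    by (intro mult_left_mono pk_deriv_lipschitz t u) auto
  finally show ?thesis by (simp add: taylor_const_def weight_def mult_ac)
qed

lemma weight_le: "weight t z \<le> t powr - (real DIM('a) + 1)"
proof -
  have "weight t z \<le> (t\<^sup>2) powr - ((real DIM('a) + 1) / 2)"
    unfolding weight_def using t by (intro powr_mono2') auto
  also have "(t\<^sup>2) powr - ((real DIM('a) + 1) / 2) = t powr - (real DIM('a) + 1)"
    by (rule square_powr_half[OF t])
  finally show ?thesis .
qed

lemma weight_antimono: "0 \<le> r \<Longrightarrow> r \<le> norm z \<Longrightarrow> weight t z \<le> (t\<^sup>2 + r\<^sup>2) powr - ((real DIM('a) + 1) / 2)"
  unfolding weight_def using t by (intro powr_mono2') (auto simp: add_pos_nonneg power_mono)

end

lemma weight_measurable [measurable]: "(\<lambda>z::'a::euclidean_space. weight t z) \<in> borel_measurable borel"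
  unfolding weight_def by measurable

lemma poisson_kernel_measurable [measurable]:
  "(\<lambda>z::'a::euclidean_space. poisson_kernel t z) \<in> borel_measurable borel"
  unfolding poisson_kernel_def by measurable

lemma poisson_kernel_deriv_measurable [measurable]:
  "(\<lambda>z::'a::euclidean_space. poisson_kernel_deriv t z) \<in> borel_measurable borel"
  unfolding poisson_kernel_deriv_def pk_deriv_def by measurable

lemma emeasure_lebesgue_ball:
  "0 \<le> r \<Longrightarrow> emeasure lebesgue (ball (c::'a::euclidean_space) r) = ennreal (unit_ball_vol (DIM('a)) * r ^ DIM('a))"
  by (simp add: emeasure_ball)

text \<open>Dyadic decomposition: at distance at least \<open>2^n t\<close> from \<open>x\<close>
  the weight is at most \<open>(2^n t)^(-(d + 1))\<close>, while the ball of radius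
  \<open>2^(n + 1) t\<close> has volume of order \<open>(2^n t)^d\<close>. The terms form a
  geometric series of ratio 1/2.\<close>

lemma nn_integral_weight:
  assumes t: "0 < t"
  shows "(\<integral>\<^sup>+y. ennreal (weight t (x - y :: 'a::euclidean_space)) \<partial>lebesgue) < \<infinity>"
proof -
  let ?d = "DIM('a)" and ?V = "unit_ball_vol (real DIM('a))"
  define a where "a n = (2 ^ n * t) powr - (real ?d + 1)" for n
  have *: "ennreal (weight t (x - y)) \<le> (\<Sum>n. ennreal (a n) * indicator (ball x (2 ^ Suc n * t)) y)" for y
  proof -
    obtain N where N: "norm (x - y) < 2 ^ N * t"
      using real_arch_pow[of 2 "norm (x - y) / t"] t by (auto simp: divide_simps)
    define n where "n = (LEAST n. norm (x - y) < 2 ^ Suc n * t)"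
    have ex: "norm (x - y) < 2 ^ Suc N * t" using N t by (auto intro: order.strict_trans2)
    then have n: "norm (x - y) < 2 ^ Suc n * t" unfolding n_def by (rule LeastI)
    have "weight t (x - y) \<le> a n"
    proof (cases n)
      \<comment> \<open>On the innermost ball no lower bound for the distance is available; the
        maximum of the weight over the whole space serves instead.\<close>
      case 0
      then show ?thesis using weight_le[OF t, of "x - y"] by (simp add: a_def)
    next
      case (Suc k)
      then have "\<not> norm (x - y) < 2 ^ Suc k * t"
        unfolding n_def using not_less_Least[of k "\<lambda>n. norm (x - y) < 2 ^ Suc n * t"] by simp
      then have "(2 ^ n * t)\<^sup>2 \<le> (norm (x - y))\<^sup>2" using Suc t by (intro power_mono) auto
      then have "weight t (x - y) \<le> ((2 ^ n * t)\<^sup>2) powr - ((real ?d + 1) / 2)"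
        unfolding weight_def using t by (intro powr_mono2') (auto simp: add_increasing)
      also have "\<dots> = a n"
        using square_powr_half[of "2 ^ n * t" "real ?d"] t by (simp add: a_def)
      finally show ?thesis .
    qed
    then have "ennreal (weight t (x - y)) \<le> ennreal (a n) * indicator (ball x (2 ^ Suc n * t)) y"
      using n by (simp add: dist_norm ennreal_leI)
    also have "\<dots> \<le> (\<Sum>n. ennreal (a n) * indicator (ball x (2 ^ Suc n * t)) y)"
    proof -
      have "F n \<le> suminf F" for F :: "nat \<Rightarrow> ennreal"
        using sum_le_suminf[of F "{n}"] by simp
      then show ?thesis .
    qed
    finally show ?thesis .
  qed
  have a: "a n * (?V * (2 ^ Suc n * t) ^ ?d) = (?V * 2 ^ ?d / t) * (1 / 2) ^ n" for n
  proof -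
    define X where "X = 2 ^ n * t"
    have X: "0 < X" "2 ^ Suc n * t = 2 * X" using t by (simp_all add: X_def)
    have "a n = X powr - real (Suc ?d)" by (simp add: a_def X_def add.commute)
    also have "\<dots> = 1 / X ^ Suc ?d"
      using X by (simp only: powr_minus_divide powr_realpow)
    finally have "a n * (?V * (2 ^ Suc n * t) ^ ?d) = ?V * 2 ^ ?d / X"
      unfolding X(2) using X(1) by (simp add: power_mult_distrib)
    also have "\<dots> = (?V * 2 ^ ?d / t) * (1 / 2) ^ n"
      unfolding X_def by (simp only: power_one_over mult_1_right times_divide_times_eq mult.commute[of t])
    finally show ?thesis .
  qed
  have "(\<integral>\<^sup>+y. ennreal (weight t (x - y)) \<partial>lebesgue)
      \<le> (\<integral>\<^sup>+y. (\<Sum>n. ennreal (a n) * indicator (ball x (2 ^ Suc n * t)) y) \<partial>lebesgue)"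
    by (intro nn_integral_mono *)
  also have "\<dots> = (\<Sum>n. ennreal (a n) * emeasure lebesgue (ball x (2 ^ Suc n * t)))"
  proof (subst nn_integral_suminf)
    have [measurable]: "ball x r \<in> sets lebesgue" for r by simp
    show "(\<lambda>y. ennreal (a n) * indicator (ball x (2 ^ Suc n * t)) y) \<in> borel_measurable lebesgue" for n
      by measurable
    show "(\<Sum>n. \<integral>\<^sup>+y. ennreal (a n) * indicator (ball x (2 ^ Suc n * t)) y \<partial>lebesgue)
        = (\<Sum>n. ennreal (a n) * emeasure lebesgue (ball x (2 ^ Suc n * t)))"
      by (intro suminf_cong nn_integral_cmult_indicator) simp
  qed
  also have "\<dots> = (\<Sum>n. ennreal ((?V * 2 ^ ?d / t) * (1 / 2) ^ n))"
  proof (intro suminf_cong)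
    fix n
    have "ennreal (a n) * emeasure lebesgue (ball x (2 ^ Suc n * t)) = ennreal (a n * (?V * (2 ^ Suc n * t) ^ ?d))"
      using t by (subst emeasure_lebesgue_ball) (auto simp: a_def ennreal_mult)
    then show "ennreal (a n) * emeasure lebesgue (ball x (2 ^ Suc n * t)) = ennreal ((?V * 2 ^ ?d / t) * (1 / 2) ^ n)"
      by (simp only: a)
  qed
  also have "\<dots> < \<infinity>"
  proof -
    have "summable (\<lambda>n. (?V * 2 ^ ?d / t) * (1 / 2) ^ n)"
      by (intro summable_mult summable_geometric) simp
    then have "(\<Sum>n. ennreal ((?V * 2 ^ ?d / t) * (1 / 2) ^ n)) = ennreal (\<Sum>n. (?V * 2 ^ ?d / t) * (1 / 2) ^ n)"
      using t by (intro suminf_ennreal2) (auto intro!: mult_nonneg_nonneg divide_nonneg_pos less_imp_le[OF unit_ball_vol_pos])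
    then show ?thesis by simp
  qed
  finally show ?thesis .
qed

section \<open>The derivative of the Poisson semigroup\<close>

text \<open>One class for all exponents: the weighted condition suffices for convergence of every
  Poisson integral and its time derivative at every point, it contains \<open>L^p_X\<close> for all
  \<open>p \<ge> 1\<close>, and it is stable under cut-offs.\<close>

definition poisson_admissible :: "('a::euclidean_space \<Rightarrow> 'x::banach) \<Rightarrow> bool" where
  "poisson_admissible f \<longleftrightarrow> strongly_measurable lebesgue banach_space f \<and>
    (\<forall>x t. 0 < t \<longrightarrow> (\<integral>\<^sup>+y. ennreal (weight t (x - y)) * ennreal (norm (f y)) \<partial>lebesgue) < \<infinity>)"

lemma borel_imp_lebesgue_measurable:
  "f \<in> borel_measurable borel \<Longrightarrow> f \<in> borel_measurable lebesgue"
  by (simp add: measurable_completion)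

lemma poisson_admissibleD:
  assumes "poisson_admissible f"
  shows "strongly_measurable lebesgue banach_space f"
    and "(\<lambda>y. norm (f y)) \<in> borel_measurable lebesgue"
    and "0 < t \<Longrightarrow> (\<integral>\<^sup>+y. ennreal (weight t (x - y)) * ennreal (norm (f y)) \<partial>lebesgue) < \<infinity>"
  using assms completion.strongly_measurable_norm by (auto simp: poisson_admissible_def)

lemma poisson_admissible_dominated:
  fixes g :: "'a::euclidean_space \<Rightarrow> 'x::banach"
  assumes f: "poisson_admissible f" and g: "strongly_measurable lebesgue banach_space g"
    and le: "\<And>y. norm (g y) \<le> C * norm (f y)" and C: "0 \<le> C"
  shows "poisson_admissible g"
  unfolding poisson_admissible_def
proof (intro conjI g allI impI)
  fix x :: 'a and t :: real assume t: "0 < t"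
  note [measurable] = poisson_admissibleD(2)[OF f]
  have [measurable]: "(\<lambda>y. weight t (x - y)) \<in> borel_measurable lebesgue"
    by (rule borel_imp_lebesgue_measurable) measurable
  have "(\<integral>\<^sup>+y. ennreal (weight t (x - y)) * ennreal (norm (g y)) \<partial>lebesgue)
      \<le> (\<integral>\<^sup>+y. ennreal C * (ennreal (weight t (x - y)) * ennreal (norm (f y))) \<partial>lebesgue)"
  proof (intro nn_integral_mono)
    fix y
    have "ennreal (norm (g y)) \<le> ennreal C * ennreal (norm (f y))"
      using le[of y] C by (simp flip: ennreal_mult)
    then have "ennreal (weight t (x - y)) * ennreal (norm (g y))
        \<le> ennreal (weight t (x - y)) * (ennreal C * ennreal (norm (f y)))"
      by (rule mult_left_mono) simp
    then show "ennreal (weight t (x - y)) * ennreal (norm (g y))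
        \<le> ennreal C * (ennreal (weight t (x - y)) * ennreal (norm (f y)))"
      by (simp add: mult_ac)
  qed
  also have "\<dots> < \<infinity>"
    using poisson_admissibleD(3)[OF f t] by (simp add: nn_integral_cmult ennreal_mult_less_top)
  finally show "(\<integral>\<^sup>+y. ennreal (weight t (x - y)) * ennreal (norm (g y)) \<partial>lebesgue) < \<infinity>" .
qed

lemma poisson_admissible_indicator:
  fixes f :: "'a::euclidean_space \<Rightarrow> 'x::banach"
  assumes f: "poisson_admissible f" and A: "A \<in> sets lebesgue"
  shows "poisson_admissible (\<lambda>y. indicat_real A y *\<^sub>R f y)"
proof (rule poisson_admissible_dominated[OF f, where C = 1])
  show "strongly_measurable lebesgue banach_space (\<lambda>y. indicat_real A y *\<^sub>R f y)"
    by (intro strongly_measurable_scaleR poisson_admissibleD(1) f borel_measurable_indicator A)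
qed (auto simp: indicator_def)

text \<open>From \<open>norm (f y) \<le> 1 + norm (f y) powr p\<close> the constant is integrated
  against the integrable weight and the power against the bounded weight. This replaces Hoelder's
  inequality and treats \<open>p = 1\<close> like all other exponents.\<close>

lemma poisson_admissible_bochner_Lp:
  fixes f :: "'a::euclidean_space \<Rightarrow> 'x::banach"
  assumes p: "1 \<le> p" and f: "f \<in> carrier_of (bochner_Lp p lebesgue banach_space)"
  shows "poisson_admissible f"
proof -
  have sm: "strongly_measurable lebesgue banach_space f"
    and "Lp_norm p lebesgue (\<lambda>v. ennreal (norm v)) f < \<infinity>"
    using f by (auto simp: bochner_Lp_def banach_space_def)
  then have fin: "(\<integral>\<^sup>+y. epowr (ennreal (norm (f y))) p \<partial>lebesgue) < \<infinity>"
    by (simp add: Lp_norm_def)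
  note [measurable] = completion.strongly_measurable_norm[OF sm]
  show ?thesis
    unfolding poisson_admissible_def
  proof (intro conjI sm allI impI)
    fix x :: 'a and t :: real assume t: "0 < t"
    have [measurable]: "(\<lambda>y. weight t (x - y)) \<in> borel_measurable lebesgue"
      by (rule borel_imp_lebesgue_measurable) measurable
    let ?c = "t powr - (real DIM('a) + 1)"
    have "(\<integral>\<^sup>+y. ennreal (weight t (x - y)) * ennreal (norm (f y)) \<partial>lebesgue)
        \<le> (\<integral>\<^sup>+y. ennreal (weight t (x - y)) + ennreal ?c * epowr (ennreal (norm (f y))) p \<partial>lebesgue)"
    proof (rule nn_integral_mono)
      fix y
      have "norm (f y) \<le> 1 + norm (f y) powr p"
      proof (cases "norm (f y) \<le> 1")
        case False
        then have "norm (f y) powr 1 \<le> norm (f y) powr p" using p by (intro powr_mono) auto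
        then show ?thesis using False by simp
      qed (simp add: add_increasing2)
      then have "weight t (x - y) * norm (f y) \<le> weight t (x - y) + weight t (x - y) * norm (f y) powr p"
        using mult_left_mono[OF _ weight_nonneg, of "norm (f y)" "1 + norm (f y) powr p" t "x - y"]
        by (simp add: distrib_left)
      also have "\<dots> \<le> weight t (x - y) + ?c * norm (f y) powr p"
        using weight_le[OF t, of "x - y"] by (intro add_left_mono mult_right_mono) auto
      finally have "ennreal (weight t (x - y) * norm (f y)) \<le> ennreal (weight t (x - y) + ?c * norm (f y) powr p)"
        by (rule ennreal_leI)
      then show "ennreal (weight t (x - y)) * ennreal (norm (f y))
          \<le> ennreal (weight t (x - y)) + ennreal ?c * epowr (ennreal (norm (f y))) p"
        by (simp add: epowr_ennreal ennreal_mult ennreal_plus)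
    qed
    also have "\<dots> = (\<integral>\<^sup>+y. ennreal (weight t (x - y)) \<partial>lebesgue) + ennreal ?c * (\<integral>\<^sup>+y. epowr (ennreal (norm (f y))) p \<partial>lebesgue)"
      by (simp add: nn_integral_add nn_integral_cmult)
    also have "\<dots> < \<infinity>"
      using nn_integral_weight[OF t] fin by (simp add: ennreal_mult_less_top)
    finally show "(\<integral>\<^sup>+y. ennreal (weight t (x - y)) * ennreal (norm (f y)) \<partial>lebesgue) < \<infinity>" .
  qed
qed

lemma poisson_admissible_add:
  assumes f: "poisson_admissible f" and g: "poisson_admissible g"
  shows "poisson_admissible (\<lambda>y. f y + g y)"
  unfolding poisson_admissible_def
proof (intro conjI allI impI)
  show "strongly_measurable lebesgue banach_space (\<lambda>y. f y + g y)"
    by (intro strongly_measurable_add poisson_admissibleD f g)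
  fix x :: 'a and t :: real assume t: "0 < t"
  note [measurable] = poisson_admissibleD(2)[OF f] poisson_admissibleD(2)[OF g]
  have [measurable]: "(\<lambda>y. weight t (x - y)) \<in> borel_measurable lebesgue"
    by (rule borel_imp_lebesgue_measurable) measurable
  have "(\<integral>\<^sup>+y. ennreal (weight t (x - y)) * ennreal (norm (f y + g y)) \<partial>lebesgue)
      \<le> (\<integral>\<^sup>+y. ennreal (weight t (x - y)) * ennreal (norm (f y)) + ennreal (weight t (x - y)) * ennreal (norm (g y)) \<partial>lebesgue)"
  proof (rule nn_integral_mono)
    fix y
    have "ennreal (norm (f y + g y)) \<le> ennreal (norm (f y)) + ennreal (norm (g y))"
      by (simp add: norm_triangle_ineq flip: ennreal_plus)
    then show "ennreal (weight t (x - y)) * ennreal (norm (f y + g y))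
        \<le> ennreal (weight t (x - y)) * ennreal (norm (f y)) + ennreal (weight t (x - y)) * ennreal (norm (g y))"
      unfolding distrib_left[symmetric] by (rule mult_left_mono) simp
  qed
  also have "\<dots> < \<infinity>"
    using poisson_admissibleD(3)[OF f t] poisson_admissibleD(3)[OF g t] by (simp add: nn_integral_add)
  finally show "(\<integral>\<^sup>+y. ennreal (weight t (x - y)) * ennreal (norm (f y + g y)) \<partial>lebesgue) < \<infinity>" .
qed

text \<open>Applied with \<open>k\<close> the kernel, its time derivative, the Taylor remainder, an
  increment of the derivative, and the kernel with a cut-off. In the remainder and the increment the
  smallness sits in \<open>C\<close>.\<close>

lemma kernel_bochner_integrable:
  fixes f :: "'a::euclidean_space \<Rightarrow> 'x::banach"
  assumes f: "poisson_admissible f" and k: "k \<in> borel_measurable lebesgue" and t: "0 < t" and C: "0 \<le> C"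
    and le: "\<And>y. \<bar>k y\<bar> \<le> C * weight t (x - y)"
  shows "bochner_integrable lebesgue (\<lambda>y. k y *\<^sub>R f y)"
    and "norm (banach_integral lebesgue (\<lambda>y. k y *\<^sub>R f y))
      \<le> C * enn2real (\<integral>\<^sup>+y. ennreal (weight t (x - y)) * ennreal (norm (f y)) \<partial>lebesgue)" (is "_ \<le> C * enn2real ?W")
proof -
  note [measurable] = poisson_admissibleD(2)[OF f] k
  have [measurable]: "(\<lambda>y. weight t (x - y)) \<in> borel_measurable lebesgue"
    by (rule borel_imp_lebesgue_measurable) measurable
  have W: "?W < \<infinity>" by (rule poisson_admissibleD(3)[OF f t])
  have "(\<integral>\<^sup>+y. ennreal (norm (k y *\<^sub>R f y)) \<partial>lebesgue)
      \<le> (\<integral>\<^sup>+y. ennreal C * (ennreal (weight t (x - y)) * ennreal (norm (f y))) \<partial>lebesgue)"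
  proof (rule nn_integral_mono)
    fix y
    have "\<bar>k y\<bar> * norm (f y) \<le> C * weight t (x - y) * norm (f y)"
      by (rule mult_right_mono[OF le]) simp
    then have "ennreal (norm (k y *\<^sub>R f y)) \<le> ennreal (C * weight t (x - y) * norm (f y))"
      by (intro ennreal_leI) simp
    then show "ennreal (norm (k y *\<^sub>R f y)) \<le> ennreal C * (ennreal (weight t (x - y)) * ennreal (norm (f y)))"
      using C by (simp add: ennreal_mult mult.assoc)
  qed
  also have "\<dots> = ennreal C * ?W" by (simp add: nn_integral_cmult)
  finally have le': "(\<integral>\<^sup>+y. ennreal (norm (k y *\<^sub>R f y)) \<partial>lebesgue) \<le> ennreal C * ?W" .
  also have fin: "\<dots> < \<infinity>" using W by (simp add: ennreal_mult_less_top)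
  finally show int: "bochner_integrable lebesgue (\<lambda>y. k y *\<^sub>R f y)"
    by (simp add: bochner_integrable_def strongly_measurable_scaleR poisson_admissibleD(1)[OF f])
  have "ennreal (norm (banach_integral lebesgue (\<lambda>y. k y *\<^sub>R f y))) \<le> ennreal C * ?W"
    using completion.norm_banach_integral_le[OF int] le' by (rule order.trans)
  also have "\<dots> = ennreal (C * enn2real ?W)"
    using W C by (simp add: ennreal_mult)
  finally show "norm (banach_integral lebesgue (\<lambda>y. k y *\<^sub>R f y)) \<le> C * enn2real ?W"
    using C by (simp add: ennreal_le_iff)
qed

lemma has_vector_derivative_quadratic:
  fixes f :: "real \<Rightarrow> 'x::real_normed_vector"
  assumes e: "0 < e"
    and le: "\<And>u. \<bar>u - t\<bar> \<le> e \<Longrightarrow> norm (f u - f t - (u - t) *\<^sub>R D) \<le> K * (u - t)\<^sup>2"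
  shows "(f has_vector_derivative D) (at t)"
  unfolding has_vector_derivative_def has_derivative_at_alt
proof (intro conjI allI impI)
  show "bounded_linear (\<lambda>x. x *\<^sub>R D)" by (rule bounded_linear_scaleR_left)
  fix \<epsilon> :: real assume \<epsilon>: "0 < \<epsilon>"
  \<comment> \<open>The denominator \<open>\<bar>K\<bar> + 1\<close> is positive whatever the sign
    of \<open>K\<close>.\<close>
  define d where "d = min e (\<epsilon> / (\<bar>K\<bar> + 1))"
  have "0 < d" using e \<epsilon> by (simp add: d_def)
  moreover have "norm (f u - f t - (u - t) *\<^sub>R D) \<le> \<epsilon> * norm (u - t)" if u: "norm (u - t) < d" for u
  proof -
    have "\<bar>K\<bar> * \<bar>u - t\<bar> \<le> (\<bar>K\<bar> + 1) * d" using u by (intro mult_mono) auto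
    also have "\<dots> \<le> (\<bar>K\<bar> + 1) * (\<epsilon> / (\<bar>K\<bar> + 1))" by (intro mult_left_mono) (auto simp: d_def)
    finally have K: "\<bar>K\<bar> * \<bar>u - t\<bar> \<le> \<epsilon>" by simp
    have "norm (f u - f t - (u - t) *\<^sub>R D) \<le> K * (u - t)\<^sup>2" using u by (intro le) (simp add: d_def)
    also have "\<dots> \<le> \<bar>K\<bar> * \<bar>u - t\<bar> * \<bar>u - t\<bar>"
      by (simp add: power2_eq_square mult.assoc mult_right_mono)
    also have "\<dots> \<le> \<epsilon> * \<bar>u - t\<bar>" using K by (intro mult_right_mono) auto
    finally show ?thesis by simp
  qed
  ultimately show "\<exists>d>0. \<forall>y. norm (y - t) < d \<longrightarrow> norm (f y - f t - (y - t) *\<^sub>R D) \<le> \<epsilon> * norm (y - t)"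
    by blast
qed

section \<open>Differentiation under the integral and continuity in time\<close>

context
  fixes f :: "'a::euclidean_space \<Rightarrow> 'x::banach" and x :: 'a
  assumes f: "poisson_admissible f"
begin

lemma kernel_lebesgue_measurable:
  "(\<lambda>y. poisson_kernel t (x - y)) \<in> borel_measurable lebesgue"
  "(\<lambda>y. poisson_kernel_deriv t (x - y)) \<in> borel_measurable lebesgue"
  by (rule borel_imp_lebesgue_measurable; measurable)+

lemma poisson_bochner_integrable:
  assumes t: "0 < t"
  shows "bochner_integrable lebesgue (\<lambda>y. poisson_kernel t (x - y) *\<^sub>R f y)"
    and "bochner_integrable lebesgue (\<lambda>y. poisson_kernel_deriv t (x - y) *\<^sub>R f y)"
proof -
  show "bochner_integrable lebesgue (\<lambda>y. poisson_kernel t (x - y) *\<^sub>R f y)"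
    by (rule kernel_bochner_integrable(1)[OF f kernel_lebesgue_measurable(1) t _ poisson_kernel_bound[OF t]])
      (use t in simp)
  show "bochner_integrable lebesgue (\<lambda>y. poisson_kernel_deriv t (x - y) *\<^sub>R f y)"
    by (rule kernel_bochner_integrable(1)[OF f kernel_lebesgue_measurable(2) t kernel_const_nonneg
          poisson_kernel_deriv_bound[OF t]])
qed

text \<open>The Taylor remainder of the kernel is at most a constant times
  \<open>(u - t)\<^sup>2\<close> times the weight, uniformly in \<open>y\<close>. Integrated against
  \<open>f\<close> it gives a quadratic remainder for the semigroup, so no limit has to be taken
  under the integral.\<close>

lemma poisson_has_vector_derivative:
  assumes t: "0 < t"
  shows "((\<lambda>u. poisson u f x) has_vector_derivative
    banach_integral lebesgue (\<lambda>y. poisson_kernel_deriv t (x - y) *\<^sub>R f y)) (at t)"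
proof -
  let ?W = "enn2real (\<integral>\<^sup>+y. ennreal (weight t (x - y)) * ennreal (norm (f y)) \<partial>lebesgue)"
  let ?D = "banach_integral lebesgue (\<lambda>y. poisson_kernel_deriv t (x - y) *\<^sub>R f y)"
  show ?thesis
  proof (rule has_vector_derivative_quadratic)
    show "0 < t / 2" using t by simp
    fix u assume u: "\<bar>u - t\<bar> \<le> t / 2"
    then have u0: "0 < u" using t by linarith
    note int = poisson_bochner_integrable[OF t] poisson_bochner_integrable[OF u0]
    let ?k = "\<lambda>y. poisson_kernel u (x - y) - poisson_kernel t (x - y) - (u - t) * poisson_kernel_deriv t (x - y)"
    have "poisson u f x - poisson t f x - (u - t) *\<^sub>R ?D
        = banach_integral lebesgue (\<lambda>y. (poisson_kernel u (x - y) *\<^sub>R f y - poisson_kernel t (x - y) *\<^sub>R f y)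
            - (u - t) *\<^sub>R (poisson_kernel_deriv t (x - y) *\<^sub>R f y))"
      unfolding poisson_def
        completion.banach_integral_diff[OF completion.bochner_integrable_diff[OF int(3) int(1)]
          completion.bochner_integrable_scaleR[OF int(2)]]
        completion.banach_integral_diff[OF int(3) int(1)] completion.banach_integral_scaleR[OF int(2)] ..
    also have "\<dots> = banach_integral lebesgue (\<lambda>y. ?k y *\<^sub>R f y)"
      by (simp add: scaleR_diff_left)
    also have "norm \<dots> \<le> (taylor_const TYPE('a) t * (u - t)\<^sup>2) * ?W"
    proof (rule kernel_bochner_integrable(2)[OF f _ t])
      note [measurable] = kernel_lebesgue_measurable
      show "?k \<in> borel_measurable lebesgue" by measurable
      show "0 \<le> taylor_const TYPE('a) t * (u - t)\<^sup>2" by (simp add: taylor_const_nonneg[OF t])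
      show "\<bar>?k y\<bar> \<le> taylor_const TYPE('a) t * (u - t)\<^sup>2 * weight t (x - y)" for y
        by (rule poisson_kernel_taylor[OF t u])
    qed
    finally show "norm (poisson u f x - poisson t f x - (u - t) *\<^sub>R ?D) \<le> (taylor_const TYPE('a) t * ?W) * (u - t)\<^sup>2"
      by (simp add: mult_ac)
  qed
qed

lemma t_deriv_poisson_eq:
  assumes t: "0 < t"
  shows "t_deriv_poisson f x t = t *\<^sub>R banach_integral lebesgue (\<lambda>y. poisson_kernel_deriv t (x - y) *\<^sub>R f y)"
  using vector_derivative_at[OF poisson_has_vector_derivative[OF t]] by (simp add: t_deriv_poisson_def)

lemma t_deriv_poisson_continuous: "continuous_on {0<..} (t_deriv_poisson f x)"
proof -
  let ?D = "\<lambda>t. banach_integral lebesgue (\<lambda>y. poisson_kernel_deriv t (x - y) *\<^sub>R f y)"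
  have "(?D \<longlongrightarrow> ?D t) (at t)" if t: "0 < t" for t
  proof -
    let ?W = "enn2real (\<integral>\<^sup>+y. ennreal (weight t (x - y)) * ennreal (norm (f y)) \<partial>lebesgue)"
    have bound: "norm (?D u - ?D t) \<le> taylor_const TYPE('a) t * \<bar>u - t\<bar> * ?W" if u: "\<bar>u - t\<bar> \<le> t / 2" for u
    proof -
      have u0: "0 < u" using u t by linarith
      let ?k = "\<lambda>y. poisson_kernel_deriv u (x - y) - poisson_kernel_deriv t (x - y)"
      have "?D u - ?D t = banach_integral lebesgue (\<lambda>y. ?k y *\<^sub>R f y)"
        unfolding scaleR_diff_left
          completion.banach_integral_diff[OF poisson_bochner_integrable(2)[OF u0] poisson_bochner_integrable(2)[OF t]] ..
      also have "norm \<dots> \<le> (taylor_const TYPE('a) t * \<bar>u - t\<bar>) * ?W"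
      proof (rule kernel_bochner_integrable(2)[OF f _ t])
        note [measurable] = kernel_lebesgue_measurable
        show "?k \<in> borel_measurable lebesgue" by measurable
        show "0 \<le> taylor_const TYPE('a) t * \<bar>u - t\<bar>" by (simp add: taylor_const_nonneg[OF t])
        show "\<bar>?k y\<bar> \<le> taylor_const TYPE('a) t * \<bar>u - t\<bar> * weight t (x - y)" for y
          by (rule poisson_kernel_deriv_lipschitz[OF t u])
      qed
      finally show ?thesis .
    qed
    have ev: "\<forall>\<^sub>F u in at t. \<bar>u - t\<bar> \<le> t / 2"
      unfolding eventually_at using t by (intro exI[of _ "t / 2"]) (auto simp: dist_real_def)
    have "\<forall>\<^sub>F u in at t. norm (?D u - ?D t) \<le> taylor_const TYPE('a) t * \<bar>u - t\<bar> * ?W"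
      by (rule eventually_mono[OF ev bound])
    moreover have "((\<lambda>u. taylor_const TYPE('a) t * \<bar>u - t\<bar> * ?W) \<longlongrightarrow> 0) (at t)"
    proof -
      have "((\<lambda>u. taylor_const TYPE('a) t * \<bar>u - t\<bar> * ?W) \<longlongrightarrow> taylor_const TYPE('a) t * \<bar>t - t\<bar> * ?W) (at t)"
        by (intro tendsto_intros)
      then show ?thesis by simp
    qed
    ultimately have "((\<lambda>u. ?D u - ?D t) \<longlongrightarrow> 0) (at t)"
      by (rule Lim_null_comparison)
    then show ?thesis by (simp add: LIM_zero_iff)
  qed
  then have "continuous_on {0<..} ?D"
    by (intro continuous_at_imp_continuous_on) (simp add: isCont_def)
  then have "continuous_on {0<..} (\<lambda>t. t *\<^sub>R ?D t)"
    by (intro continuous_on_scaleR continuous_on_id)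
  then show ?thesis
    by (rule continuous_on_eq) (simp add: t_deriv_poisson_eq)
qed

text \<open>On the support of \<open>f\<close> the kernel is dominated by a function of \<open>t\<close> alone, so the triangle
  inequality in \<open>X\<close> is enough.\<close>

lemma t_deriv_poisson_far:
  assumes t: "0 < t" and r: "0 \<le> r" and far: "\<And>y. norm (x - y) < r \<Longrightarrow> f y = 0"
  shows "ennreal (norm (t_deriv_poisson f x t))
    \<le> ennreal (kernel_const TYPE('a) * (t * (t\<^sup>2 + r\<^sup>2) powr - ((real DIM('a) + 1) / 2))) *
      (\<integral>\<^sup>+y. ennreal (norm (f y)) \<partial>lebesgue)"
proof -
  note [measurable] = poisson_admissibleD(2)[OF f]
  let ?w = "(t\<^sup>2 + r\<^sup>2) powr - ((real DIM('a) + 1) / 2)"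
  let ?D = "banach_integral lebesgue (\<lambda>y. poisson_kernel_deriv t (x - y) *\<^sub>R f y)"
  have "ennreal (norm ?D) \<le> (\<integral>\<^sup>+y. ennreal (norm (poisson_kernel_deriv t (x - y) *\<^sub>R f y)) \<partial>lebesgue)"
    by (rule completion.norm_banach_integral_le[OF poisson_bochner_integrable(2)[OF t]])
  also have "\<dots> \<le> (\<integral>\<^sup>+y. ennreal (kernel_const TYPE('a) * ?w) * ennreal (norm (f y)) \<partial>lebesgue)"
  proof (rule nn_integral_mono)
    fix y
    have "\<bar>poisson_kernel_deriv t (x - y)\<bar> * norm (f y) \<le> kernel_const TYPE('a) * ?w * norm (f y)"
    proof (cases "norm (x - y) < r")
      case False
      have "\<bar>poisson_kernel_deriv t (x - y)\<bar> \<le> kernel_const TYPE('a) * weight t (x - y)"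
        by (rule poisson_kernel_deriv_bound[OF t])
      also have "\<dots> \<le> kernel_const TYPE('a) * ?w"
        using False r by (intro mult_left_mono weight_antimono t kernel_const_nonneg) auto
      finally show ?thesis by (rule mult_right_mono) simp
    qed (simp add: far)
    then have "ennreal (\<bar>poisson_kernel_deriv t (x - y)\<bar> * norm (f y)) \<le> ennreal (kernel_const TYPE('a) * ?w * norm (f y))"
      by (rule ennreal_leI)
    then show "ennreal (norm (poisson_kernel_deriv t (x - y) *\<^sub>R f y))
        \<le> ennreal (kernel_const TYPE('a) * ?w) * ennreal (norm (f y))"
      using kernel_const_nonneg[where 'a='a] by (simp add: ennreal_mult)
  qed
  also have "\<dots> = ennreal (kernel_const TYPE('a) * ?w) * (\<integral>\<^sup>+y. ennreal (norm (f y)) \<partial>lebesgue)"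
    by (rule nn_integral_cmult) measurable
  finally have *: "ennreal (norm ?D) \<le> ennreal (kernel_const TYPE('a) * ?w) * (\<integral>\<^sup>+y. ennreal (norm (f y)) \<partial>lebesgue)" .
  have "ennreal (norm (t_deriv_poisson f x t)) = ennreal t * ennreal (norm ?D)"
    using t by (simp add: t_deriv_poisson_eq ennreal_mult)
  also have "\<dots> \<le> ennreal t * (ennreal (kernel_const TYPE('a) * ?w) * (\<integral>\<^sup>+y. ennreal (norm (f y)) \<partial>lebesgue))"
    by (rule mult_left_mono[OF *]) simp
  also have "\<dots> = ennreal (kernel_const TYPE('a) * (t * ?w)) * (\<integral>\<^sup>+y. ennreal (norm (f y)) \<partial>lebesgue)"
    using t kernel_const_nonneg[where 'a='a] by (simp add: ennreal_mult mult_ac)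
  finally show ?thesis .
qed

end

lemma t_deriv_poisson_add:
  assumes "poisson_admissible f" "poisson_admissible g" "0 < t"
  shows "t_deriv_poisson (\<lambda>y. f y + g y) x t = t_deriv_poisson f x t + t_deriv_poisson g x t"
  using assms poisson_bochner_integrable[OF assms(1,3)] poisson_bochner_integrable[OF assms(2,3)]
  by (simp add: t_deriv_poisson_eq poisson_admissible_add scaleR_add_right completion.banach_integral_add)

lemma sigma_finite_lebesgue: "sigma_finite_measure (lebesgue :: 'a::euclidean_space measure)"
proof
  show "\<exists>A::'a set set. countable A \<and> A \<subseteq> sets lebesgue \<and> \<Union>A = space lebesgue \<and> (\<forall>a\<in>A. emeasure lebesgue a \<noteq> \<infinity>)"
  proof (intro exI[of _ "range (\<lambda>n::nat. ball 0 (real n))"] conjI)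
    have "x \<in> (\<Union>n::nat. ball 0 (real n))" for x :: 'a
      using reals_Archimedean2[of "norm x"] by auto
    then show "\<Union>(range (\<lambda>n::nat. ball 0 (real n))) = space (lebesgue :: 'a measure)" by auto
  qed (auto simp: emeasure_ball)
qed

text \<open>The cut-off is moved from the function to the kernel, giving \<open>\<kappa>\<close>.
  For a simple function the integral against \<open>\<kappa> x\<close> is a finite sum of vectors
  whose scalar coefficients are parametric integrals, hence measurable in \<open>x\<close>. The
  general case is a limit for every \<open>x\<close>, by dominated convergence.\<close>

lemma t_deriv_poisson_strongly_measurable:
  fixes f :: "'a::euclidean_space \<Rightarrow> 'x::banach"
  assumes f: "poisson_admissible f" and N: "N \<in> sets borel" and t: "0 < t"
  shows "strongly_measurable lebesgue banach_space
    (\<lambda>x. t_deriv_poisson (\<lambda>y. indicat_real N (x, y) *\<^sub>R f y) x t)"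
proof -
  define \<kappa> where "\<kappa> x y = (t * poisson_kernel_deriv t (x - y)) * indicat_real N (x, y)" for x y :: 'a
  define C where "C = t * kernel_const TYPE('a)"
  have C: "0 \<le> C" using t by (simp add: C_def kernel_const_nonneg)
  have Nx: "{y. (x, y) \<in> N} \<in> sets lebesgue" for x
  proof -
    have "(\<lambda>y. (x, y)) -` N \<inter> space borel \<in> sets borel"
      by (rule measurable_sets[OF _ N]) simp
    then show ?thesis by (simp add: vimage_def)
  qed
  have ind: "(\<lambda>y. indicat_real N (x, y)) = indicat_real {y. (x, y) \<in> N}" for x
    by (auto simp: indicator_def)
  have \<kappa>_meas: "\<kappa> x \<in> borel_measurable lebesgue" for x
  proof -
    have "(\<lambda>y. indicat_real N (x, y)) \<in> borel_measurable lebesgue"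
      unfolding ind by (intro borel_measurable_indicator Nx)
    moreover have "(\<lambda>y. poisson_kernel_deriv t (x - y)) \<in> borel_measurable lebesgue"
      by (rule borel_imp_lebesgue_measurable) measurable
    ultimately show ?thesis unfolding \<kappa>_def by measurable
  qed
  have \<kappa>_le: "\<bar>\<kappa> x y\<bar> \<le> C * weight t (x - y)" for x y
  proof -
    have "\<bar>\<kappa> x y\<bar> \<le> \<bar>t * poisson_kernel_deriv t (x - y)\<bar>"
      by (auto simp: \<kappa>_def indicator_def)
    also have "\<dots> \<le> C * weight t (x - y)"
      using poisson_kernel_deriv_bound[OF t, of "x - y"] t by (simp add: C_def abs_mult mult.assoc)
    finally show ?thesis .
  qed
  have eq: "t_deriv_poisson (\<lambda>y. indicat_real N (x, y) *\<^sub>R f y) x t = banach_integral lebesgue (\<lambda>y. \<kappa> x y *\<^sub>R f y)" for x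
  proof -
    have adm: "poisson_admissible (\<lambda>y. indicat_real N (x, y) *\<^sub>R f y)"
      using poisson_admissible_indicator[OF f Nx, of x] by (simp add: ind[THEN fun_cong])
    show ?thesis
      unfolding t_deriv_poisson_eq[OF adm t] completion.banach_integral_scaleR[OF poisson_bochner_integrable(2)[OF adm t], symmetric]
      by (simp add: \<kappa>_def mult_ac)
  qed
  have sm: "strongly_measurable lebesgue banach_space f" by (rule poisson_admissibleD(1)[OF f])
  obtain s where s: "\<And>i. simple_function lebesgue (s i)" "AE x in lebesgue. (\<lambda>i. s i x) \<longlonglongrightarrow> f x"
    "\<And>i x. x \<in> space lebesgue \<Longrightarrow> norm (s i x) \<le> 2 * norm (f x)"
    using completion.strongly_measurable_dominated_sequence[OF sm] by blast
  have s_adm: "poisson_admissible (s i)" for i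
    using s by (intro poisson_admissible_dominated[OF f, of _ 2] strongly_measurable_simple) auto
  define h where "h i x = banach_integral lebesgue (\<lambda>y. \<kappa> x y *\<^sub>R s i y)" for i x
  note int_f = kernel_bochner_integrable(1)[OF f \<kappa>_meas t C \<kappa>_le]
  note int_s = kernel_bochner_integrable(1)[OF s_adm \<kappa>_meas t C \<kappa>_le]
  have lim: "(\<lambda>i. h i x) \<longlonglongrightarrow> banach_integral lebesgue (\<lambda>y. \<kappa> x y *\<^sub>R f y)" for x
    unfolding h_def
  proof (rule completion.banach_integral_LIMSEQ[OF int_f int_s])
    note [measurable] = poisson_admissibleD(2)[OF f]
    have [measurable]: "(\<lambda>y. weight t (x - y)) \<in> borel_measurable lebesgue"
      by (rule borel_imp_lebesgue_measurable) measurable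
    have "(\<lambda>i. \<integral>\<^sup>+y. ennreal (norm (\<kappa> x y *\<^sub>R s i y - \<kappa> x y *\<^sub>R f y)) \<partial>lebesgue) \<longlonglongrightarrow> (\<integral>\<^sup>+y. 0 \<partial>(lebesgue :: 'a measure))"
    proof (rule nn_integral_dominated_convergence[where w = "\<lambda>y. ennreal (3 * C) * (ennreal (weight t (x - y)) * ennreal (norm (f y)))"])
      show "(\<lambda>y. ennreal (norm (\<kappa> x y *\<^sub>R s i y - \<kappa> x y *\<^sub>R f y))) \<in> borel_measurable lebesgue" for i
        using completion.strongly_measurable_norm strongly_measurable_diff int_f int_s
        unfolding bochner_integrable_def by (intro measurable_compose[OF _ measurable_ennreal]) blast
      show "AE y in lebesgue. ennreal (norm (\<kappa> x y *\<^sub>R s i y - \<kappa> x y *\<^sub>R f y))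
          \<le> ennreal (3 * C) * (ennreal (weight t (x - y)) * ennreal (norm (f y)))" for i
      proof (rule AE_I2)
        fix y
        have "norm (s i y - f y) \<le> 3 * norm (f y)"
          using norm_triangle_ineq4[of "s i y" "f y"] s(3)[of y i] by simp
        then have "\<bar>\<kappa> x y\<bar> * norm (s i y - f y) \<le> (C * weight t (x - y)) * (3 * norm (f y))"
          by (intro mult_mono \<kappa>_le) (auto intro: order.trans[OF _ \<kappa>_le])
        also have "\<dots> = 3 * C * (weight t (x - y) * norm (f y))" by simp
        finally have "ennreal (norm (\<kappa> x y *\<^sub>R s i y - \<kappa> x y *\<^sub>R f y)) \<le> ennreal (3 * C * (weight t (x - y) * norm (f y)))"
          by (intro ennreal_leI) (simp flip: scaleR_diff_right)
        then show "ennreal (norm (\<kappa> x y *\<^sub>R s i y - \<kappa> x y *\<^sub>R f y))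
          \<le> ennreal (3 * C) * (ennreal (weight t (x - y)) * ennreal (norm (f y)))"
          using C by (simp add: ennreal_mult[symmetric])
      qed
      show "(\<integral>\<^sup>+y. ennreal (3 * C) * (ennreal (weight t (x - y)) * ennreal (norm (f y))) \<partial>lebesgue) < \<infinity>"
        using poisson_admissibleD(3)[OF f t, of x] by (simp add: nn_integral_cmult ennreal_mult_less_top)
      show "AE y in lebesgue. (\<lambda>i. ennreal (norm (\<kappa> x y *\<^sub>R s i y - \<kappa> x y *\<^sub>R f y))) \<longlonglongrightarrow> 0"
        using s(2)
      proof eventually_elim
        case (elim y)
        have "(\<lambda>i. ennreal (norm (\<kappa> x y *\<^sub>R s i y - \<kappa> x y *\<^sub>R f y))) \<longlonglongrightarrow> ennreal (norm (\<kappa> x y *\<^sub>R f y - \<kappa> x y *\<^sub>R f y))"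
          by (intro tendsto_intros elim)
        then show ?case by simp
      qed
    qed simp_all
    then show "(\<lambda>i. \<integral>\<^sup>+y. ennreal (norm (\<kappa> x y *\<^sub>R s i y - \<kappa> x y *\<^sub>R f y)) \<partial>lebesgue) \<longlonglongrightarrow> 0" by simp
  qed
  have h_sm: "strongly_measurable lebesgue banach_space (h i)" for i
  proof -
    \<comment> \<open>The value 0 contributes nothing to the integral. Leaving it out permits
      division by \<open>norm v\<close> when the integrability of the kernel over \<open>E v\<close>
      is derived from that of \<open>\<kappa> x y *\<^sub>R s i y\<close>.\<close>
    define R where "R = range (s i) - {0}"
    define E where "E v = s i -` {v}" for v
    have fin: "finite R" using s(1)[of i] by (auto simp: R_def simple_function_def)
    have E: "E v \<in> sets lebesgue" for v
      using simple_functionD(2)[OF s(1), of i "{v}"] by (simp add: E_def)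
    have intE: "integrable lebesgue (\<lambda>y. \<kappa> x y * indicat_real (E v) y)" if "v \<in> R" for x v
    proof -
      have v: "0 < norm v" using that by (simp add: R_def)
      have "bochner_integrable lebesgue (\<lambda>y. \<kappa> x y *\<^sub>R s i y)" by (rule int_s)
      then have fin: "(\<integral>\<^sup>+y. ennreal (norm (\<kappa> x y *\<^sub>R s i y)) \<partial>lebesgue) < \<infinity>"
        by (simp add: bochner_integrable_def)
      have m: "(\<lambda>y. \<kappa> x y * indicat_real (E v) y) \<in> borel_measurable lebesgue"
        using \<kappa>_meas E by measurable
      have "(\<integral>\<^sup>+y. ennreal (norm (\<kappa> x y * indicat_real (E v) y)) \<partial>lebesgue) * ennreal (norm v)
          = (\<integral>\<^sup>+y. ennreal (norm (\<kappa> x y * indicat_real (E v) y)) * ennreal (norm v) \<partial>lebesgue)"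
        by (rule nn_integral_multc[symmetric], rule measurable_compose[OF m]) simp
      also have "\<dots> \<le> (\<integral>\<^sup>+y. ennreal (norm (\<kappa> x y *\<^sub>R s i y)) \<partial>lebesgue)"
        by (intro nn_integral_mono) (auto simp: E_def indicator_def ennreal_mult[symmetric])
      finally have "(\<integral>\<^sup>+y. ennreal (norm (\<kappa> x y * indicat_real (E v) y)) \<partial>lebesgue) * ennreal (norm v) < \<infinity>"
        using fin by (rule le_less_trans)
      then have "(\<integral>\<^sup>+y. ennreal (norm (\<kappa> x y * indicat_real (E v) y)) \<partial>lebesgue) < \<infinity>"
        using v by (auto simp: ennreal_mult_less_top)
      then show ?thesis using m by (simp add: integrable_iff_bounded)
    qed
    have h_eq: "h i x = (\<Sum>v\<in>R. (\<integral>y. \<kappa> x y * indicat_real (E v) y \<partial>lebesgue) *\<^sub>R v)" for x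
    proof -
      have "has_banach_integral lebesgue (\<lambda>y. \<Sum>v\<in>R. (\<kappa> x y * indicat_real (E v) y) *\<^sub>R v)
          (\<Sum>v\<in>R. (\<integral>y. \<kappa> x y * indicat_real (E v) y \<partial>lebesgue) *\<^sub>R v)"
        by (intro completion.has_banach_integral_sum fin completion.has_banach_integral_real_scaleR intE)
      moreover have "(\<Sum>v\<in>R. (\<kappa> x y * indicat_real (E v) y) *\<^sub>R v) = \<kappa> x y *\<^sub>R s i y" for y
      proof -
        have "(\<Sum>v\<in>R. (\<kappa> x y * indicat_real (E v) y) *\<^sub>R v) = (\<Sum>v\<in>R. if v = s i y then \<kappa> x y *\<^sub>R s i y else 0)"
          by (intro sum.cong) (auto simp: E_def indicator_def)
        also have "\<dots> = \<kappa> x y *\<^sub>R s i y"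
          using fin by (simp add: sum.delta) (auto simp: R_def)
        finally show ?thesis .
      qed
      ultimately show ?thesis
        unfolding h_def using completion.banach_integral_eq by auto
    qed
    have h_meas: "(\<lambda>x. \<integral>y. \<kappa> x y * indicat_real (E v) y \<partial>lebesgue) \<in> borel_measurable lebesgue" for v
    proof (rule sigma_finite_measure.borel_measurable_lebesgue_integral[OF sigma_finite_lebesgue])
      let ?L = "lebesgue :: 'a measure"
      \<comment> \<open>\<open>N\<close> is a Borel set of the product space, whereas the integrals
        live on the product of two Lebesgue sigma-algebras. The identity map between the two is
        measurable because it is so in each coordinate.\<close>
      have id: "(\<lambda>x. x) \<in> ?L \<rightarrow>\<^sub>M borel" by (rule borel_imp_lebesgue_measurable) simp
      have [measurable]: "fst \<in> ?L \<Otimes>\<^sub>M ?L \<rightarrow>\<^sub>M borel" "snd \<in> ?L \<Otimes>\<^sub>M ?L \<rightarrow>\<^sub>M borel"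
        using measurable_compose[OF measurable_fst id] measurable_compose[OF measurable_snd id] by auto
      have "(\<lambda>p. (fst p, snd p)) \<in> ?L \<Otimes>\<^sub>M ?L \<rightarrow>\<^sub>M borel \<Otimes>\<^sub>M borel" by measurable
      then have "(\<lambda>p. p) \<in> ?L \<Otimes>\<^sub>M ?L \<rightarrow>\<^sub>M borel" by (simp add: borel_prod)
      then have [measurable]: "(\<lambda>p. indicat_real N p) \<in> borel_measurable (?L \<Otimes>\<^sub>M ?L)"
        by (rule measurable_compose) (use N in measurable)
      have [measurable]: "(\<lambda>p. indicat_real (E v) (snd p)) \<in> borel_measurable (?L \<Otimes>\<^sub>M ?L)"
        by (rule measurable_compose[OF measurable_snd]) (use E in measurable)
      have "(\<lambda>p. t * poisson_kernel_deriv t (fst p - snd p) * indicat_real N p * indicat_real (E v) (snd p))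
          \<in> borel_measurable (?L \<Otimes>\<^sub>M ?L)"
        by measurable
      then show "(\<lambda>(x, y). \<kappa> x y * indicat_real (E v) y) \<in> borel_measurable (?L \<Otimes>\<^sub>M ?L)"
        by (simp add: \<kappa>_def case_prod_beta)
    qed
    have "h i = (\<lambda>x. \<Sum>v\<in>R. (\<integral>y. \<kappa> x y * indicat_real (E v) y \<partial>lebesgue) *\<^sub>R v)"
      by (rule ext) (rule h_eq)
    then show ?thesis
      by (simp only:) (intro strongly_measurable_sum fin strongly_measurable_scaleR h_meas strongly_measurable_const)
  qed
  show ?thesis
    unfolding eq by (rule completion.strongly_measurable_LIMSEQ[where f = h, OF h_sm]) (simp add: lim)
qed

section \<open>The norm of \<open>L\<^sup>q\<^sub>X\<close>\<close>

definition lq_norm :: "real \<Rightarrow> (real \<Rightarrow> 'x::banach) \<Rightarrow> ennreal" where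
  "lq_norm q u = norm_of (LqX q) u"

lemma lq_norm_eq: "lq_norm q u = epowr (\<integral>\<^sup>+t. epowr (ennreal (norm (u t))) q \<partial>dt_over_t) (1 / q)"
  by (simp add: lq_norm_def bochner_Lp_def Lp_norm_def banach_space_def)

lemma space_dt_over_t [simp]: "space dt_over_t = {0<..}"
  by (simp add: dt_over_t_def)

lemma sets_dt_over_t: "sets dt_over_t = sets (lebesgue_on {0<..})"
  by (simp add: dt_over_t_def)

lemma measurable_dt_over_t: "borel_measurable dt_over_t = borel_measurable (lebesgue_on {0<..})"
  by (rule measurable_cong_sets) (simp_all add: sets_dt_over_t)

text \<open>Brings integrals for \<open>dt_over_t\<close>, a density on a restricted completed
  measure, back to \<open>lborel\<close>, where the fundamental theorem of calculus and the
  measurability of parametric integrals are applied.\<close>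

lemma nn_integral_dt_over_t:
  assumes g: "g \<in> borel_measurable dt_over_t"
  shows "(\<integral>\<^sup>+t. g t \<partial>dt_over_t) = (\<integral>\<^sup>+t. indicator {0<..} t * (ennreal (1 / t) * g t) \<partial>lborel)"
proof -
  have "(\<lambda>t::real. ennreal (1 / t)) \<in> borel_measurable lebesgue"
    by (rule borel_imp_lebesgue_measurable) simp
  then have "(\<lambda>t::real. ennreal (1 / t)) \<in> borel_measurable (lebesgue_on {0<..})"
    by (rule measurable_restrict_space1)
  moreover have "g \<in> borel_measurable (lebesgue_on {0<..})" using g by (simp add: measurable_dt_over_t)
  ultimately have "(\<integral>\<^sup>+t. g t \<partial>dt_over_t) = (\<integral>\<^sup>+t. ennreal (1 / t) * g t \<partial>lebesgue_on {0<..})"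
    unfolding dt_over_t_def by (rule nn_integral_density)
  also have "\<dots> = (\<integral>\<^sup>+t. ennreal (1 / t) * g t * indicator {0<..} t \<partial>lebesgue)"
    by (rule nn_integral_restrict_space) simp
  finally show ?thesis by (simp add: nn_integral_completion mult_ac)
qed

lemma borel_imp_dt_measurable:
  assumes "g \<in> measurable borel M"
  shows "g \<in> measurable dt_over_t M"
proof -
  have "g \<in> measurable lebesgue M" using assms by (simp add: measurable_completion)
  then have "g \<in> measurable (lebesgue_on {0<..}) M" by (rule measurable_restrict_space1)
  then show ?thesis using measurable_cong_sets[OF sets_dt_over_t refl] by blast
qed

lemma continuous_dt_measurable:
  fixes u :: "real \<Rightarrow> real"
  assumes "continuous_on {0<..} u"
  shows "u \<in> borel_measurable dt_over_t"
  unfolding measurable_dt_over_t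
  by (rule continuous_imp_measurable_on_sets_lebesgue[OF assms]) simp

text \<open>The pointwise bound on \<open>w\<close>, in place of a sum, covers sums and differences
  alike.\<close>

lemma lq_norm_triangle:
  assumes q: "1 \<le> q" and u: "continuous_on {0<..} u" and v: "continuous_on {0<..} v"
    and le: "\<And>t. 0 < t \<Longrightarrow> norm (w t) \<le> norm (u t) + norm (v t)"
  shows "lq_norm q w \<le> lq_norm q u + lq_norm q v"
proof -
  have [measurable]: "(\<lambda>t. norm (u t)) \<in> borel_measurable dt_over_t" "(\<lambda>t. norm (v t)) \<in> borel_measurable dt_over_t"
    using u v by (auto intro!: continuous_dt_measurable continuous_on_norm)
  have "(\<integral>\<^sup>+t. epowr (ennreal (norm (w t))) q \<partial>dt_over_t)
      \<le> (\<integral>\<^sup>+t. epowr (ennreal (norm (u t)) + ennreal (norm (v t))) q \<partial>dt_over_t)"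
    using q le by (intro nn_integral_mono epowr_mono) (auto simp flip: ennreal_plus)
  then have "lq_norm q w \<le> epowr (\<integral>\<^sup>+t. epowr (ennreal (norm (u t)) + ennreal (norm (v t))) q \<partial>dt_over_t) (1 / q)"
    unfolding lq_norm_eq using q by (intro epowr_mono) auto
  also have "\<dots> \<le> lq_norm q u + lq_norm q v"
    unfolding lq_norm_eq by (rule epowr_nn_integral_add_le[OF q]) measurable
  finally show ?thesis .
qed

text \<open>The integrand is the square of \<open>r * t / (t\<^sup>2 + r\<^sup>2)\<close> divided by
  \<open>t\<close>. By dilation invariance of \<open>dt/t\<close> the value does not depend on
  \<open>r\<close>, so the whole dependence of the far part on \<open>r\<close> is the factor
  \<open>1 / r ^ d\<close> in \<open>lq_norm_far\<close>.\<close>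

lemma nn_integral_poisson_profile:
  assumes r: "0 < r"
  shows "(\<integral>\<^sup>+t. ennreal (r\<^sup>2 * t / (t\<^sup>2 + r\<^sup>2)\<^sup>2) * indicator {0..} t \<partial>lborel) = ennreal (1 / 2)"
proof -
  have pos: "0 < t\<^sup>2 + r\<^sup>2" for t :: real using r by (simp add: add_nonneg_pos)
  have "(\<integral>\<^sup>+t. ennreal (r\<^sup>2 * t / (t\<^sup>2 + r\<^sup>2)\<^sup>2) * indicator {0..} t \<partial>lborel)
      = ennreal (0 - (- (r\<^sup>2 / 2)) / (0\<^sup>2 + r\<^sup>2))"
  proof (rule nn_integral_FTC_atLeast)
    show "((\<lambda>t. (- (r\<^sup>2 / 2)) / (t\<^sup>2 + r\<^sup>2)) has_real_derivative r\<^sup>2 * t / (t\<^sup>2 + r\<^sup>2)\<^sup>2) (at t)" for t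
    proof -
      have "((\<lambda>t. c / (t\<^sup>2 + r\<^sup>2)) has_real_derivative - (c * (2 * t)) / (t\<^sup>2 + r\<^sup>2)\<^sup>2) (at t)" for c
        using pos[of t] by (auto intro!: derivative_eq_intros simp: power2_eq_square)
      from this[of "- (r\<^sup>2 / 2)"] show ?thesis by simp
    qed
    have "filterlim (\<lambda>t::real. t\<^sup>2 + r\<^sup>2) at_top at_top"
    proof (rule filterlim_at_top_mono[OF filterlim_ident])
      show "\<forall>\<^sub>F t::real in at_top. t \<le> t\<^sup>2 + r\<^sup>2"
        using eventually_ge_at_top[of 1]
      proof eventually_elim
        case (elim t)
        then have "t * 1 \<le> t * t" by (intro mult_left_mono) auto
        then show ?case by (simp add: power2_eq_square add_increasing2)
      qed
    qed
    then show "((\<lambda>t. (- (r\<^sup>2 / 2)) / (t\<^sup>2 + r\<^sup>2)) \<longlongrightarrow> 0) at_top"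
      by (intro tendsto_divide_0[OF tendsto_const] filterlim_at_top_imp_at_infinity)
  qed auto
  then show ?thesis using r by simp
qed

text \<open>Since \<open>t(t\<^sup>2 + r\<^sup>2) powr - ((d + 1) / 2) \<le> b / r\<^sup>d\<close> with \<open>b = rt / (t\<^sup>2 + r\<^sup>2) \<le> 1\<close>, its \<open>q\<close>-th power
  may be replaced by its square.\<close>

lemma lq_norm_far:
  fixes u :: "real \<Rightarrow> 'x::banach"
  assumes q: "2 \<le> q" and r: "0 < r" and d: "1 \<le> d" and K: "0 \<le> K"
    and le: "\<And>t. 0 < t \<Longrightarrow> ennreal (norm (u t))
        \<le> ennreal (K * (t * (t\<^sup>2 + r\<^sup>2) powr - ((real d + 1) / 2))) * I"
  shows "lq_norm q u \<le> ennreal (K / r ^ d) * I"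
proof -
  have [measurable]: "(\<lambda>t::real. ennreal (r * t / (t\<^sup>2 + r\<^sup>2))) \<in> borel_measurable dt_over_t"
    by (rule borel_imp_dt_measurable) simp
  have pos: "0 < t\<^sup>2 + r\<^sup>2" for t :: real using r by (simp add: add_nonneg_pos)
  have le': "ennreal (norm (u t)) \<le> ennreal (K / r ^ d) * I * ennreal (r * t / (t\<^sup>2 + r\<^sup>2))" if t: "0 < t" for t
  proof -
    have "(t\<^sup>2 + r\<^sup>2) powr - ((real d + 1) / 2) = (t\<^sup>2 + r\<^sup>2) powr (- 1) * (t\<^sup>2 + r\<^sup>2) powr - ((real d - 1) / 2)"
      unfolding powr_add[symmetric] by (rule arg_cong[where f = "\<lambda>z. _ powr z"]) (simp add: field_simps)
    also have "\<dots> \<le> (t\<^sup>2 + r\<^sup>2) powr (- 1) * (r\<^sup>2) powr - ((real d - 1) / 2)"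
      using r d by (intro mult_left_mono powr_mono2') auto
    also have "(r\<^sup>2) powr - ((real d - 1) / 2) = r powr - (real d - 1)"
      using square_powr_half[OF r, of "real d - 2"] by simp
    also have "\<dots> = r / r ^ d"
      using r by (simp add: powr_diff powr_minus_divide powr_realpow)
    also have "(t\<^sup>2 + r\<^sup>2) powr (- 1) = 1 / (t\<^sup>2 + r\<^sup>2)"
      using pos[of t] by (simp add: powr_minus_divide)
    finally have "K * (t * (t\<^sup>2 + r\<^sup>2) powr - ((real d + 1) / 2)) \<le> K * (t * (1 / (t\<^sup>2 + r\<^sup>2) * (r / r ^ d)))"
      using K t by (intro mult_left_mono) auto
    also have "\<dots> = K / r ^ d * (r * t / (t\<^sup>2 + r\<^sup>2))" by (simp add: mult_ac)
    finally have "ennreal (K * (t * (t\<^sup>2 + r\<^sup>2) powr - ((real d + 1) / 2))) * I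
        \<le> ennreal (K / r ^ d * (r * t / (t\<^sup>2 + r\<^sup>2))) * I"
      by (intro mult_right_mono ennreal_leI) auto
    also have "\<dots> = ennreal (K / r ^ d) * I * ennreal (r * t / (t\<^sup>2 + r\<^sup>2))"
      using K r t pos[of t] by (subst ennreal_mult) (auto simp: mult_ac)
    finally show ?thesis using le[OF t] by (rule order.trans[rotated])
  qed
  have "(\<integral>\<^sup>+t. epowr (ennreal (norm (u t))) q \<partial>dt_over_t)
      \<le> (\<integral>\<^sup>+t. epowr (ennreal (K / r ^ d) * I) q * epowr (ennreal (r * t / (t\<^sup>2 + r\<^sup>2))) q \<partial>dt_over_t)"
    using q le' by (intro nn_integral_mono) (simp add: epowr_mult[symmetric] epowr_mono)
  also have "\<dots> = epowr (ennreal (K / r ^ d) * I) q * (\<integral>\<^sup>+t. epowr (ennreal (r * t / (t\<^sup>2 + r\<^sup>2))) q \<partial>dt_over_t)"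
    by (rule nn_integral_cmult) measurable
  also have "(\<integral>\<^sup>+t. epowr (ennreal (r * t / (t\<^sup>2 + r\<^sup>2))) q \<partial>dt_over_t)
      = (\<integral>\<^sup>+t. indicator {0<..} t * (ennreal (1 / t) * epowr (ennreal (r * t / (t\<^sup>2 + r\<^sup>2))) q) \<partial>lborel)"
    by (rule nn_integral_dt_over_t) measurable
  also have "\<dots> \<le> (\<integral>\<^sup>+t. ennreal (r\<^sup>2 * t / (t\<^sup>2 + r\<^sup>2)\<^sup>2) * indicator {0..} t \<partial>lborel)"
  proof (rule nn_integral_mono)
    fix t :: real
    show "indicator {0<..} t * (ennreal (1 / t) * epowr (ennreal (r * t / (t\<^sup>2 + r\<^sup>2))) q)
        \<le> ennreal (r\<^sup>2 * t / (t\<^sup>2 + r\<^sup>2)\<^sup>2) * indicator {0..} t"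
    proof (cases "0 < t")
      case True
      define b where "b = r * t / (t\<^sup>2 + r\<^sup>2)"
      have "2 * (r * t) \<le> t\<^sup>2 + r\<^sup>2" using sum_squares_bound[of r t] by (simp add: algebra_simps)
      then have b: "0 < b" "b \<le> 1" using r True pos[of t] by (auto simp: b_def)
      have "b powr q \<le> b powr 2" using b q by (intro powr_mono') auto
      then have "1 / t * b powr q \<le> 1 / t * b\<^sup>2"
        using b True by (intro mult_left_mono) (auto simp: powr_numeral)
      also have "\<dots> = r\<^sup>2 * t / (t\<^sup>2 + r\<^sup>2)\<^sup>2"
        using True by (simp add: b_def power_divide power_mult_distrib power2_eq_square)
      finally have "ennreal (1 / t * b powr q) \<le> ennreal (r\<^sup>2 * t / (t\<^sup>2 + r\<^sup>2)\<^sup>2)" by (rule ennreal_leI)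
      then show ?thesis
        using True b by (simp add: epowr_ennreal ennreal_mult[symmetric] flip: b_def)
    qed simp
  qed
  also have "\<dots> = ennreal (1 / 2)" by (rule nn_integral_poisson_profile[OF r])
  finally have "(\<integral>\<^sup>+t. epowr (ennreal (norm (u t))) q \<partial>dt_over_t)
      \<le> epowr (ennreal (K / r ^ d) * I) q * ennreal (1 / 2)"
    by (simp add: mult_left_mono)
  also have "\<dots> \<le> epowr (ennreal (K / r ^ d) * I) q * 1"
  proof (rule mult_left_mono)
    show "ennreal (1 / 2) \<le> 1" using ennreal_leI[of "1 / 2" 1] by (simp only: ennreal_1)
  qed simp
  finally have "lq_norm q u \<le> epowr (epowr (ennreal (K / r ^ d) * I) q) (1 / q)"
    unfolding lq_norm_eq using q by (intro epowr_mono) auto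
  then show ?thesis using q by simp
qed

section \<open>Strong measurability with values in \<open>L\<^sup>q\<^sub>X\<close>\<close>

text \<open>Step functions of mesh \<open>1 / N\<close>, encoded by the sequence of their values:
  the composition of a measurable map into the natural numbers with an arbitrary sequence.\<close>

definition stepf :: "nat \<Rightarrow> (nat \<Rightarrow> 'x) \<Rightarrow> real \<Rightarrow> 'x" where
  "stepf N v t = v (nat \<lfloor>real N * t\<rfloor>)"

definition grid :: "nat \<Rightarrow> real \<Rightarrow> real" where
  "grid n t = (real (nat \<lfloor>real (Suc n) * t\<rfloor>) + 1) / real (Suc n)"

lemma grid_pos: "0 < grid n t"
  by (simp add: grid_def)

lemma grid_LIMSEQ:
  assumes t: "0 < t"
  shows "(\<lambda>n. grid n t) \<longlonglongrightarrow> t"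
proof -
  have le: "\<bar>grid n t - t\<bar> \<le> 1 / real (Suc n)" for n
  proof -
    define k where "k = real (nat \<lfloor>real (Suc n) * t\<rfloor>)"
    define M where "M = real (Suc n)"
    have M: "0 < M" by (simp add: M_def)
    note k_def' = k_def[folded M_def]
    have "k = real_of_int \<lfloor>M * t\<rfloor>" using t by (simp add: k_def M_def)
    then have k: "k \<le> M * t" "M * t < k + 1" by linarith+
    have "grid n t - t = (k + 1 - M * t) / M"
      using M unfolding grid_def M_def[symmetric] k_def'[symmetric]
      by (simp add: field_simps)
    moreover have "0 \<le> (k + 1 - M * t) / M" "(k + 1 - M * t) / M \<le> 1 / M"
      using k M by (auto intro!: divide_right_mono)
    ultimately show ?thesis unfolding M_def[symmetric] by (metis abs_of_nonneg)
  qed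
  have "(\<lambda>n. grid n t - t) \<longlonglongrightarrow> 0"
  proof (rule Lim_null_comparison)
    show "\<forall>\<^sub>F n in sequentially. norm (grid n t - t) \<le> 1 / real (Suc n)" using le by simp
    show "(\<lambda>n. 1 / real (Suc n)) \<longlonglongrightarrow> 0" by (rule LIMSEQ_Suc[OF lim_1_over_n])
  qed
  then show ?thesis by (simp add: LIM_zero_iff)
qed

lemma continuous_grid_LIMSEQ:
  assumes "continuous_on {0<..} u" "0 < t"
  shows "(\<lambda>n. u (grid n t)) \<longlonglongrightarrow> u t"
  using continuous_on_tendsto_compose[OF assms(1) grid_LIMSEQ[OF assms(2)]] assms(2) grid_pos by auto

lemma measurable_nat_floor: "(\<lambda>t::real. nat \<lfloor>c * t\<rfloor>) \<in> measurable borel (count_space UNIV)"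
  by measurable

lemma norm_diff_stepf_measurable:
  assumes "continuous_on {0<..} u"
  shows "(\<lambda>t. norm (u t - stepf N v t)) \<in> borel_measurable dt_over_t"
  unfolding stepf_def
proof (rule measurable_compose_countable[where g = "\<lambda>t. nat \<lfloor>real N * t\<rfloor>" and f = "\<lambda>j t. norm (u t - v j)"])
  show "(\<lambda>t. norm (u t - v j)) \<in> borel_measurable dt_over_t" for j
    by (intro continuous_dt_measurable continuous_intros assms)
  show "(\<lambda>t. nat \<lfloor>real N * t\<rfloor>) \<in> measurable dt_over_t (count_space UNIV)"
    by (rule borel_imp_dt_measurable[OF measurable_nat_floor])
qed

text \<open>Strong measurability is known for each fixed \<open>t\<close> only. With
  \<open>grid n t\<close> in place of \<open>t\<close> the function depends on \<open>t\<close>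
  through a cell index, so it is jointly measurable; letting \<open>n\<close> grow, continuity in
  \<open>t\<close> transfers this to \<open>H\<close>. The integral over \<open>t\<close> is then
  measurable in \<open>x\<close>.\<close>

lemma lq_norm_diff_stepf_measurable:
  fixes h :: "'a::euclidean_space \<Rightarrow> real \<Rightarrow> 'x::banach"
  assumes sm: "\<And>t. 0 < t \<Longrightarrow> strongly_measurable lebesgue banach_space (\<lambda>x. h x t)"
    and cont: "\<And>x. continuous_on {0<..} (h x)"
  shows "(\<lambda>x. lq_norm q (\<lambda>t. h x t - stepf N v t)) \<in> borel_measurable lebesgue"
proof -
  let ?P = "(lebesgue :: 'a measure) \<Otimes>\<^sub>M (lborel :: real measure)"
  define G where "G n p = indicat_real {0<..} (snd p) * norm (h (fst p) (grid n (snd p)) - stepf N v (snd p))"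
    for n and p :: "'a \<times> real"
  define H where "H p = indicat_real {0<..} (snd p) * norm (h (fst p) (snd p) - stepf N v (snd p))"
    for p :: "'a \<times> real"
  have fl: "(\<lambda>p. nat \<lfloor>c * snd p\<rfloor>) \<in> measurable ?P (count_space UNIV)" for c
    by (rule measurable_compose[OF measurable_snd]) (simp add: measurable_nat_floor)
  have [measurable]: "G n \<in> borel_measurable ?P" for n
  proof -
    have "(\<lambda>p. norm (h (fst p) (grid n (snd p)) - stepf N v (snd p))) \<in> borel_measurable ?P"
      unfolding stepf_def grid_def
    proof (rule measurable_compose_countable[where g = "\<lambda>p. nat \<lfloor>real N * snd p\<rfloor>"
          and f = "\<lambda>j p. norm (h (fst p) ((real (nat \<lfloor>real (Suc n) * snd p\<rfloor>) + 1) / real (Suc n)) - v j)", OF _ fl])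
      fix j
      show "(\<lambda>p. norm (h (fst p) ((real (nat \<lfloor>real (Suc n) * snd p\<rfloor>) + 1) / real (Suc n)) - v j)) \<in> borel_measurable ?P"
      proof (rule measurable_compose_countable[where g = "\<lambda>p. nat \<lfloor>real (Suc n) * snd p\<rfloor>"
            and f = "\<lambda>k p. norm (h (fst p) ((real k + 1) / real (Suc n)) - v j)", OF _ fl])
        fix k :: nat
        have "(\<lambda>x. norm (h x ((real k + 1) / real (Suc n)) - v j)) \<in> borel_measurable lebesgue"
          by (intro completion.strongly_measurable_norm strongly_measurable_diff sm strongly_measurable_const) simp
        then show "(\<lambda>p. norm (h (fst p) ((real k + 1) / real (Suc n)) - v j)) \<in> borel_measurable ?P"
          by (rule measurable_compose[OF measurable_fst])
      qed
    qed
    moreover have "(\<lambda>p. indicat_real {0<..} (snd p)) \<in> borel_measurable ?P"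
      by (rule measurable_compose[OF measurable_snd]) simp
    ultimately show ?thesis unfolding G_def by (intro borel_measurable_times)
  qed
  have [measurable]: "H \<in> borel_measurable ?P"
  proof (rule borel_measurable_LIMSEQ_real[where u = G])
    fix p :: "'a \<times> real"
    show "(\<lambda>n. G n p) \<longlonglongrightarrow> H p"
    proof (cases "0 < snd p")
      case True
      show ?thesis unfolding G_def H_def
        by (intro tendsto_intros continuous_grid_LIMSEQ cont True)
    qed (simp add: G_def H_def)
  qed simp
  have "(\<integral>\<^sup>+t. epowr (ennreal (norm (h x t - stepf N v t))) q \<partial>dt_over_t)
      = (\<integral>\<^sup>+t. indicator {0<..} t * (ennreal (1 / t) * epowr (ennreal (H (x, t))) q) \<partial>lborel)" for x
  proof -
    note [measurable] = norm_diff_stepf_measurable[OF cont]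
    have "(\<integral>\<^sup>+t. epowr (ennreal (norm (h x t - stepf N v t))) q \<partial>dt_over_t)
        = (\<integral>\<^sup>+t. indicator {0<..} t * (ennreal (1 / t) * epowr (ennreal (norm (h x t - stepf N v t))) q) \<partial>lborel)"
      by (rule nn_integral_dt_over_t) measurable
    also have "\<dots> = (\<integral>\<^sup>+t. indicator {0<..} t * (ennreal (1 / t) * epowr (ennreal (H (x, t))) q) \<partial>lborel)"
      by (intro nn_integral_cong) (simp add: H_def indicator_def)
    finally show ?thesis .
  qed
  moreover have "(\<lambda>x. \<integral>\<^sup>+t. indicator {0<..} t * (ennreal (1 / t) * epowr (ennreal (H (x, t))) q) \<partial>lborel)
      \<in> borel_measurable lebesgue"
    by (rule lborel.borel_measurable_nn_integral) measurable
  ultimately have "(\<lambda>x. \<integral>\<^sup>+t. epowr (ennreal (norm (h x t - stepf N v t))) q \<partial>dt_over_t) \<in> borel_measurable lebesgue"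
    by simp
  then show ?thesis unfolding lq_norm_eq by measurable
qed

lemma lq_norm_measurable:
  fixes h :: "'a::euclidean_space \<Rightarrow> real \<Rightarrow> 'x::banach"
  assumes "\<And>t. 0 < t \<Longrightarrow> strongly_measurable lebesgue banach_space (\<lambda>x. h x t)"
    and "\<And>x. continuous_on {0<..} (h x)"
  shows "(\<lambda>x. lq_norm q (h x)) \<in> borel_measurable lebesgue"
  using lq_norm_diff_stepf_measurable[OF assms, where v = "\<lambda>_. 0"] by (simp add: stepf_def)

section \<open>Density of step functions with finitely many values\<close>

lemma nn_integral_dt_over_t_interval:
  assumes "0 < a" "a \<le> b"
  shows "(\<integral>\<^sup>+t. indicator {a..b} t \<partial>dt_over_t) \<le> ennreal ((b - a) / a)"
proof -
  have "(\<integral>\<^sup>+t. indicator {a..b} t \<partial>dt_over_t)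
      = (\<integral>\<^sup>+t. indicator {0<..} t * (ennreal (1 / t) * indicator {a..b} t) \<partial>lborel)"
    by (intro nn_integral_dt_over_t borel_imp_dt_measurable) simp
  also have "\<dots> \<le> (\<integral>\<^sup>+t. ennreal (1 / a) * indicator {a..b} t \<partial>lborel)"
    using assms by (intro nn_integral_mono) (auto simp: indicator_def intro!: ennreal_leI divide_left_mono)
  also have "\<dots> = ennreal (1 / a) * ennreal (b - a)"
    using assms by (simp add: nn_integral_cmult_indicator)
  also have "\<dots> = ennreal ((b - a) / a)" using assms by (simp flip: ennreal_mult)
  finally show ?thesis .
qed

text \<open>A list makes all but finitely many values zero, and index 0 is forced to the value 0 as
  well. The step function thus vanishes near 0 and near infinity, where \<open>dt/t\<close> has
  infinite mass. Lists over a countable set are countable in number.\<close>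

definition list_vals :: "'x::zero list \<Rightarrow> nat \<Rightarrow> 'x" where
  "list_vals vs j = (if 1 \<le> j \<and> j < length vs then vs ! j else 0)"

lemma stepf_carrier:
  fixes vs :: "'x::banach list"
  assumes q: "0 < q"
  shows "stepf (Suc N) (list_vals vs) \<in> carrier_of (LqX q)"
proof -
  let ?d = "stepf (Suc N) (list_vals vs)"
  have ran: "?d t \<in> insert 0 (set vs)" for t by (auto simp: stepf_def list_vals_def)
  have meas: "?d \<in> measurable dt_over_t (count_space UNIV)"
    unfolding stepf_def
    by (rule measurable_compose[OF borel_imp_dt_measurable[OF measurable_nat_floor]]) simp
  have "simple_function dt_over_t ?d"
    unfolding simple_function_def
  proof (intro conjI ballI)
    show "finite (?d ` space dt_over_t)"
      by (rule finite_subset[of _ "insert 0 (set vs)"]) (use ran in auto)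
    show "?d -` {x} \<inter> space dt_over_t \<in> sets dt_over_t" for x
      by (rule measurable_sets[OF meas]) simp
  qed
  then have sm: "strongly_measurable dt_over_t banach_space ?d" by (rule strongly_measurable_simple)
  define B where "B = (\<Sum>v\<leftarrow>vs. norm v)"
  have B0: "0 \<le> B" unfolding B_def by (rule sum_list_nonneg) auto
  have B: "norm v \<le> B" if "v \<in> set vs" for v
    unfolding B_def by (rule member_le_sum_list) (use that in auto)
  \<comment> \<open>Index at least 1 means \<open>t \<ge> a\<close>, and index below
    \<open>length vs\<close> gives \<open>t \<le> b\<close>; so the step function lives on
    \<open>{a..b}\<close>, which has finite mass.\<close>
  define a b where "a = 1 / real (Suc N)" and "b = a + real (length vs) / real (Suc N)"
  have ab: "0 < a" "a \<le> b" by (simp_all add: a_def b_def)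
  have "(\<integral>\<^sup>+t. epowr (ennreal (norm (?d t))) q \<partial>dt_over_t) \<le> (\<integral>\<^sup>+t. ennreal (B powr q) * indicator {a..b} t \<partial>dt_over_t)"
  proof (rule nn_integral_mono)
    fix t assume "t \<in> space dt_over_t"
    then have t: "0 < t" by simp
    show "epowr (ennreal (norm (?d t))) q \<le> ennreal (B powr q) * indicator {a..b} t"
    proof (cases "1 \<le> nat \<lfloor>real (Suc N) * t\<rfloor> \<and> nat \<lfloor>real (Suc N) * t\<rfloor> < length vs")
      case True
      then have "1 \<le> real (Suc N) * t" by linarith
      then have "a \<le> t" by (simp add: a_def divide_simps mult.commute del: of_nat_Suc)
      moreover have "real (Suc N) * t \<le> real (length vs) + 1" using True by linarith
      then have "t \<le> b" by (simp add: a_def b_def field_simps del: of_nat_Suc)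
      moreover have "norm (?d t) \<le> B" using True by (auto simp: stepf_def list_vals_def intro!: B)
      then have "norm (?d t) powr q \<le> B powr q" using q by (intro powr_mono2) auto
      ultimately show ?thesis by (simp add: epowr_ennreal ennreal_leI)
    qed (auto simp: stepf_def list_vals_def)
  qed
  also have "\<dots> = ennreal (B powr q) * (\<integral>\<^sup>+t. indicator {a..b} t \<partial>dt_over_t)"
    by (intro nn_integral_cmult borel_imp_dt_measurable) simp
  also have "\<dots> \<le> ennreal (B powr q) * ennreal ((b - a) / a)"
    by (intro mult_left_mono nn_integral_dt_over_t_interval ab) simp
  also have "\<dots> < \<infinity>" by (simp add: ennreal_mult_less_top)
  finally show ?thesis
    using sm by (simp add: bochner_Lp_def Lp_norm_def banach_space_def)
qed

text \<open>The parts of \<open>u\<close> near 0 and near infinity are small because the integral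
  converges. On the remaining compact interval \<open>u\<close> is uniformly continuous, so its
  values at grid points, replaced by nearby points of \<open>D\<close>, give the step
  function.\<close>

lemma stepf_dense:
  fixes u :: "real \<Rightarrow> 'x::banach"
  assumes q: "0 < q" and cont: "continuous_on {0<..} u" and fin: "lq_norm q u < \<infinity>"
    and D: "\<And>t. 0 < t \<Longrightarrow> u t \<in> closure D" and e: "0 < e"
  shows "\<exists>N. \<exists>vs\<in>lists (insert 0 D). lq_norm q (\<lambda>t. u t - stepf (Suc N) (list_vals vs) t) < e"
proof -
  obtain e' where e': "0 < e'" "ennreal e' \<le> e"
  proof (cases e)
    case (real r)
    then show ?thesis using e by (intro that[of r]) auto
  next
    case top
    then show ?thesis by (intro that[of 1]) auto
  qed
  \<comment> \<open>Half of the allowed error in the \<open>q\<close>-th power goes to the two ends,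
    half to the compact interval.\<close>
  define \<eta> where "\<eta> = e' powr q / 2"
  have \<eta>: "0 < \<eta>" using e' by (simp add: \<eta>_def)
  define g where "g t = epowr (ennreal (norm (u t))) q" for t
  have um: "(\<lambda>t. norm (u t)) \<in> borel_measurable dt_over_t"
    by (intro continuous_dt_measurable continuous_intros cont)
  then have [measurable]: "g \<in> borel_measurable dt_over_t" unfolding g_def by measurable
  have g_fin: "(\<integral>\<^sup>+t. g t \<partial>dt_over_t) < \<infinity>"
    using fin by (simp add: lq_norm_eq g_def)
  define T where "T n = {t::real. t < 1 / real (Suc n) \<or> real (Suc n) < t}" for n
  have T_meas [measurable]: "(\<lambda>t. indicator (T n) t :: ennreal) \<in> borel_measurable dt_over_t" for n
    unfolding T_def by (intro borel_imp_dt_measurable) measurable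
  have "(\<lambda>n. \<integral>\<^sup>+t. g t * indicator (T n) t \<partial>dt_over_t) \<longlonglongrightarrow> (\<integral>\<^sup>+t. 0 \<partial>dt_over_t)"
  proof (rule nn_integral_dominated_convergence[where w = g])
    show "AE t in dt_over_t. g t * indicator (T n) t \<le> g t" for n
      by (intro AE_I2) (simp add: indicator_def)
    show "AE t in dt_over_t. (\<lambda>n. g t * indicator (T n) t) \<longlonglongrightarrow> 0"
    proof (rule AE_I2)
      fix t assume "t \<in> space dt_over_t"
      then have t: "0 < t" by simp
      obtain n1 where n1: "inverse (real (Suc n1)) < t" using reals_Archimedean[OF t] by blast
      obtain n2 where n2: "t < real n2" using reals_Archimedean2 by blast
      have "g t * indicator (T n) t = 0" if n: "n1 \<le> n" "n2 \<le> n" for n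
      proof -
        have "1 / real (Suc n) \<le> 1 / real (Suc n1)" using n by (intro divide_left_mono) auto
        then have "1 / real (Suc n) \<le> t" using n1 by (simp add: inverse_eq_divide)
        moreover have "t \<le> real (Suc n)" using n2 n by linarith
        ultimately show ?thesis by (simp add: T_def indicator_def)
      qed
      then have "\<forall>\<^sub>F n in sequentially. g t * indicator (T n) t = 0"
        unfolding eventually_sequentially by (intro exI[of _ "max n1 n2"]) simp
      then show "(\<lambda>n. g t * indicator (T n) t) \<longlonglongrightarrow> 0" by (rule tendsto_eventually)
    qed
  qed (use g_fin in simp_all)
  then have "\<forall>\<^sub>F n in sequentially. (\<integral>\<^sup>+t. g t * indicator (T n) t \<partial>dt_over_t) < ennreal \<eta>"
    using \<eta> by (intro order_tendstoD(2)) auto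
  then obtain n where n: "(\<integral>\<^sup>+t. g t * indicator (T n) t \<partial>dt_over_t) < ennreal \<eta>"
    by (auto simp: eventually_sequentially)
  \<comment> \<open>The interval is enlarged beyond \<open>{\<alpha>..\<beta>}\<close> so that cells
    never straddle the two regimes: with mesh below \<open>a = \<alpha> / 2\<close>, a cell starting
    below \<open>a\<close> lies below \<open>\<alpha>\<close>, and a cell starting at or after
    \<open>b\<close> lies beyond \<open>\<beta>\<close>.\<close>
  define \<alpha> \<beta> a b where "\<alpha> = 1 / real (Suc n)" and "\<beta> = real (Suc n)" and "a = \<alpha> / 2" and "b = \<beta> + 1"
  have "\<alpha> \<le> 1" "1 \<le> \<beta>" by (simp_all add: \<alpha>_def \<beta>_def)
  moreover have "0 < \<alpha>" by (simp add: \<alpha>_def)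
  ultimately have \<alpha>: "0 < \<alpha>" "\<alpha> \<le> \<beta>" by linarith+
  have a: "0 < a" "a < \<alpha>" "a \<le> b" "0 < b" using \<alpha> by (auto simp: a_def b_def)
  define L where "L = (b + 1 - a) / a"
  have L: "0 \<le> L" using a by (simp add: L_def)
  \<comment> \<open>The pointwise error will be at most \<open>2 * \<kappa>\<close>, one
    \<open>\<kappa>\<close> from uniform continuity and one from approximation by \<open>D\<close>.
    As \<open>L\<close> bounds the mass of \<open>{a..b + 1}\<close>, this \<open>\<kappa>\<close>
    keeps the integrated error within \<open>\<eta>\<close>.\<close>
  define \<kappa> where "\<kappa> = (\<eta> / (L + 1)) powr (1 / q) / 2"
  have \<kappa>: "0 < \<kappa>" using \<eta> L by (simp add: \<kappa>_def)
  have \<kappa>L: "(2 * \<kappa>) powr q * L \<le> \<eta>"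
  proof -
    have "(2 * \<kappa>) powr q = \<eta> / (L + 1)" using q \<eta> L by (simp add: \<kappa>_def powr_powr)
    moreover have "\<eta> * (L / (L + 1)) \<le> \<eta> * 1" using \<eta> L by (intro mult_left_mono) auto
    ultimately show ?thesis by simp
  qed
  have "uniformly_continuous_on {a..b + 1} u"
    using a by (intro compact_uniformly_continuous continuous_on_subset[OF cont]) auto
  then obtain \<delta> where \<delta>: "0 < \<delta>"
    "\<And>s t. s \<in> {a..b + 1} \<Longrightarrow> t \<in> {a..b + 1} \<Longrightarrow> dist t s < \<delta> \<Longrightarrow> dist (u t) (u s) < \<kappa>"
    unfolding uniformly_continuous_on_def using \<kappa> by metis
  obtain N where "inverse (real (Suc N)) < min \<delta> (min a 1)"
    using reals_Archimedean[of "min \<delta> (min a 1)"] \<delta> a by auto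
  then have N: "1 / real (Suc N) < \<delta>" "1 / real (Suc N) < a" "1 / real (Suc N) < 1"
    by (simp_all add: inverse_eq_divide)
  define M where "M = real (Suc N)"
  have M: "0 < M" by (simp add: M_def)
  note N = N[folded M_def]
  have "\<exists>w\<in>insert 0 D. if a \<le> real j / M then norm (w - u (real j / M)) < \<kappa> else w = 0" for j
  proof (cases "a \<le> real j / M")
    case True
    then have "0 < real j / M" using a by linarith
    then obtain w where "w \<in> D" "dist w (u (real j / M)) < \<kappa>"
      using D[of "real j / M"] \<kappa> closure_approachable by blast
    then show ?thesis using True by (auto simp: dist_norm)
  qed auto
  then obtain w where w: "\<And>j. w j \<in> insert 0 D"
    "\<And>j. a \<le> real j / M \<Longrightarrow> norm (w j - u (real j / M)) < \<kappa>" "\<And>j. \<not> a \<le> real j / M \<Longrightarrow> w j = 0"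
    by metis
  \<comment> \<open>The number of cells whose left end point is below \<open>b\<close>.\<close>
  define l where "l = nat \<lceil>M * b\<rceil>"
  define vs where "vs = map w [0..<l]"
  have vs: "vs \<in> lists (insert 0 D)" using w(1) by (auto simp: vs_def in_lists_conv_set simp del: insert_iff)
  let ?d = "stepf (Suc N) (list_vals vs)"
  have pointwise: "epowr (ennreal (norm (u t - ?d t))) q
      \<le> ennreal ((2 * \<kappa>) powr q) * indicator {a..b + 1} t + g t * indicator (T n) t" if t: "0 < t" for t
  proof -
    define j where "j = nat \<lfloor>M * t\<rfloor>"
    have "real j = real_of_int \<lfloor>M * t\<rfloor>" using t M by (simp add: j_def)
    then have "real j \<le> M * t" "M * t < real j + 1" by linarith+
    then have j: "real j / M \<le> t" "t < real j / M + 1 / M"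
      using M by (auto simp: field_simps)
    \<comment> \<open>The grid point of index 0 is 0, which is below \<open>a\<close>, so
      \<open>w\<close> agrees there with the 0 that \<open>list_vals\<close> imposes.\<close>
    have w0: "w 0 = 0" using a w(3)[of 0] by simp
    have d: "?d t = (if j < l then w j else 0)"
      using w0 unfolding stepf_def M_def[symmetric] j_def[symmetric] list_vals_def vs_def by (cases j) auto
    consider "j < l" "a \<le> real j / M" | "?d t = 0" "t \<in> T n"
    proof (cases "j < l")
      case True
      show ?thesis
      proof (cases "a \<le> real j / M")
        case False
        then have "?d t = 0" using d True w(3) by simp
        moreover have "t < \<alpha>" using False j(2) N(2) a_def by linarith
        ultimately show ?thesis using that(2) by (simp add: T_def \<alpha>_def)
      qed (use that True in blast)
    next
      case False
      then have "M * b \<le> real j" unfolding l_def by linarith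
      then have "b \<le> real j / M" using M by (simp add: field_simps)
      then have "\<beta> < t" using j(1) by (simp add: b_def)
      then show ?thesis using that(2) False d by (simp add: T_def \<beta>_def)
    qed
    then show ?thesis
    proof cases
      case 1
      have "real j < M * b" using 1(1) unfolding l_def by linarith
      then have "real j / M < b" using M by (simp add: field_simps)
      then have jj: "real j / M \<in> {a..b + 1}" and tt: "t \<in> {a..b + 1}"
        using 1(2) j N(3) by auto
      have "dist t (real j / M) < \<delta>" using j N(1) by (simp add: dist_real_def)
      then have "dist (u t) (u (real j / M)) < \<kappa>" by (rule \<delta>(2)[OF jj tt])
      moreover have "norm (w j - u (real j / M)) < \<kappa>" by (rule w(2)[OF 1(2)])
      ultimately have "norm (u t - ?d t) \<le> 2 * \<kappa>"
        using d 1(1) norm_triangle_ineq4[of "u t - u (real j / M)" "w j - u (real j / M)"]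
        by (simp add: dist_norm)
      then have "norm (u t - ?d t) powr q \<le> (2 * \<kappa>) powr q" using q by (intro powr_mono2) auto
      then have "epowr (ennreal (norm (u t - ?d t))) q \<le> ennreal ((2 * \<kappa>) powr q) * indicator {a..b + 1} t"
        using tt by (simp add: epowr_ennreal ennreal_leI)
      then show ?thesis by (simp add: add_increasing2)
    next
      case 2
      then show ?thesis by (simp add: g_def add_increasing)
    qed
  qed
  have "(\<integral>\<^sup>+t. epowr (ennreal (norm (u t - ?d t))) q \<partial>dt_over_t)
      \<le> (\<integral>\<^sup>+t. ennreal ((2 * \<kappa>) powr q) * indicator {a..b + 1} t + g t * indicator (T n) t \<partial>dt_over_t)"
    using pointwise by (intro nn_integral_mono) simp
  also have "\<dots> = ennreal ((2 * \<kappa>) powr q) * (\<integral>\<^sup>+t. indicator {a..b + 1} t \<partial>dt_over_t)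
      + (\<integral>\<^sup>+t. g t * indicator (T n) t \<partial>dt_over_t)"
  proof -
    have [measurable]: "(\<lambda>t. indicator {a..b + 1} t :: ennreal) \<in> borel_measurable dt_over_t"
      by (intro borel_imp_dt_measurable) simp
    have "(\<lambda>t. g t * indicator (T n) t) \<in> borel_measurable dt_over_t" by (intro borel_measurable_times_ennreal) measurable
    then show ?thesis
      by (simp add: nn_integral_add nn_integral_cmult)
  qed
  also have "\<dots> \<le> ennreal ((2 * \<kappa>) powr q) * ennreal L + (\<integral>\<^sup>+t. g t * indicator (T n) t \<partial>dt_over_t)"
    unfolding L_def using a by (intro add_right_mono mult_left_mono nn_integral_dt_over_t_interval) auto
  also have "\<dots> \<le> ennreal \<eta> + (\<integral>\<^sup>+t. g t * indicator (T n) t \<partial>dt_over_t)"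
    using \<kappa>L L by (intro add_right_mono) (simp add: ennreal_leI flip: ennreal_mult)
  also have "\<dots> < ennreal \<eta> + ennreal \<eta>"
    using n by (simp add: ennreal_add_left_cancel_less)
  also have "\<dots> = epowr (ennreal e') q"
    using \<eta> e' by (simp add: \<eta>_def epowr_ennreal flip: ennreal_plus)
  finally have *: "(\<integral>\<^sup>+t. epowr (ennreal (norm (u t - ?d t))) q \<partial>dt_over_t) < epowr (ennreal e') q" .
  have "lq_norm q (\<lambda>t. u t - ?d t) < ennreal e'"
  proof (rule ccontr)
    assume "\<not> lq_norm q (\<lambda>t. u t - ?d t) < ennreal e'"
    then have "epowr (ennreal e') q \<le> epowr (lq_norm q (\<lambda>t. u t - ?d t)) q"
      using q by (intro epowr_mono) auto
    then show False using * q by (simp add: lq_norm_eq)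
  qed
  then show ?thesis using e'(2) vs by (meson less_le_trans)
qed

lemma continuous_strongly_measurable_dt:
  fixes u :: "real \<Rightarrow> 'x::banach"
  assumes "continuous_on {0<..} u"
  shows "strongly_measurable dt_over_t banach_space u"
proof -
  let ?D = "range (\<lambda>(k::nat, n::nat). u ((real k + 1) / real (Suc n)))"
  have countable: "countable ?D" by simp
  have meas: "(\<lambda>t. norm (u t - v)) \<in> borel_measurable dt_over_t" for v
    using assms by (simp add: continuous_dt_measurable continuous_on_norm continuous_on_diff)
  have "AE t in dt_over_t. u t \<in> closure ?D"
  proof (rule AE_I2)
    fix t assume "t \<in> space dt_over_t"
    then have lim: "(\<lambda>n. u (grid n t)) \<longlonglongrightarrow> u t" by (intro continuous_grid_LIMSEQ assms) simp
    have "u (grid n t) \<in> ?D" for n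
      unfolding grid_def by (rule image_eqI[of _ _ "(nat \<lfloor>real (Suc n) * t\<rfloor>, n)"]) simp_all
    then have "u (grid n t) \<in> closure ?D" for n
      using closure_subset by (rule subsetD[rotated])
    then show "u t \<in> closure ?D"
      using lim by (rule closed_sequentially[OF closed_closure])
  qed
  from strongly_measurable_banachI[OF countable this meas] show ?thesis .
qed

lemma lq_carrier:
  assumes "continuous_on {0<..} u" "lq_norm q u < \<infinity>"
  shows "u \<in> carrier_of (LqX q)"
  using assms(2) continuous_strongly_measurable_dt[OF assms(1)]
  by (simp add: lq_norm_eq bochner_Lp_def Lp_norm_def banach_space_def)

text \<open>Strong measurability at the countably many grid times gives one countable set
  \<open>E\<close>, and by continuity almost every \<open>h x\<close> takes all its values in the
  closure of \<open>E\<close>. The step functions with values in \<open>E\<close> are then a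
  countable family approximating almost every \<open>h x\<close>, as Pettis' criterion
  demands.\<close>

lemma lq_strongly_measurable:
  fixes h :: "'a::euclidean_space \<Rightarrow> real \<Rightarrow> 'x::banach"
  assumes q: "0 < q" and sm: "\<And>t. 0 < t \<Longrightarrow> strongly_measurable lebesgue banach_space (\<lambda>x. h x t)"
    and cont: "\<And>x. continuous_on {0<..} (h x)"
    and fin: "AE x in lebesgue. lq_norm q (h x) < \<infinity>"
  shows "strongly_measurable lebesgue (LqX q) h"
proof -
  let ?t = "\<lambda>k n. (real k + 1) / real (Suc n)"
  have "\<exists>D. countable D \<and> (AE x in lebesgue. h x (?t k n) \<in> closure D)" for k n
  proof -
    have "strongly_measurable lebesgue banach_space (\<lambda>x. h x (?t k n))" by (rule sm) simp
    then show ?thesis using strongly_measurable_AE_closure by blast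
  qed
  then obtain D where D: "\<And>k n. countable (D k n)" "\<And>k n. AE x in lebesgue. h x (?t k n) \<in> closure (D k n)"
    by metis
  \<comment> \<open>With 0 in \<open>E\<close> the value that \<open>stepf_dense\<close> adds is
    already present, so the lists it returns range over the countable index set
    \<open>I\<close>.\<close>
  define E where "E = insert 0 (\<Union>k n. D k n)"
  have E: "countable E" using D(1) by (auto simp: E_def)
  have "AE x in lebesgue. \<forall>k n. h x (?t k n) \<in> closure (D k n)"
    using D(2) by (simp add: AE_all_countable)
  then have hE: "AE x in lebesgue. \<forall>t>0. h x t \<in> closure E"
  proof eventually_elim
    case (elim x)
    show ?case
    proof (intro allI impI)
      fix t :: real assume t: "0 < t"
      have "closure (D k n) \<subseteq> closure E" for k n by (rule closure_mono) (auto simp: E_def)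
      then have "h x (grid n t) \<in> closure E" for n
        using elim unfolding grid_def by blast
      then show "h x t \<in> closure E"
        using continuous_grid_LIMSEQ[OF cont t] by (rule closed_sequentially[OF closed_closure])
    qed
  qed
  define I where "I = (UNIV :: nat set) \<times> lists E"
  have I: "countable I" "I \<noteq> {}" using E by (auto simp: I_def)
  define d where "d i = (case from_nat_into I i of (N, vs) \<Rightarrow> stepf (Suc N) (list_vals vs))" for i
  show ?thesis
  proof (rule strongly_measurableI_dense[where d = d])
    show "d i \<in> carrier_of (LqX q)" for i
      by (cases "from_nat_into I i") (simp add: d_def stepf_carrier[OF q])
    show "(\<lambda>x. norm_of (LqX q) (h x - d i)) \<in> borel_measurable lebesgue" for i
    proof -
      obtain N vs where "from_nat_into I i = (N, vs)" by fastforce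
      then have "d i = stepf (Suc N) (list_vals vs)" by (simp add: d_def)
      then show ?thesis
        using lq_norm_diff_stepf_measurable[OF sm cont, of q "Suc N" "list_vals vs"]
        by (simp add: lq_norm_def fun_diff_def)
    qed
    show "AE x in lebesgue. h x \<in> carrier_of (LqX q)"
      using fin by eventually_elim (rule lq_carrier[OF cont])
    show "AE x in lebesgue. \<forall>e>0. \<exists>i. norm_of (LqX q) (h x - d i) < e"
      using fin hE
    proof eventually_elim
      case (elim x)
      show ?case
      proof (intro allI impI)
        fix e :: ennreal assume e: "0 < e"
        obtain N vs where vs: "vs \<in> lists (insert 0 E)"
          "lq_norm q (\<lambda>t. h x t - stepf (Suc N) (list_vals vs) t) < e"
          using stepf_dense[OF q cont elim(1) _ e, of E] elim(2) by blast
        then have "(N, vs) \<in> I" by (auto simp: I_def E_def insert_absorb)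
        then obtain i where "from_nat_into I i = (N, vs)" using from_nat_into_surj[OF I(1)] by metis
        then have "norm_of (LqX q) (h x - d i) < e"
          using vs(2) by (simp add: d_def lq_norm_def fun_diff_def)
        then show "\<exists>i. norm_of (LqX q) (h x - d i) < e" ..
      qed
    qed
  qed
qed

section \<open>The critical radius\<close>

definition mass :: "('a::euclidean_space \<Rightarrow> real) \<Rightarrow> 'a \<Rightarrow> real \<Rightarrow> real" where
  "mass V x r = (LINT y:ball x r|lebesgue. V y)"

text \<open>The reverse Hoelder constant is fixed and taken positive, since thresholds below are
  obtained by dividing by it.\<close>

locale reverse_hoelder_potential =
  fixes V :: "'a::euclidean_space \<Rightarrow> real" and s C :: real
  assumes dim: "2 \<le> DIM('a)" and s: "real DIM('a) / 2 < s" and C: "0 < C"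
    and V_nonneg: "\<And>x. 0 \<le> V x"
    and V_int: "\<And>x r. set_integrable lebesgue (ball x r) V"
    and Vs_int: "\<And>x r. 0 < r \<Longrightarrow> set_integrable lebesgue (ball x r) (\<lambda>y. V y powr s)"
    and RH: "\<And>x r. 0 < r \<Longrightarrow>
        (1 / measure lebesgue (ball x r) * (LINT y:ball x r|lebesgue. V y powr s)) powr (1 / s)
          \<le> C / measure lebesgue (ball x r) * mass V x r"
    and V_nonzero: "\<not> (AE x in lebesgue. V x = 0)"
begin

lemma s_gt_1: "1 < s"
  using s dim by linarith

lemma mass_nonneg: "0 \<le> mass V x r"
  by (simp add: mass_def set_lebesgue_integral_def V_nonneg)

lemma set_integral_le_mass:
  assumes "E \<in> sets lebesgue" "E \<subseteq> ball x r"
  shows "set_integrable lebesgue E V" and "(LINT y:E|lebesgue. V y) \<le> mass V x r"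
proof -
  show E: "set_integrable lebesgue E V" by (rule set_integrable_subset[OF V_int assms])
  show "(LINT y:E|lebesgue. V y) \<le> mass V x r"
    unfolding mass_def set_lebesgue_integral_def
    using E V_int[of x r] assms(2) V_nonneg unfolding set_integrable_def
    by (intro integral_mono) (auto simp: indicator_def)
qed

lemma mass_mono: "ball y t \<subseteq> ball x r \<Longrightarrow> mass V y t \<le> mass V x r"
  using set_integral_le_mass(2)[of "ball y t" x r] by (simp add: mass_def)

text \<open>Hoelder's inequality up to a factor \<open>2\<close>, by splitting \<open>V\<close> at the level
  \<open>l\<close> at which both parts contribute equally.\<close>

lemma set_integral_small_subset:
  assumes R: "0 < R" and E: "E \<in> sets lebesgue" "E \<subseteq> ball x R"
    and e: "0 < e" "measure lebesgue E \<le> e * measure lebesgue (ball x R)"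
  shows "(LINT y:E|lebesgue. V y) \<le> 2 * C * e powr (1 - 1 / s) * mass V x R"
proof (cases "mass V x R = 0")
  case True
  then show ?thesis using set_integral_le_mass(2)[OF E] by simp
next
  case False
  then have m: "0 < mass V x R" using mass_nonneg[of x R] by simp
  define b where "b = measure lebesgue (ball x R)"
  have b: "0 < b" using R by (simp add: b_def content_ball_pos)
  \<comment> \<open>\<open>A\<close> is \<open>C\<close> times the mean of \<open>V\<close>, which
    by the reverse Hoelder inequality bounds its mean of order \<open>s\<close>.\<close>
  define A where "A = C / b * mass V x R"
  have A: "0 < A" using C b m by (simp add: A_def)
  define J where "J = (LINT y:ball x R|lebesgue. V y powr s)"
  have J0: "0 \<le> J" by (simp add: J_def set_lebesgue_integral_def)
  have J: "J \<le> b * A powr s"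
  proof -
    have "(1 / b * J) powr (1 / s) \<le> A" using RH[OF R, of x] by (simp add: b_def J_def A_def)
    then have "((1 / b * J) powr (1 / s)) powr s \<le> A powr s"
      using s_gt_1 by (intro powr_mono2) auto
    then have "1 / b * J \<le> A powr s" using s_gt_1 b J0 by (simp add: powr_powr)
    then show ?thesis using b by (simp add: field_simps)
  qed
  define l where "l = A * e powr (- 1 / s)"
  have l: "0 < l" using A e by (simp add: l_def)
  have Elm: "E \<in> lmeasurable" using lmeasurable_ball E(2,1) by (rule fmeasurableI2)
  have intE: "set_integrable lebesgue E (\<lambda>y. V y powr s)" by (rule set_integrable_subset[OF Vs_int[OF R] E])
  have intc: "set_integrable lebesgue E (\<lambda>_. l)"
    unfolding set_integrable_def using Elm by (auto simp: fmeasurable_def intro!: integrable_scaleR_left)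
  have "(LINT y:E|lebesgue. V y) \<le> (LINT y:E|lebesgue. l + l powr (1 - s) * V y powr s)"
  proof (rule set_integral_mono[OF set_integral_le_mass(1)[OF E]])
    show "set_integrable lebesgue E (\<lambda>y. l + l powr (1 - s) * V y powr s)"
      by (intro set_integral_add(1) intc set_integrable_mult_right intE)
    fix y
    show "V y \<le> l + l powr (1 - s) * V y powr s"
    proof (cases "V y \<le> l")
      case False
      then have "V y powr (1 - s) \<le> l powr (1 - s)" using l s_gt_1 by (intro powr_mono2') auto
      then have "V y powr (1 - s) * V y powr s \<le> l powr (1 - s) * V y powr s"
        by (rule mult_right_mono) simp
      moreover have "V y powr (1 - s) * V y powr s = V y" using False l by (simp flip: powr_add)
      ultimately show ?thesis using l by linarith
    qed (simp add: add_increasing2)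
  qed
  also have "\<dots> = l * measure lebesgue E + l powr (1 - s) * (LINT y:E|lebesgue. V y powr s)"
    using intc intE by (subst set_integral_add(2)) (auto simp: set_lebesgue_integral_def)
  also have "\<dots> \<le> l * (e * b) + l powr (1 - s) * (b * A powr s)"
  proof (intro add_mono mult_left_mono)
    show "measure lebesgue E \<le> e * b" using e(2) by (simp add: b_def)
    have "(LINT y:E|lebesgue. V y powr s) \<le> J"
      unfolding J_def set_lebesgue_integral_def
      using intE Vs_int[OF R] E(2) unfolding set_integrable_def
      by (intro integral_mono) (auto simp: indicator_def)
    then show "(LINT y:E|lebesgue. V y powr s) \<le> b * A powr s" using J by linarith
  qed (use l in auto)
  also have "\<dots> = 2 * (e powr (1 - 1 / s) * (A * b))"
  proof -
    have "l * (e * b) = e powr (1 - 1 / s) * (A * b)"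
      using e by (simp add: l_def powr_diff powr_minus_divide divide_inverse)
    moreover have "l powr (1 - s) * (b * A powr s) = e powr (1 - 1 / s) * (A * b)"
    proof -
      have "l powr (1 - s) = A powr (1 - s) * e powr ((- 1 / s) * (1 - s))"
        using A e by (simp add: l_def powr_mult powr_powr)
      moreover have "(- 1 / s) * (1 - s) = 1 - 1 / s" using s_gt_1 by (simp add: field_simps)
      moreover have "A powr (1 - s) * A powr s = A" using A by (simp flip: powr_add)
      ultimately show ?thesis by (simp add: mult_ac)
    qed
    ultimately show ?thesis by linarith
  qed
  also have "\<dots> = 2 * C * e powr (1 - 1 / s) * mass V x R" using b by (simp add: A_def)
  finally show ?thesis .
qed

text \<open>\<open>set_integral_small_subset\<close> for concentric balls, with
  \<open>e = (r / R)^d\<close>. It produces the power \<open>d - d / s\<close> of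
  \<open>r / R\<close>; the normalizing factors use up \<open>d - 2\<close> of it. The remaining
  exponent \<open>2 - d / s\<close> is positive precisely because \<open>s > d / 2\<close>.\<close>

lemma mass_decay:
  assumes "0 < r" "r \<le> R"
  shows "1 / r ^ (DIM('a) - 2) * mass V x r
    \<le> 2 * C * (r / R) powr (2 - real DIM('a) / s) * (1 / R ^ (DIM('a) - 2) * mass V x R)"
proof -
  let ?d = "DIM('a)"
  define q where "q = r / R"
  have R: "0 < R" and q: "0 < q" "r = q * R" using assms by (auto simp: q_def)
  have "mass V x r \<le> 2 * C * (q ^ ?d) powr (1 - 1 / s) * mass V x R"
    unfolding mass_def[of V x r]
  proof (rule set_integral_small_subset[OF R])
    show "measure lebesgue (ball x r) \<le> q ^ ?d * measure lebesgue (ball x R)"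
      using R assms q by (simp add: content_ball power_mult_distrib)
  qed (use assms q in auto)
  also have "(q ^ ?d) powr (1 - 1 / s) = q powr (real ?d - real ?d / s)"
    using q by (simp add: powr_powr right_diff_distrib flip: powr_realpow)
  also have "\<dots> = q powr (2 - real ?d / s) * q ^ (?d - 2)"
    using q dim by (simp add: of_nat_diff flip: powr_realpow powr_add)
  finally have "1 / r ^ (?d - 2) * mass V x r
      \<le> 1 / r ^ (?d - 2) * (2 * C * (q powr (2 - real ?d / s) * q ^ (?d - 2)) * mass V x R)"
    using assms by (intro mult_left_mono) auto
  also have "\<dots> = 2 * C * q powr (2 - real ?d / s) * (1 / R ^ (?d - 2) * mass V x R)"
    using q R by (simp add: power_mult_distrib)
  finally show ?thesis by (simp add: q_def)
qed

text \<open>An outer shell of relative volume \<open>\<eta>\<close> carries at most half of the mass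
  once \<open>2 * C * \<eta> powr (1 - 1 / s) \<le> 1 / 2\<close>. Shrinking the radius by
  \<open>\<theta>\<close>, the \<open>d\<close>-th root of \<open>1 - \<eta>\<close>, therefore
  costs a factor 2 at most, and finitely many such steps undo the dilation.\<close>

lemma mass_doubling:
  obtains D where "1 \<le> D" "\<And>x r. 0 < r \<Longrightarrow> mass V x (A * r) \<le> D * mass V x r"
proof -
  let ?d = "DIM('a)"
  define \<gamma> where "\<gamma> = 1 - 1 / s"
  have \<gamma>: "0 < \<gamma>" using s_gt_1 by (simp add: \<gamma>_def)
  define \<eta> where "\<eta> = min (1 / 2) ((1 / (4 * C)) powr (1 / \<gamma>))"
  have \<eta>: "0 < \<eta>" "\<eta> < 1" using C by (auto simp: \<eta>_def)
  have \<eta>C: "2 * C * \<eta> powr \<gamma> \<le> 1 / 2"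
  proof -
    have "\<eta> powr \<gamma> \<le> ((1 / (4 * C)) powr (1 / \<gamma>)) powr \<gamma>"
      using \<eta> \<gamma> by (intro powr_mono2) (auto simp: \<eta>_def)
    also have "\<dots> = 1 / (4 * C)" using \<gamma> C by (simp add: powr_powr)
    finally show ?thesis using C by (simp add: field_simps)
  qed
  define \<theta> where "\<theta> = root ?d (1 - \<eta>)"
  have \<theta>d: "\<theta> ^ ?d = 1 - \<eta>" using \<eta> by (simp add: \<theta>_def)
  have \<theta>: "0 < \<theta>" "\<theta> < 1" using \<eta> by (auto simp: \<theta>_def)
  have step: "mass V x R \<le> 2 * mass V x (\<theta> * R)" if R: "0 < R" for x R
  proof -
    have sub: "ball x (\<theta> * R) \<subseteq> ball x R" using \<theta> R by (intro subset_ball) auto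
    let ?E = "ball x R - ball x (\<theta> * R)"
    have "measure lebesgue ?E = measure lebesgue (ball x R) - measure lebesgue (ball x (\<theta> * R))"
      using sub by (intro measurable_measure_Diff) auto
    also have "\<dots> = \<eta> * measure lebesgue (ball x R)"
      using R \<theta> by (simp add: content_ball power_mult_distrib \<theta>d algebra_simps)
    finally have "(LINT y:?E|lebesgue. V y) \<le> 2 * C * \<eta> powr \<gamma> * mass V x R"
      unfolding \<gamma>_def using \<eta> by (intro set_integral_small_subset R) auto
    also have "\<dots> \<le> 1 / 2 * mass V x R"
      using \<eta>C by (intro mult_right_mono mass_nonneg)
    finally have E: "(LINT y:?E|lebesgue. V y) \<le> 1 / 2 * mass V x R" .
    have "mass V x R = (LINT y:ball x (\<theta> * R) \<union> ?E|lebesgue. V y)"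
      using sub by (simp add: mass_def Un_absorb1)
    also have "\<dots> = mass V x (\<theta> * R) + (LINT y:?E|lebesgue. V y)"
      unfolding mass_def by (intro set_integral_Un V_int set_integral_le_mass(1)[of _ x R]) auto
    finally show ?thesis using E by linarith
  qed
  have iter: "mass V x R \<le> 2 ^ n * mass V x (\<theta> ^ n * R)" if R: "0 < R" for x R n
  proof (induction n)
    case (Suc n)
    have "mass V x (\<theta> ^ n * R) \<le> 2 * mass V x (\<theta> * (\<theta> ^ n * R))"
      using R \<theta> by (intro step) simp
    then have "2 ^ n * mass V x (\<theta> ^ n * R) \<le> 2 ^ n * (2 * mass V x (\<theta> * (\<theta> ^ n * R)))"
      by (intro mult_left_mono) auto
    from order.trans[OF Suc this] show ?case by (simp add: mult_ac)
  qed simp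
  \<comment> \<open>Passing to the larger dilation \<open>\<bar>A\<bar> + 1\<close> treats all real
    \<open>A\<close> at once.\<close>
  have "0 < 1 / (\<bar>A\<bar> + 1)" by (rule divide_pos_pos) linarith+
  then obtain n where n: "\<theta> ^ n < 1 / (\<bar>A\<bar> + 1)"
    using real_arch_pow_inv \<theta>(2) by blast
  show ?thesis
  proof
    show "(1::real) \<le> 2 ^ n" by simp
    fix x and r :: real assume r: "0 < r"
    have "mass V x (A * r) \<le> mass V x ((\<bar>A\<bar> + 1) * r)"
      using r by (intro mass_mono subset_ball mult_right_mono) auto
    also have "\<dots> \<le> 2 ^ n * mass V x (\<theta> ^ n * ((\<bar>A\<bar> + 1) * r))"
      using r by (intro iter) (auto intro!: mult_pos_pos)
    also have "\<dots> \<le> 2 ^ n * mass V x r"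
    proof (intro mult_left_mono mass_mono subset_ball)
      have "\<theta> ^ n * (\<bar>A\<bar> + 1) \<le> 1" using n by (simp add: field_simps)
      then have "\<theta> ^ n * (\<bar>A\<bar> + 1) * r \<le> 1 * r" using r by (intro mult_right_mono) auto
      then show "\<theta> ^ n * ((\<bar>A\<bar> + 1) * r) \<le> r" by (simp add: mult_ac)
    qed simp
    finally show "mass V x (A * r) \<le> 2 ^ n * mass V x r" .
  qed
qed

section \<open>The critical radius is positive, finite and slowly varying\<close>

definition admissible_radii :: "'a \<Rightarrow> real set" where
  "admissible_radii x = {r. r > 0 \<and> 1 / r ^ (DIM('a) - 2) * mass V x r \<le> 1}"

abbreviation "\<rho> \<equiv> critical_radius V"

lemma critical_radius_eq: "\<rho> x = Sup (admissible_radii x)"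
  by (simp add: critical_radius_def admissible_radii_def mass_def)

text \<open>This is where the potential must not vanish almost everywhere: otherwise all radii would
  be admissible and the set of them unbounded.\<close>

lemma mass_pos: "\<exists>r>0. 0 < mass V x r"
proof (rule ccontr)
  assume "\<not> (\<exists>r>0. 0 < mass V x r)"
  then have "mass V x (real (Suc n)) = 0" for n
    using mass_nonneg[of x "real (Suc n)"] by (metis less_le of_nat_0_less_iff zero_less_Suc)
  then have "AE y in lebesgue. indicat_real (ball x (real (Suc n))) y *\<^sub>R V y = 0" for n
    using V_int[of x "real (Suc n)"] V_nonneg
    by (subst integral_nonneg_eq_0_iff_AE[symmetric]) (auto simp: mass_def set_lebesgue_integral_def set_integrable_def)
  then have "AE y in lebesgue. \<forall>n. indicat_real (ball x (real (Suc n))) y *\<^sub>R V y = 0"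
    by (intro AE_all_countable[THEN iffD2] allI)
  then have "AE y in lebesgue. V y = 0"
  proof eventually_elim
    case (elim y)
    obtain n where "dist x y < real n" using reals_Archimedean2 by blast
    then have "y \<in> ball x (real (Suc n))" by simp
    then show ?case using elim[rule_format, of n] by (simp only: indicator_simps) simp
  qed
  then show False using V_nonzero by simp
qed

lemma decay_exponent_pos: "0 < 2 - real DIM('a) / s"
  using s s_gt_1 by (simp add: field_simps)

lemma admissible_radii_nonempty: "admissible_radii x \<noteq> {}"
proof -
  define \<delta> where "\<delta> = 2 - real DIM('a) / s"
  \<comment> \<open>The summand 1 keeps \<open>B\<close> positive when the unit ball has no mass;
    \<open>r\<close> is then chosen so that \<open>B * r powr \<delta> \<le> 1\<close>.\<close>
  define B where "B = 2 * C * (mass V x 1 + 1)"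
  have \<delta>: "0 < \<delta>" using decay_exponent_pos by (simp add: \<delta>_def)
  have B: "0 < B" using C mass_nonneg[of x 1] by (simp add: B_def add_nonneg_pos)
  define r where "r = min 1 ((1 / B) powr (1 / \<delta>))"
  have r: "0 < r" "r \<le> 1" using B by (auto simp: r_def)
  have "r powr \<delta> \<le> ((1 / B) powr (1 / \<delta>)) powr \<delta>"
    using r \<delta> by (intro powr_mono2) (auto simp: r_def)
  also have "\<dots> = 1 / B" using \<delta> B by (simp add: powr_powr)
  finally have r\<delta>: "r powr \<delta> \<le> 1 / B" .
  have "1 / r ^ (DIM('a) - 2) * mass V x r \<le> 2 * C * r powr \<delta> * mass V x 1"
    using mass_decay[OF r, of x] by (simp add: \<delta>_def)
  also have "\<dots> \<le> 2 * C * r powr \<delta> * (mass V x 1 + 1)"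
    using C by (intro mult_left_mono) auto
  also have "\<dots> = B * r powr \<delta>" by (simp add: B_def)
  also have "\<dots> \<le> B * (1 / B)" using r\<delta> B by (intro mult_left_mono) auto
  also have "\<dots> = 1" using B by simp
  finally show ?thesis using r by (auto simp: admissible_radii_def)
qed

text \<open>\<open>mass_decay\<close> read upwards from a ball of positive mass: the normalized mass
  grows at least like \<open>(R / r) powr \<delta>\<close> and so stays above 1 from some radius
  on.\<close>

lemma admissible_radii_bdd: "bdd_above (admissible_radii x)"
proof -
  obtain r where r: "0 < r" "0 < mass V x r" using mass_pos by blast
  define \<delta> where "\<delta> = 2 - real DIM('a) / s"
  have \<delta>: "0 < \<delta>" using decay_exponent_pos by (simp add: \<delta>_def)
  define B where "B = 1 / r ^ (DIM('a) - 2) * mass V x r"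
  have B: "0 < B" using r by (simp add: B_def)
  show ?thesis
  proof (rule bdd_aboveI)
    fix R assume R: "R \<in> admissible_radii x"
    show "R \<le> max r (r * (2 * C / B) powr (1 / \<delta>))"
    proof (cases "r \<le> R")
      case True
      have R0: "0 < R" using R by (simp add: admissible_radii_def)
      have "B \<le> 2 * C * (r / R) powr \<delta> * (1 / R ^ (DIM('a) - 2) * mass V x R)"
        unfolding B_def \<delta>_def by (rule mass_decay[OF r(1) True])
      also have "\<dots> \<le> 2 * C * (r / R) powr \<delta> * 1"
        using R C by (intro mult_left_mono) (auto simp: admissible_radii_def)
      finally have "(R / r) powr \<delta> \<le> 2 * C / B"
        using B r R0 by (simp add: powr_divide field_simps)
      then have "((R / r) powr \<delta>) powr (1 / \<delta>) \<le> (2 * C / B) powr (1 / \<delta>)"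
        using \<delta> by (intro powr_mono2) auto
      then have "R / r \<le> (2 * C / B) powr (1 / \<delta>)" using \<delta> R0 r by (simp add: powr_powr)
      then show ?thesis using r by (simp add: field_simps)
    qed simp
  qed
qed

lemma critical_radius_pos: "0 < \<rho> x"
proof -
  obtain r where r: "r \<in> admissible_radii x" using admissible_radii_nonempty by blast
  then have "r \<le> \<rho> x" unfolding critical_radius_eq by (intro cSup_upper admissible_radii_bdd)
  then show ?thesis using r by (simp add: admissible_radii_def)
qed

lemma admissible_radius_le: "r \<in> admissible_radii x \<Longrightarrow> r \<le> \<rho> x"
  unfolding critical_radius_eq by (intro cSup_upper admissible_radii_bdd)

lemma admissible_radius_near:
  assumes "a < \<rho> x"
  obtains r where "r \<in> admissible_radii x" "a < r"
  using less_cSupD[OF admissible_radii_nonempty, of a x] assms unfolding critical_radius_eq by blast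

text \<open>The two bounds have different causes. The radius \<open>2 * \<rho> x\<close> is
  inadmissible at \<open>x\<close>, so the ball of radius \<open>(A + 2) * \<rho> x\<close> about
  \<open>y\<close>, which contains that ball, is heavy, and by \<open>mass_decay\<close> much larger
  balls about \<open>y\<close> are inadmissible. Conversely an admissible ball about
  \<open>x\<close> controls, by doubling, the ball about \<open>y\<close> of the same radius
  \<open>R\<close>, and shrinking by the fixed factor \<open>\<tau>\<close> makes the latter
  admissible.\<close>

lemma critical_radius_comparable:
  assumes A: "0 \<le> A"
  obtains K where "1 \<le> K" "\<And>x y. norm (x - y) \<le> A * \<rho> x \<Longrightarrow> \<rho> y \<le> K * \<rho> x \<and> \<rho> x \<le> K * \<rho> y"
proof -
  let ?d = "DIM('a)"
  define \<delta> where "\<delta> = 2 - real ?d / s"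
  have \<delta>: "0 < \<delta>" using decay_exponent_pos by (simp add: \<delta>_def)
  \<comment> \<open>The lower bound for the normalized mass of the ball of radius
    \<open>(A + 2) * \<rho> x\<close> about \<open>y\<close>. The leading 2 in \<open>K1\<close>,
    like the 2 in the factor \<open>2 / \<tau>\<close> of the other bound, is there because an
    admissible radius is only taken larger than half the supremum.\<close>
  define c where "c = (2 / (A + 2)) ^ (?d - 2)"
  have c: "0 < c" using A by (simp add: c_def)
  define K1 where "K1 = 2 * ((A + 2) * max 1 ((2 * C / c) powr (1 / \<delta>)))"
  obtain D where D: "1 \<le> D" "\<And>x r. 0 < r \<Longrightarrow> mass V x ((2 * A + 1) * r) \<le> D * mass V x r"
    using mass_doubling by blast
  \<comment> \<open>Chosen so that the decay factor \<open>2 * C * \<tau> powr \<delta>\<close>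
    outweighs the doubling constant \<open>D\<close>.\<close>
  define \<tau> where "\<tau> = min 1 ((1 / (2 * C * D)) powr (1 / \<delta>))"
  have \<tau>: "0 < \<tau>" "\<tau> \<le> 1" using C D(1) by (auto simp: \<tau>_def)
  have \<tau>\<delta>: "2 * C * \<tau> powr \<delta> * D \<le> 1"
  proof -
    have "\<tau> powr \<delta> \<le> ((1 / (2 * C * D)) powr (1 / \<delta>)) powr \<delta>"
      using \<tau> \<delta> by (intro powr_mono2) (auto simp: \<tau>_def)
    also have "\<dots> = 1 / (2 * C * D)" using \<delta> C D(1) by (simp add: powr_powr)
    finally show ?thesis using C D(1) by (simp add: field_simps)
  qed
  show ?thesis
  proof (rule that[of "max 1 (max K1 (2 / \<tau>))"])
    fix x y :: 'a assume xy: "norm (x - y) \<le> A * \<rho> x"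
    define r where "r = \<rho> x"
    have r: "0 < r" unfolding r_def by (rule critical_radius_pos)
    have upper: "\<rho> y \<le> K1 * \<rho> x"
    proof -
      obtain R where R: "R \<in> admissible_radii y" "\<rho> y / 2 < R"
        using critical_radius_pos[of y] by (auto intro: admissible_radius_near[of "\<rho> y / 2" y])
      have R0: "0 < R" and FR: "1 / R ^ (?d - 2) * mass V y R \<le> 1" using R by (auto simp: admissible_radii_def)
      let ?t = "(A + 2) * r"
      have t: "0 < ?t" using A r by simp
      have "R \<le> ?t * max 1 ((2 * C / c) powr (1 / \<delta>))"
      proof (cases "?t \<le> R")
        case True
        have "\<not> 2 * r \<in> admissible_radii x" using admissible_radius_le[of "2 * r" x] r by (auto simp: r_def)
        then have "1 < 1 / (2 * r) ^ (?d - 2) * mass V x (2 * r)" using r by (auto simp: admissible_radii_def)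
        then have "(2 * r) ^ (?d - 2) \<le> mass V x (2 * r)" using r by (simp add: field_simps)
        also have "\<dots> \<le> mass V y ?t"
        proof (rule mass_mono, rule subsetI)
          fix z assume "z \<in> ball x (2 * r)"
          then have "dist y z < A * r + 2 * r"
            using xy dist_triangle[of y z x] by (simp add: r_def dist_norm norm_minus_commute)
          then show "z \<in> ball y ?t" by (simp add: algebra_simps)
        qed
        finally have "(2 * r) ^ (?d - 2) / ?t ^ (?d - 2) \<le> 1 / ?t ^ (?d - 2) * mass V y ?t"
          using t by (simp add: divide_right_mono)
        moreover have "(2 * r) ^ (?d - 2) / ?t ^ (?d - 2) = c"
        proof -
          have "2 * r / ?t = 2 / (A + 2)" using r by simp
          then show ?thesis unfolding c_def power_divide[symmetric] by simp
        qed
        ultimately have "c \<le> 1 / ?t ^ (?d - 2) * mass V y ?t" by simp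
        also have "\<dots> \<le> 2 * C * (?t / R) powr \<delta> * (1 / R ^ (?d - 2) * mass V y R)"
          unfolding \<delta>_def by (rule mass_decay[OF t True])
        also have "\<dots> \<le> 2 * C * (?t / R) powr \<delta> * 1"
          using FR C by (intro mult_left_mono) auto
        finally have "(R / ?t) powr \<delta> \<le> 2 * C / c"
          using c t R0 by (simp add: powr_divide field_simps)
        then have "((R / ?t) powr \<delta>) powr (1 / \<delta>) \<le> (2 * C / c) powr (1 / \<delta>)"
          using \<delta> by (intro powr_mono2) auto
        then have "R / ?t \<le> (2 * C / c) powr (1 / \<delta>)" using \<delta> R0 t by (simp add: powr_powr)
        then have "R \<le> ?t * (2 * C / c) powr (1 / \<delta>)" using t by (simp add: pos_divide_le_eq mult.commute)
        also have "\<dots> \<le> ?t * max 1 ((2 * C / c) powr (1 / \<delta>))" using t by (intro mult_left_mono) auto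
        finally show ?thesis .
      next
        case False
        then have "R \<le> ?t * 1" by simp
        also have "\<dots> \<le> ?t * max 1 ((2 * C / c) powr (1 / \<delta>))" using t by (intro mult_left_mono) auto
        finally show ?thesis .
      qed
      then show ?thesis using R(2) by (simp add: K1_def r_def mult_ac)
    qed
    have lower: "\<rho> x \<le> 2 / \<tau> * \<rho> y"
    proof -
      obtain R where R: "R \<in> admissible_radii x" "\<rho> x / 2 < R"
        using critical_radius_pos[of x] by (auto intro: admissible_radius_near[of "\<rho> x / 2" x])
      have R0: "0 < R" and FR: "1 / R ^ (?d - 2) * mass V x R \<le> 1" using R by (auto simp: admissible_radii_def)
      have "mass V y R \<le> mass V x ((2 * A + 1) * R)"
      proof (rule mass_mono, rule subsetI)
        fix z assume z: "z \<in> ball y R"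
        have "A * \<rho> x \<le> A * (2 * R)" using R(2) A by (intro mult_left_mono) auto
        then have "dist x z < 2 * A * R + R"
          using z xy dist_triangle[of x z y] by (simp add: dist_norm)
        then show "z \<in> ball x ((2 * A + 1) * R)" by (simp add: algebra_simps)
      qed
      also have "\<dots> \<le> D * mass V x R" by (rule D(2)[OF R0])
      finally have "1 / R ^ (?d - 2) * mass V y R \<le> 1 / R ^ (?d - 2) * (D * mass V x R)"
        using R0 by (intro mult_left_mono) auto
      also have "\<dots> = D * (1 / R ^ (?d - 2) * mass V x R)" by simp
      also have "\<dots> \<le> D * 1" using FR D(1) by (intro mult_left_mono) auto
      finally have FyR: "1 / R ^ (?d - 2) * mass V y R \<le> D" by simp
      have \<tau>R: "0 < \<tau> * R" "\<tau> * R \<le> R" using \<tau> R0 by auto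
      have "1 / (\<tau> * R) ^ (?d - 2) * mass V y (\<tau> * R) \<le> 2 * C * \<tau> powr \<delta> * (1 / R ^ (?d - 2) * mass V y R)"
        using mass_decay[OF \<tau>R, of y] R0 by (simp add: \<delta>_def)
      also have "\<dots> \<le> 2 * C * \<tau> powr \<delta> * D" using FyR C by (intro mult_left_mono) auto
      also have "\<dots> \<le> 1" by (rule \<tau>\<delta>)
      finally have "\<tau> * R \<le> \<rho> y" using \<tau>R by (intro admissible_radius_le) (simp add: admissible_radii_def)
      then have "R \<le> \<rho> y / \<tau>" using \<tau> by (simp add: field_simps)
      then show ?thesis using R(2) by simp
    qed
    have "K1 * \<rho> x \<le> max 1 (max K1 (2 / \<tau>)) * \<rho> x" "2 / \<tau> * \<rho> y \<le> max 1 (max K1 (2 / \<tau>)) * \<rho> y"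
      using critical_radius_pos[of x] critical_radius_pos[of y] by - (rule mult_right_mono, simp, simp)+
    then show "\<rho> y \<le> max 1 (max K1 (2 / \<tau>)) * \<rho> x \<and> \<rho> x \<le> max 1 (max K1 (2 / \<tau>)) * \<rho> y"
      using upper lower by linarith
  qed simp
qed

section \<open>Upper semicontinuity and Borel measurability of the critical radius\<close>

lemma nn_integral_ball: "(\<integral>\<^sup>+y. ennreal (indicat_real (ball x r) y *\<^sub>R V y) \<partial>lebesgue) = ennreal (mass V x r)"
  unfolding mass_def set_lebesgue_integral_def
  using V_int[of x r] V_nonneg unfolding set_integrable_def by (intro nn_integral_eq_integral) auto

text \<open>Upper semicontinuity of \<open>\<rho>\<close>: by Fatou's lemma, a limit of admissible radii is admissible.\<close>

lemma critical_radius_superlevel_closed: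
  assumes a: "0 < a"
  shows "closed {x. a \<le> \<rho> x}"
  unfolding closed_sequential_limits
proof (intro allI impI, elim conjE)
  fix X x assume X: "\<forall>n. X n \<in> {x. a \<le> \<rho> x}" and lim: "X \<longlonglongrightarrow> x"
  obtain K where K: "1 \<le> K" "\<And>x y. norm (x - y) \<le> 1 * \<rho> x \<Longrightarrow> \<rho> y \<le> K * \<rho> x \<and> \<rho> x \<le> K * \<rho> y"
    using critical_radius_comparable[of 1] by auto
  \<comment> \<open>An admissible radius is taken within \<open>a / (n + 2)\<close> below
    \<open>a\<close>. The shift by 2 keeps all these radii at least \<open>a / 2\<close>, so that
    their limit is positive.\<close>
  have "\<exists>r. r \<in> admissible_radii (X n) \<and> a - a / real (n + 2) < r" for n
  proof -
    have "0 < a / real (n + 2)" using a by simp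
    moreover have "a \<le> \<rho> (X n)" using X by simp
    ultimately have "a - a / real (n + 2) < \<rho> (X n)" by linarith
    then show ?thesis by (rule admissible_radius_near) blast
  qed
  then obtain R where R: "\<And>n. R n \<in> admissible_radii (X n)" "\<And>n. a - a / real (n + 2) < R n" by metis
  have a2: "a / 2 \<le> R n" for n
  proof -
    have "a / real (n + 2) \<le> a / 2" using a by (intro divide_left_mono) auto
    then show ?thesis using R(2)[of n] by linarith
  qed
  have "(\<lambda>n. norm (x - X n)) \<longlonglongrightarrow> norm (x - x)" by (intro tendsto_intros lim)
  then have "\<forall>\<^sub>F n in sequentially. norm (x - X n) < \<rho> x"
    using critical_radius_pos[of x] by (intro order_tendstoD(2)) auto
  then have "\<forall>\<^sub>F n in sequentially. norm (x - X n) \<le> \<rho> x"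
    by eventually_elim simp
  then obtain n0 where n0: "\<And>n. n0 \<le> n \<Longrightarrow> norm (x - X n) \<le> \<rho> x" by (auto simp: eventually_sequentially)
  \<comment> \<open>Comparability at \<open>x\<close> bounds the radii from above once
    \<open>X n\<close> is within \<open>\<rho> x\<close> of \<open>x\<close>; compactness then
    supplies a convergent subsequence.\<close>
  have "R (n + n0) \<in> {a / 2..K * \<rho> x}" for n
    using K(2)[of x "X (n + n0)"] n0[of "n + n0"] admissible_radius_le[OF R(1)[of "n + n0"]] a2[of "n + n0"] by auto
  then have "\<forall>n. R (n + n0) \<in> {a / 2..K * \<rho> x}" ..
  then obtain r \<phi> where r: "r \<in> {a / 2..K * \<rho> x}" "strict_mono (\<phi> :: nat \<Rightarrow> nat)" "((\<lambda>n. R (n + n0)) \<circ> \<phi>) \<longlonglongrightarrow> r"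
    by (rule seq_compactE[OF compact_Icc[of "a / 2" "K * \<rho> x", unfolded compact_eq_seq_compact_metric]])
  define Y where "Y n = X (\<phi> n + n0)" for n
  define T where "T n = R (\<phi> n + n0)" for n
  have T: "T \<longlonglongrightarrow> r" using r(3) unfolding T_def[abs_def] comp_def .
  have Y: "Y \<longlonglongrightarrow> x"
    using LIMSEQ_subseq_LIMSEQ[OF LIMSEQ_ignore_initial_segment[OF lim, of n0] r(2)] unfolding Y_def[abs_def] comp_def .
  have r0: "0 < r" using r(1) a by auto
  have TY: "mass V (Y n) (T n) \<le> T n ^ (DIM('a) - 2)" for n
  proof -
    have "0 < T n" "1 / T n ^ (DIM('a) - 2) * mass V (Y n) (T n) \<le> 1"
      using R(1)[of "\<phi> n + n0"] by (auto simp: admissible_radii_def Y_def T_def)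
    then show ?thesis by (simp add: pos_divide_le_eq)
  qed
  have [measurable]: "(\<lambda>y. indicat_real (ball x r) y *\<^sub>R V y) \<in> borel_measurable lebesgue" for x r
    using V_int[of x r] by (auto simp: set_integrable_def)
  have "ennreal (mass V x r) \<le> (\<integral>\<^sup>+y. liminf (\<lambda>n. ennreal (indicat_real (ball (Y n) (T n)) y *\<^sub>R V y)) \<partial>lebesgue)"
    unfolding nn_integral_ball[symmetric]
  proof (rule nn_integral_mono)
    fix y
    show "ennreal (indicat_real (ball x r) y *\<^sub>R V y) \<le> liminf (\<lambda>n. ennreal (indicat_real (ball (Y n) (T n)) y *\<^sub>R V y))"
    proof (cases "y \<in> ball x r")
      case True
      \<comment> \<open>Balls are open, so a point of the limit ball belongs to all but finitely
        many of the moving balls. This is the pointwise bound that Fatou's lemma needs.\<close>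
      have "(\<lambda>n. T n - dist (Y n) y) \<longlonglongrightarrow> r - dist x y" by (intro tendsto_intros T Y)
      then have "\<forall>\<^sub>F n in sequentially. 0 < T n - dist (Y n) y"
        using True by (intro order_tendstoD(1)) auto
      then have "\<forall>\<^sub>F n in sequentially. ennreal (indicat_real (ball x r) y *\<^sub>R V y) \<le> ennreal (indicat_real (ball (Y n) (T n)) y *\<^sub>R V y)"
        by eventually_elim (use True in simp)
      then show ?thesis by (rule Liminf_bounded)
    qed simp
  qed
  also have "\<dots> \<le> liminf (\<lambda>n. \<integral>\<^sup>+y. ennreal (indicat_real (ball (Y n) (T n)) y *\<^sub>R V y) \<partial>lebesgue)"
    by (rule nn_integral_liminf) measurable
  also have "\<dots> \<le> liminf (\<lambda>n. ennreal (T n ^ (DIM('a) - 2)))"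
    unfolding nn_integral_ball by (intro Liminf_mono always_eventually allI ennreal_leI TY)
  also have "\<dots> = ennreal (r ^ (DIM('a) - 2))"
    by (intro lim_imp_Liminf tendsto_ennrealI tendsto_power T) simp
  finally have "mass V x r \<le> r ^ (DIM('a) - 2)" using r0 by simp
  then have "r \<in> admissible_radii x" using r0 by (simp add: admissible_radii_def field_simps)
  then have rx: "r \<le> \<rho> x" by (rule admissible_radius_le)
  have "(\<lambda>n. a - a / real (n + 2)) \<longlonglongrightarrow> a - 0"
    by (intro tendsto_diff tendsto_const LIMSEQ_ignore_initial_segment[OF lim_const_over_n])
  then have "((\<lambda>n. a - a / real (n + 2)) \<circ> (\<lambda>n. \<phi> n + n0)) \<longlonglongrightarrow> a - 0"
    using r(2) by (intro LIMSEQ_subseq_LIMSEQ) (simp_all add: strict_mono_def)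
  moreover have "((\<lambda>n. a - a / real (n + 2)) \<circ> (\<lambda>n. \<phi> n + n0)) n \<le> T n" for n
    using R(2)[of "\<phi> n + n0"] unfolding T_def comp_def by (rule less_imp_le)
  ultimately have "a - 0 \<le> r"
    using T by (intro LIMSEQ_le) blast+
  then have "a \<le> r" by simp
  then show "x \<in> {x. a \<le> \<rho> x}" using rx by simp
qed

lemma critical_radius_measurable: "\<rho> \<in> borel_measurable borel"
proof (rule borel_measurableI_ge)
  fix a
  show "{x \<in> space borel. a \<le> \<rho> x} \<in> sets borel"
  proof (cases "0 < a")
    case True
    then show ?thesis using critical_radius_superlevel_closed by simp
  next
    case False
    then have "a \<le> \<rho> x" for x using critical_radius_pos[of x] by linarith
    then have "{x \<in> space borel. a \<le> \<rho> x} = UNIV" by auto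
    then show ?thesis by simp
  qed
qed

lemma local_region_measurable: "local_region V \<in> sets borel"
proof -
  have [measurable]: "\<rho> \<in> borel_measurable borel" by (rule critical_radius_measurable)
  have "{p \<in> space (borel \<Otimes>\<^sub>M borel). norm (fst p - snd p) \<le> \<rho> (fst p)} \<in> sets (borel \<Otimes>\<^sub>M borel :: ('a \<times> 'a) measure)"
    by measurable
  moreover have "{p \<in> space (borel \<Otimes>\<^sub>M borel). norm (fst p - snd p) \<le> \<rho> (fst p)} = local_region V"
    by (auto simp: local_region_def space_pair_measure)
  ultimately show ?thesis unfolding borel_prod by simp
qed

end

section \<open>Coverings by critical balls\<close>

text \<open>Zorn's lemma: a pairwise condition concerns two points at a time, and two points of the
  union of a chain already lie in one member.\<close>

lemma maximal_pairwise_set: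
  fixes P :: "'a \<Rightarrow> 'a \<Rightarrow> bool"
  assumes sym: "\<And>x y. P x y \<Longrightarrow> P y x"
  obtains Z where "pairwise P Z" "\<And>x. x \<notin> Z \<Longrightarrow> \<exists>z\<in>Z. \<not> P x z"
proof -
  have "\<exists>M\<in>{Z. pairwise P Z}. \<forall>X\<in>{Z. pairwise P Z}. M \<subseteq> X \<longrightarrow> X = M"
  proof (rule subset_Zorn')
    fix C assume C: "subset.chain {Z. pairwise P Z} C"
    have "P x y" if x: "x \<in> A" "A \<in> C" and y: "y \<in> B" "B \<in> C" and ne: "x \<noteq> y" for x y A B
    proof -
      have "A \<subseteq> B \<or> B \<subseteq> A" using C x y by (auto simp: subset_chain_def)
      then obtain D where "D \<in> C" "x \<in> D" "y \<in> D" using x y by blast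
      then show ?thesis using C ne by (auto simp: subset_chain_def pairwise_def)
    qed
    then show "\<Union>C \<in> {Z. pairwise P Z}" unfolding pairwise_def by blast
  qed
  then obtain Z where Z: "pairwise P Z" "\<And>X. pairwise P X \<Longrightarrow> Z \<subseteq> X \<Longrightarrow> X = Z" by blast
  show ?thesis
  proof (rule that[OF Z(1)])
    fix x assume x: "x \<notin> Z"
    show "\<exists>z\<in>Z. \<not> P x z"
    proof (rule ccontr)
      assume "\<not> (\<exists>z\<in>Z. \<not> P x z)"
      then have "pairwise P (insert x Z)" using Z(1) sym by (auto simp: pairwise_insert)
      then show False using Z(2)[of "insert x Z"] x by auto
    qed
  qed
qed

text \<open>Volume packing: the balls of radius \<open>r / 2\<close> about the points of
  \<open>G\<close> are disjoint and lie in one ball of radius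
  \<open>(R + 1 / 2) * r\<close>.\<close>

lemma separated_card_le:
  fixes G :: "'a::euclidean_space set"
  assumes fin: "finite G" and r: "0 < r" and R: "0 \<le> R"
    and sub: "G \<subseteq> ball y (R * r)" and sep: "\<And>z w. z \<in> G \<Longrightarrow> w \<in> G \<Longrightarrow> z \<noteq> w \<Longrightarrow> r \<le> dist z w"
  shows "real (card G) \<le> (2 * R + 1) ^ DIM('a)"
proof -
  let ?d = "DIM('a)" and ?v = "unit_ball_vol (real DIM('a))"
  have "disjoint_family_on (\<lambda>z. ball z (r / 2)) G"
    unfolding disjoint_family_on_def
  proof (intro ballI impI)
    fix z w assume zw: "z \<in> G" "w \<in> G" "z \<noteq> w"
    have False if "u \<in> ball z (r / 2)" "u \<in> ball w (r / 2)" for u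
      using that sep[OF zw] dist_triangle[of z w u] by (simp add: dist_commute)
    then show "ball z (r / 2) \<inter> ball w (r / 2) = {}" by blast
  qed
  then have "(\<Sum>z\<in>G. emeasure lebesgue (ball z (r / 2))) = emeasure lebesgue (\<Union>z\<in>G. ball z (r / 2))"
    using fin by (intro sum_emeasure) auto
  also have "\<dots> \<le> emeasure lebesgue (ball y ((R + 1 / 2) * r))"
  proof (rule emeasure_mono)
    show "(\<Union>z\<in>G. ball z (r / 2)) \<subseteq> ball y ((R + 1 / 2) * r)"
    proof safe
      fix z u assume "z \<in> G" "u \<in> ball z (r / 2)"
      then have "dist y z < R * r" "dist z u < r / 2" using sub by auto
      then have "dist y u < R * r + r / 2" using dist_triangle[of y u z] by linarith
      then show "u \<in> ball y ((R + 1 / 2) * r)" by (simp add: algebra_simps)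
    qed
  qed simp
  also have "\<dots> = ennreal (?v * ((R + 1 / 2) * r) ^ ?d)" using R r by (intro emeasure_lebesgue_ball) simp
  also have "(\<Sum>z\<in>G. emeasure lebesgue (ball z (r / 2))) = ennreal (real (card G) * (?v * (r / 2) ^ ?d))"
    using r by (simp add: emeasure_lebesgue_ball ennreal_mult ennreal_of_nat_eq_real_of_nat del: emeasure_completion)
  finally have "real (card G) * (?v * (r / 2) ^ ?d) \<le> ?v * ((R + 1 / 2) * r) ^ ?d"
    using R r by (subst (asm) ennreal_le_iff) auto
  also have "(R + 1 / 2) * r = (2 * R + 1) * (r / 2)" by (simp add: field_simps)
  also have "?v * ((2 * R + 1) * (r / 2)) ^ ?d = (2 * R + 1) ^ ?d * (?v * (r / 2) ^ ?d)"
    by (simp only: power_mult_distrib mult_ac)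
  finally show ?thesis using r by simp
qed

text \<open>\<open>Z\<close> is maximal among the sets whose points keep the distance
  \<open>min (\<rho> z) (\<rho> w)\<close>. Maximality gives the covering: a point outside
  \<open>Z\<close> is closer than \<open>\<rho> z\<close> to some \<open>z\<close>. Separation and
  comparability give the bounded overlap by packing, since all radii of balls meeting at
  \<open>y\<close> are comparable to \<open>\<rho> y\<close>.\<close>

lemma slowly_varying_cover:
  fixes \<rho> :: "'a::euclidean_space \<Rightarrow> real"
  assumes pos: "\<And>x. 0 < \<rho> x"
    and comparable: "\<And>A. 0 \<le> A \<Longrightarrow> \<exists>K\<ge>1. \<forall>x y. norm (x - y) \<le> A * \<rho> x \<longrightarrow> \<rho> y \<le> K * \<rho> x \<and> \<rho> x \<le> K * \<rho> y"
  obtains Z A K P where "countable Z" "1 \<le> A" "1 \<le> K"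
    "\<And>x. \<exists>z\<in>Z. x \<in> ball z (\<rho> z)"
    "\<And>z x. x \<in> ball z (\<rho> z) \<Longrightarrow> cball x (\<rho> x) \<subseteq> ball z (A * \<rho> z) \<and> \<rho> z \<le> K * \<rho> x"
    "\<And>y. finite {z\<in>Z. y \<in> ball z (A * \<rho> z)} \<and> card {z\<in>Z. y \<in> ball z (A * \<rho> z)} \<le> P"
proof -
  obtain Z where sep: "pairwise (\<lambda>z w. min (\<rho> z) (\<rho> w) \<le> dist z w) Z"
    and max: "\<And>x. x \<notin> Z \<Longrightarrow> \<exists>z\<in>Z. \<not> min (\<rho> x) (\<rho> z) \<le> dist x z"
    by (rule maximal_pairwise_set[of "\<lambda>z w. min (\<rho> z) (\<rho> w) \<le> dist z w"]) (auto simp: dist_commute min.commute)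
  have cover: "\<exists>z\<in>Z. x \<in> ball z (\<rho> z)" for x
  proof (cases "x \<in> Z")
    case True
    then show ?thesis using pos[of x] by (intro bexI[of _ x]) auto
  next
    case False
    then obtain z where "z \<in> Z" "\<not> min (\<rho> x) (\<rho> z) \<le> dist x z" using max by blast
    then show ?thesis by (intro bexI[of _ z]) (auto simp: dist_commute not_le)
  qed
  obtain K where K: "1 \<le> K" "\<And>x y. norm (x - y) \<le> 1 * \<rho> x \<Longrightarrow> \<rho> y \<le> K * \<rho> x \<and> \<rho> x \<le> K * \<rho> y"
    using comparable[of 1] by auto
  \<comment> \<open>From \<open>z\<close> to \<open>x\<close> is less than \<open>\<rho> z\<close>,
    and the ball about \<open>x\<close> has radius at most \<open>K * \<rho> z\<close>.\<close>
  define A where "A = K + 1"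
  have A: "1 \<le> A" using K by (simp add: A_def)
  have inc: "cball x (\<rho> x) \<subseteq> ball z (A * \<rho> z) \<and> \<rho> z \<le> K * \<rho> x" if x: "x \<in> ball z (\<rho> z)" for z x
  proof -
    have cmp: "\<rho> x \<le> K * \<rho> z \<and> \<rho> z \<le> K * \<rho> x" using x by (intro K(2)) (simp add: dist_norm)
    have "dist z y < A * \<rho> z" if "dist x y \<le> \<rho> x" for y
      using that x cmp dist_triangle[of z y x] by (simp add: A_def algebra_simps)
    then show ?thesis using cmp by auto
  qed
  obtain L where L: "1 \<le> L" "\<And>x y. norm (x - y) \<le> A * \<rho> x \<Longrightarrow> \<rho> y \<le> L * \<rho> x \<and> \<rho> x \<le> L * \<rho> y"
    using comparable[of A] A by auto
  \<comment> \<open>The centres concerned are at least \<open>\<rho> y / L\<close> apart and lie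
    within \<open>A * L * \<rho> y\<close> of \<open>y\<close>, that is, within
    \<open>A * L * L\<close> times the separation.\<close>
  define P where "P = nat \<lceil>(2 * (A * L * L) + 1) ^ DIM('a)\<rceil>"
  have overlap: "finite {z\<in>Z. y \<in> ball z (A * \<rho> z)} \<and> card {z\<in>Z. y \<in> ball z (A * \<rho> z)} \<le> P" for y
  proof (rule finite_if_finite_subsets_card_bdd)
    fix G assume G: "G \<subseteq> {z\<in>Z. y \<in> ball z (A * \<rho> z)}" "finite G"
    have cmp: "\<rho> y \<le> L * \<rho> z \<and> \<rho> z \<le> L * \<rho> y" if "z \<in> G" for z
      using that G by (intro L(2)) (auto simp: dist_norm)
    have "real (card G) \<le> (2 * (A * L * L) + 1) ^ DIM('a)"
    proof (rule separated_card_le[OF G(2)])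
      show "0 < \<rho> y / L" using pos[of y] L(1) by simp
      show "0 \<le> A * L * L" using A L by simp
      show "G \<subseteq> ball y (A * L * L * (\<rho> y / L))"
      proof
        fix z assume z: "z \<in> G"
        then have "dist y z < A * \<rho> z" using G by (auto simp: dist_commute)
        also have "\<dots> \<le> A * (L * \<rho> y)" using A cmp[OF z] by (intro mult_left_mono) auto
        finally show "z \<in> ball y (A * L * L * (\<rho> y / L))" using L(1) by simp
      qed
      fix z w assume zw: "z \<in> G" "w \<in> G" "z \<noteq> w"
      have "min (\<rho> z) (\<rho> w) \<le> dist z w" using sep zw G unfolding pairwise_def by blast
      moreover have "\<rho> y / L \<le> \<rho> z" "\<rho> y / L \<le> \<rho> w"
        using cmp[OF zw(1)] cmp[OF zw(2)] L(1) by (auto simp: field_simps)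
      ultimately show "\<rho> y / L \<le> dist z w" by linarith
    qed
    then show "card G \<le> P" unfolding P_def by linarith
  qed
  \<comment> \<open>Every dilated ball contains a point of a countable dense set, and each such
    point lies in finitely many dilated balls only.\<close>
  have "countable Z"
  proof -
    obtain Q :: "'a set" where Q: "countable Q" "\<And>U. open U \<Longrightarrow> U \<noteq> {} \<Longrightarrow> \<exists>q\<in>Q. q \<in> U"
      using countable_dense_setE by blast
    have "Z \<subseteq> (\<Union>q\<in>Q. {z\<in>Z. q \<in> ball z (A * \<rho> z)})"
    proof
      fix z assume "z \<in> Z"
      moreover have "0 < A * \<rho> z" using A pos[of z] by (intro mult_pos_pos) auto
      then have "ball z (A * \<rho> z) \<noteq> {}" by simp
      then obtain q where "q \<in> Q" "q \<in> ball z (A * \<rho> z)" using Q(2)[of "ball z (A * \<rho> z)"] by auto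
      ultimately show "z \<in> (\<Union>q\<in>Q. {z\<in>Z. q \<in> ball z (A * \<rho> z)})" by blast
    qed
    moreover have "countable (\<Union>q\<in>Q. {z\<in>Z. q \<in> ball z (A * \<rho> z)})"
      using Q(1) overlap by (intro countable_UN) (auto intro: countable_finite)
    ultimately show ?thesis by (rule countable_subset)
  qed
  from that[OF this A K(1) cover inc overlap] show ?thesis .
qed

section \<open>Localization\<close>

lemma square_fun_eq_lq_norm: "square_fun q f x = lq_norm q (t_deriv_poisson f x)"
  by (simp add: square_fun_def lq_norm_def)

text \<open>Jensen's inequality for the mean over \<open>Q\<close> up to a factor: with \<open>a\<close> the mean of \<open>u\<close>, absorb the part
  where \<open>u \<le> a / 2\<close>.\<close>

lemma mean_epowr_le:
  fixes u :: "'m \<Rightarrow> ennreal"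
  assumes p: "1 \<le> p" and u [measurable]: "u \<in> borel_measurable M" and Q [measurable]: "Q \<in> sets M"
    and m: "emeasure M Q = ennreal m" "0 < m"
  shows "ennreal m * epowr (ennreal (1 / m) * (\<integral>\<^sup>+y. u y * indicator Q y \<partial>M)) p
    \<le> ennreal (2 powr p) * (\<integral>\<^sup>+y. epowr (u y) p * indicator Q y \<partial>M)"
proof -
  define I where "I = (\<integral>\<^sup>+y. u y * indicator Q y \<partial>M)"
  define J where "J = (\<integral>\<^sup>+y. epowr (u y) p * indicator Q y \<partial>M)"
  have split: "I \<le> ennreal (l * m) + ennreal (l powr (1 - p)) * J" if l: "0 < l" for l
  proof -
    have "u y \<le> ennreal l + ennreal (l powr (1 - p)) * epowr (u y) p" for y
    proof (cases "u y")
      case (real v)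
      have "v \<le> l + l powr (1 - p) * v powr p"
      proof (cases "v \<le> l")
        case False
        then have "l powr (p - 1) \<le> v powr (p - 1)" using l p by (intro powr_mono2) auto
        then have "l powr (1 - p) * l powr (p - 1) * v \<le> l powr (1 - p) * v powr (p - 1) * v"
          using real by (intro mult_right_mono mult_left_mono) auto
        moreover have "l powr (1 - p) * l powr (p - 1) = 1" using l by (simp flip: powr_add)
        moreover have "v powr (p - 1) * v = v powr p"
          using False l by (simp add: powr_diff)
        ultimately have "v \<le> l powr (1 - p) * v powr p" by (simp add: mult.assoc)
        then show ?thesis using l by linarith
      qed (simp add: add_increasing2)
      then have "ennreal v \<le> ennreal (l + l powr (1 - p) * v powr p)" by (rule ennreal_leI)
      then show ?thesis using real l by (simp add: epowr_ennreal ennreal_plus ennreal_mult)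
    qed (use l in \<open>simp add: ennreal_mult_top\<close>)
    then have "I \<le> (\<integral>\<^sup>+y. ennreal l * indicator Q y + ennreal (l powr (1 - p)) * (epowr (u y) p * indicator Q y) \<partial>M)"
      unfolding I_def by (intro nn_integral_mono) (auto simp: indicator_def)
    also have "\<dots> = ennreal l * ennreal m + ennreal (l powr (1 - p)) * J"
      unfolding J_def by (simp add: nn_integral_add nn_integral_cmult m)
    finally show ?thesis using l m by (simp add: ennreal_mult)
  qed
  have "ennreal m * epowr (ennreal (1 / m) * I) p \<le> ennreal (2 powr p) * J"
  proof (cases J)
    case (real j)
    \<comment> \<open>Absorbing half of the mean below is legitimate for a finite integral only; the
      split at level 1 provides finiteness.\<close>
    then have "I < top"
      using split[of 1] by (auto simp: less_top[symmetric] top_unique simp flip: ennreal_plus)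
    then obtain i where i: "I = ennreal i" "0 \<le> i" by (cases I) auto
    define a where "a = i / m"
    show ?thesis
    proof (cases "i = 0")
      case False
      then have a: "0 < a" using i m by (simp add: a_def)
      have "ennreal i \<le> ennreal (a / 2 * m + (a / 2) powr (1 - p) * j)"
        using split[of "a / 2"] a m real i by (simp add: ennreal_plus ennreal_mult)
      then have "i \<le> a / 2 * m + (a / 2) powr (1 - p) * j"
        using a m real by (subst (asm) ennreal_le_iff) auto
      then have "a / 2 * m \<le> (a / 2) powr (1 - p) * j" using m by (simp add: a_def)
      then have "(a / 2) powr (p - 1) * (a / 2 * m) \<le> (a / 2) powr (p - 1) * ((a / 2) powr (1 - p) * j)"
        by (rule mult_left_mono) simp
      moreover have "(a / 2) powr (p - 1) * (a / 2) = (a / 2) powr p" using a by (simp add: powr_diff)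
      moreover have "(a / 2) powr (p - 1) * (a / 2) powr (1 - p) = 1" using a by (simp flip: powr_add)
      ultimately have "(a / 2) powr p * m \<le> j" by (metis mult.assoc mult_1)
      then have "2 powr p * ((a / 2) powr p * m) \<le> 2 powr p * j" by (rule mult_left_mono) simp
      moreover have "2 powr p * (a / 2) powr p = a powr p" using a by (simp flip: powr_mult)
      ultimately have "m * a powr p \<le> 2 powr p * j" by (metis mult.assoc mult.commute)
      then have "ennreal (m * a powr p) \<le> ennreal (2 powr p * j)" by (rule ennreal_leI)
      moreover have "ennreal (1 / m) * I = ennreal a" using i m by (simp add: a_def flip: ennreal_mult)
      ultimately show ?thesis using a m real by (simp add: epowr_ennreal ennreal_mult)
    qed (simp add: i)
  qed (simp add: ennreal_mult_top)
  then show ?thesis by (simp add: I_def J_def)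
qed

text \<open>Sums over the cover are written as integrals over \<open>count_space Z\<close>, so both
  exchanges of order are instances of Tonelli's theorem. The passage from \<open>B z\<close> to the
  larger \<open>Q z\<close> is paid for by the overlap number \<open>P\<close>. Both the strong type
  (\<open>\<Phi>\<close> a \<open>p\<close>-th power) and the weak type (\<open>\<Phi>\<close> a
  level times the indicator of a level set) are summed by it.\<close>

lemma nn_integral_cover_le:
  fixes \<Phi> u :: "'a \<Rightarrow> ennreal"
  assumes Z: "countable Z" and [measurable]: "\<Phi> \<in> borel_measurable M" "u \<in> borel_measurable M"
    and [measurable]: "\<And>z. z \<in> Z \<Longrightarrow> B z \<in> sets M" "\<And>z. z \<in> Z \<Longrightarrow> Q z \<in> sets M"
    and cover: "\<And>x. x \<in> space M \<Longrightarrow> \<exists>z\<in>Z. x \<in> B z"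
    and overlap: "\<And>y. finite {z\<in>Z. y \<in> Q z} \<and> card {z\<in>Z. y \<in> Q z} \<le> P"
    and loc: "\<And>z. z \<in> Z \<Longrightarrow> (\<integral>\<^sup>+x. \<Phi> x * indicator (B z) x \<partial>M) \<le> C * (\<integral>\<^sup>+x. u x * indicator (Q z) x \<partial>M)"
  shows "(\<integral>\<^sup>+x. \<Phi> x \<partial>M) \<le> C * of_nat P * (\<integral>\<^sup>+x. u x \<partial>M)"
proof -
  have "(\<integral>\<^sup>+x. \<Phi> x \<partial>M) \<le> (\<integral>\<^sup>+x. \<integral>\<^sup>+z. \<Phi> x * indicator (B z) x \<partial>count_space Z \<partial>M)"
  proof (rule nn_integral_mono)
    fix x assume "x \<in> space M"
    then obtain z where z: "z \<in> Z" "x \<in> B z" using cover by blast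
    have "\<Phi> x = (\<integral>\<^sup>+w. \<Phi> x * indicator {z} w \<partial>count_space Z)"
      using z by (simp add: nn_integral_cmult)
    also have "\<dots> \<le> (\<integral>\<^sup>+w. \<Phi> x * indicator (B w) x \<partial>count_space Z)"
      using z by (intro nn_integral_mono mult_left_mono) (auto simp: indicator_def)
    finally show "\<Phi> x \<le> (\<integral>\<^sup>+z. \<Phi> x * indicator (B z) x \<partial>count_space Z)" .
  qed
  also have "\<dots> = (\<integral>\<^sup>+z. \<integral>\<^sup>+x. \<Phi> x * indicator (B z) x \<partial>M \<partial>count_space Z)"
    by (rule nn_integral_count_space_nn_integral[OF Z]) measurable
  also have "\<dots> \<le> (\<integral>\<^sup>+z. C * (\<integral>\<^sup>+x. u x * indicator (Q z) x \<partial>M) \<partial>count_space Z)"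
    by (intro nn_integral_mono loc) simp
  also have "\<dots> = C * (\<integral>\<^sup>+z. \<integral>\<^sup>+x. u x * indicator (Q z) x \<partial>M \<partial>count_space Z)"
    by (rule nn_integral_cmult) simp
  also have "(\<integral>\<^sup>+z. \<integral>\<^sup>+x. u x * indicator (Q z) x \<partial>M \<partial>count_space Z)
      = (\<integral>\<^sup>+x. \<integral>\<^sup>+z. u x * indicator (Q z) x \<partial>count_space Z \<partial>M)"
    by (rule nn_integral_count_space_nn_integral[OF Z, symmetric]) measurable
  also have "\<dots> \<le> (\<integral>\<^sup>+x. of_nat P * u x \<partial>M)"
  proof (rule nn_integral_mono)
    fix x
    let ?W = "{z\<in>Z. x \<in> Q z}"
    have "(\<integral>\<^sup>+z. u x * indicator (Q z) x \<partial>count_space Z) = (\<integral>\<^sup>+z. u x * indicator ?W z \<partial>count_space Z)"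
      by (intro nn_integral_cong) (auto simp: indicator_def)
    also have "\<dots> = u x * of_nat (card ?W)"
      using overlap[of x] by (subst nn_integral_cmult_indicator) (auto simp: emeasure_count_space)
    also have "\<dots> \<le> u x * of_nat P" using overlap[of x] by (intro mult_left_mono) auto
    finally show "(\<integral>\<^sup>+z. u x * indicator (Q z) x \<partial>count_space Z) \<le> of_nat P * u x" by (simp add: mult.commute)
  qed
  also have "\<dots> = of_nat P * (\<integral>\<^sup>+x. u x \<partial>M)" by (rule nn_integral_cmult) measurable
  finally show ?thesis by (simp add: mult.assoc mult_left_mono)
qed

text \<open>The set where \<open>\<Phi>\<close> is infinite lies in every superlevel set, so its
  measure is at most \<open>C / l\<close> for every level \<open>l\<close>.\<close>

lemma weak_type_AE_finite:
  fixes \<Phi> :: "'a \<Rightarrow> ennreal"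
  assumes [measurable]: "\<Phi> \<in> borel_measurable M" and C: "C < \<infinity>"
    and le: "\<And>l. 0 < l \<Longrightarrow> ennreal l * emeasure M {x \<in> space M. \<Phi> x > ennreal l} \<le> C"
  shows "AE x in M. \<Phi> x < \<infinity>"
proof -
  let ?T = "{x \<in> space M. \<Phi> x = top}"
  have le': "ennreal l * emeasure M ?T \<le> C" if "0 < l" for l
  proof -
    have "ennreal l * emeasure M ?T \<le> ennreal l * emeasure M {x \<in> space M. \<Phi> x > ennreal l}"
      by (intro mult_left_mono emeasure_mono) auto
    then show ?thesis using le[OF that] by (rule order.trans)
  qed
  have "emeasure M ?T = 0"
  proof (cases "emeasure M ?T")
    case (real e)
    obtain c where c: "C = ennreal c" "0 \<le> c" using C by (cases C) auto
    show ?thesis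
    proof (rule ccontr)
      assume "emeasure M ?T \<noteq> 0"
      then have e: "0 < e" using real by (simp add: less_le)
      have "ennreal ((c + 1) / e * e) = ennreal ((c + 1) / e) * ennreal e"
        using e c by (intro ennreal_mult) auto
      also have "\<dots> \<le> ennreal c"
        using le'[of "(c + 1) / e"] e c real by simp
      finally have "ennreal ((c + 1) / e * e) \<le> ennreal c" .
      then have "(c + 1) / e * e \<le> c" using c by (subst (asm) ennreal_le_iff) auto
      then show False using e by simp
    qed
  next
    case top
    then show ?thesis using le'[of 1] C by (simp add: top_unique)
  qed
  then have "?T \<in> null_sets M" by (auto intro: null_setsI)
  then have "AE x in M. x \<notin> ?T" by (rule AE_not_in)
  then show ?thesis using AE_space by eventually_elim (auto simp: less_top)
qed

text \<open>Finiteness of both terms is required because the difference of two infinite values has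
  infinite modulus.\<close>

lemma abs_diff_ennreal_le:
  fixes a b c :: ennreal
  assumes "a \<le> c + b" "b \<le> c + a" "a < \<infinity>" "b < \<infinity>"
  shows "e2ennreal \<bar>enn2ereal a - enn2ereal b\<bar> \<le> c"
proof (cases c)
  case (real z)
  obtain x y where xy: "a = ennreal x" "0 \<le> x" "b = ennreal y" "0 \<le> y"
    using assms(3,4) by (cases a; cases b) auto
  have "x \<le> z + y" "y \<le> z + x"
    using assms(1,2) xy real by (auto simp: simp flip: ennreal_plus)
  then have "ennreal \<bar>x - y\<bar> \<le> ennreal z" by (intro ennreal_leI) linarith
  moreover have "e2ennreal \<bar>enn2ereal a - enn2ereal b\<bar> = ennreal \<bar>x - y\<bar>"
    using xy by (simp add: enn2ereal_ennreal)
  ultimately show ?thesis using real by simp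
qed simp

section \<open>Comparison of the local operator with a frozen cut-off\<close>

context reverse_hoelder_potential
begin

lemma indicator_local_region:
  "indicat_real (local_region V) (x, y) = indicat_real (cball x (\<rho> x)) y"
  "indicat_real (- local_region V) (x, y) = indicat_real (- cball x (\<rho> x)) y"
  by (auto simp: indicator_def local_region_def dist_norm)

lemma local_t_deriv_poisson_eq:
  "local_t_deriv_poisson V f x = t_deriv_poisson (\<lambda>y. indicat_real (cball x (\<rho> x)) y *\<^sub>R f y) x"
  by (simp add: local_t_deriv_poisson_def indicator_local_region)

context
  fixes f :: "'a \<Rightarrow> 'x::banach"
  assumes f: "poisson_admissible f"
begin

lemma local_continuous: "continuous_on {0<..} (local_t_deriv_poisson V f x)"
  unfolding local_t_deriv_poisson_eq
  by (intro t_deriv_poisson_continuous poisson_admissible_indicator f) simp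

lemma local_strongly_measurable:
  "0 < t \<Longrightarrow> strongly_measurable lebesgue banach_space (\<lambda>x. local_t_deriv_poisson V f x t)"
  unfolding local_t_deriv_poisson_def
  by (rule t_deriv_poisson_strongly_measurable[OF f local_region_measurable])

lemma lq_norm_local_measurable: "(\<lambda>x. lq_norm q (local_t_deriv_poisson V f x)) \<in> borel_measurable lebesgue"
  by (rule lq_norm_measurable[OF local_strongly_measurable local_continuous])

lemma square_fun_glob_measurable: "square_fun_glob V q f \<in> borel_measurable lebesgue"
proof -
  have "(\<lambda>x. lq_norm q (t_deriv_poisson (\<lambda>y. indicat_real (- local_region V) (x, y) *\<^sub>R f y) x)) \<in> borel_measurable lebesgue"
  proof (rule lq_norm_measurable)
    show "strongly_measurable lebesgue banach_space
        (\<lambda>x. t_deriv_poisson (\<lambda>y. indicat_real (- local_region V) (x, y) *\<^sub>R f y) x t)" if "0 < t" for t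
      using local_region_measurable that by (intro t_deriv_poisson_strongly_measurable[OF f]) auto
    show "continuous_on {0<..} (t_deriv_poisson (\<lambda>y. indicat_real (- local_region V) (x, y) *\<^sub>R f y) x)" for x
      unfolding indicator_local_region by (intro t_deriv_poisson_continuous poisson_admissible_indicator f) simp
  qed
  then show ?thesis by (simp add: square_fun_glob_def[abs_def] square_fun_eq_lq_norm)
qed

lemma local_glob_decomposition:
  assumes "0 < t"
  shows "t_deriv_poisson f x t = local_t_deriv_poisson V f x t
    + t_deriv_poisson (\<lambda>y. indicat_real (- cball x (\<rho> x)) y *\<^sub>R f y) x t"
proof -
  have "t_deriv_poisson (\<lambda>y. indicat_real (cball x (\<rho> x)) y *\<^sub>R f y + indicat_real (- cball x (\<rho> x)) y *\<^sub>R f y) x t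
      = local_t_deriv_poisson V f x t + t_deriv_poisson (\<lambda>y. indicat_real (- cball x (\<rho> x)) y *\<^sub>R f y) x t"
    unfolding local_t_deriv_poisson_eq
    by (intro t_deriv_poisson_add poisson_admissible_indicator f assms) auto
  moreover have "(\<lambda>y. indicat_real (cball x (\<rho> x)) y *\<^sub>R f y + indicat_real (- cball x (\<rho> x)) y *\<^sub>R f y) = f"
    by (auto simp: indicator_def)
  ultimately show ?thesis by simp
qed

lemma square_fun_glob_triangle:
  assumes q: "1 \<le> q"
  shows "square_fun q f x \<le> lq_norm q (local_t_deriv_poisson V f x) + square_fun_glob V q f x"
    and "square_fun_glob V q f x \<le> lq_norm q (local_t_deriv_poisson V f x) + square_fun q f x"
proof -
  let ?g = "t_deriv_poisson (\<lambda>y. indicat_real (- cball x (\<rho> x)) y *\<^sub>R f y) x"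
  have g: "continuous_on {0<..} ?g"
    by (intro t_deriv_poisson_continuous poisson_admissible_indicator f) simp
  have eq: "square_fun_glob V q f x = lq_norm q ?g"
    unfolding square_fun_glob_def square_fun_eq_lq_norm indicator_local_region ..
  show "square_fun q f x \<le> lq_norm q (local_t_deriv_poisson V f x) + square_fun_glob V q f x"
    unfolding eq square_fun_eq_lq_norm
    by (rule lq_norm_triangle[OF q local_continuous g]) (simp add: local_glob_decomposition norm_triangle_ineq)
  show "square_fun_glob V q f x \<le> lq_norm q (local_t_deriv_poisson V f x) + square_fun q f x"
    unfolding eq square_fun_eq_lq_norm
  proof (rule lq_norm_triangle[OF q local_continuous t_deriv_poisson_continuous[OF f]])
    fix t :: real assume t: "0 < t"
    have "?g t = t_deriv_poisson f x t - local_t_deriv_poisson V f x t"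
      using local_glob_decomposition[OF t, of x] by simp
    then show "norm (?g t) \<le> norm (local_t_deriv_poisson V f x t) + norm (t_deriv_poisson f x t)"
      using norm_triangle_ineq4[of "t_deriv_poisson f x t" "local_t_deriv_poisson V f x t"] by simp
  qed
qed

lemma square_fun_loc_le:
  assumes q: "1 \<le> q" and "square_fun q f x < \<infinity>" "lq_norm q (local_t_deriv_poisson V f x) < \<infinity>"
  shows "e2ennreal \<bar>square_fun_loc V q f x\<bar> \<le> lq_norm q (local_t_deriv_poisson V f x)"
proof -
  have "square_fun_glob V q f x < \<infinity>"
    by (rule le_less_trans[OF square_fun_glob_triangle(2)[OF q]]) (use assms(2,3) in simp)
  then show ?thesis
    unfolding square_fun_loc_def
    by (intro abs_diff_ennreal_le square_fun_glob_triangle q assms)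
qed

lemma lq_norm_local_le:
  assumes q: "2 \<le> q" and K: "1 \<le> K"
    and Q: "cball x (\<rho> x) \<subseteq> Q" "Q \<in> sets lebesgue" and r: "0 < r" "r \<le> K * \<rho> x"
  shows "lq_norm q (local_t_deriv_poisson V f x) \<le> square_fun q (\<lambda>y. indicat_real Q y *\<^sub>R f y) x
    + ennreal (kernel_const TYPE('a) * K ^ DIM('a) / r ^ DIM('a)) * (\<integral>\<^sup>+y. ennreal (norm (f y)) * indicator Q y \<partial>lebesgue)"
proof -
  let ?B = "cball x (\<rho> x)" and ?d = "DIM('a)"
  define g where "g y = indicat_real Q y *\<^sub>R f y" for y
  define w where "w y = indicat_real (Q - ?B) y *\<^sub>R f y" for y
  have B: "?B \<in> sets lebesgue" by simp
  have g: "poisson_admissible g" unfolding g_def by (rule poisson_admissible_indicator[OF f Q(2)])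
  have w: "poisson_admissible w" unfolding w_def using Q(2) by (intro poisson_admissible_indicator[OF f]) auto
  have Bf: "poisson_admissible (\<lambda>y. indicat_real ?B y *\<^sub>R f y)" by (rule poisson_admissible_indicator[OF f B])
  have eq: "g = (\<lambda>y. indicat_real ?B y *\<^sub>R f y + w y)"
  proof
    fix y
    show "g y = indicat_real ?B y *\<^sub>R f y + w y"
      using Q(1) by (cases "y \<in> ?B"; cases "y \<in> Q") (auto simp: g_def w_def)
  qed
  have dec: "t_deriv_poisson g x t = local_t_deriv_poisson V f x t + t_deriv_poisson w x t" if "0 < t" for t
    unfolding eq local_t_deriv_poisson_eq by (rule t_deriv_poisson_add[OF Bf w that])
  have "lq_norm q (local_t_deriv_poisson V f x) \<le> lq_norm q (t_deriv_poisson g x) + lq_norm q (t_deriv_poisson w x)"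
  proof (rule lq_norm_triangle[OF _ t_deriv_poisson_continuous[OF g] t_deriv_poisson_continuous[OF w]])
    fix t :: real assume "0 < t"
    then have "local_t_deriv_poisson V f x t = t_deriv_poisson g x t - t_deriv_poisson w x t" by (simp add: dec)
    then show "norm (local_t_deriv_poisson V f x t) \<le> norm (t_deriv_poisson g x t) + norm (t_deriv_poisson w x t)"
      by (simp add: norm_triangle_ineq4)
  qed (use q in simp)
  also have "lq_norm q (t_deriv_poisson w x)
      \<le> ennreal (kernel_const TYPE('a) / \<rho> x ^ ?d) * (\<integral>\<^sup>+y. ennreal (norm (w y)) \<partial>lebesgue)"
  proof (rule lq_norm_far[OF q critical_radius_pos _ kernel_const_nonneg])
    show "1 \<le> ?d" using dim by simp
    fix t :: real assume t: "0 < t"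
    show "ennreal (norm (t_deriv_poisson w x t))
        \<le> ennreal (kernel_const TYPE('a) * (t * (t\<^sup>2 + (\<rho> x)\<^sup>2) powr - ((real ?d + 1) / 2))) * (\<integral>\<^sup>+y. ennreal (norm (w y)) \<partial>lebesgue)"
      using critical_radius_pos[of x]
      by (intro t_deriv_poisson_far[OF w t]) (auto simp: w_def indicator_def dist_norm)
  qed
  also have "\<dots> \<le> ennreal (kernel_const TYPE('a) * K ^ ?d / r ^ ?d) * (\<integral>\<^sup>+y. ennreal (norm (f y)) * indicator Q y \<partial>lebesgue)"
  proof (rule mult_mono)
    have "r ^ ?d \<le> K ^ ?d * \<rho> x ^ ?d" using r by (simp add: power_mono flip: power_mult_distrib)
    then have "1 / \<rho> x ^ ?d \<le> K ^ ?d / r ^ ?d" using r critical_radius_pos[of x] by (simp add: field_simps)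
    then have "kernel_const TYPE('a) * (1 / \<rho> x ^ ?d) \<le> kernel_const TYPE('a) * (K ^ ?d / r ^ ?d)"
      by (rule mult_left_mono) (rule kernel_const_nonneg)
    then show "ennreal (kernel_const TYPE('a) / \<rho> x ^ ?d) \<le> ennreal (kernel_const TYPE('a) * K ^ ?d / r ^ ?d)"
      by (intro ennreal_leI) simp
    show "(\<integral>\<^sup>+y. ennreal (norm (w y)) \<partial>lebesgue) \<le> (\<integral>\<^sup>+y. ennreal (norm (f y)) * indicator Q y \<partial>lebesgue)"
      by (intro nn_integral_mono) (auto simp: w_def indicator_def)
  qed simp_all
  finally show ?thesis unfolding square_fun_eq_lq_norm g_def[symmetric, abs_def] by (simp add: add_left_mono)
qed

end

text \<open>The common source of all three conclusions. The error is written through the mean of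
  \<open>norm (f y)\<close> over the dilated ball, so that it is constant in \<open>x\<close> on
  each ball of the cover.\<close>

lemma local_cover:
  obtains Z A M P where "countable Z" "1 \<le> A" "0 \<le> M"
    "\<And>x. \<exists>z\<in>Z. x \<in> ball z (\<rho> z)"
    "\<And>y. finite {z\<in>Z. y \<in> ball z (A * \<rho> z)} \<and> card {z\<in>Z. y \<in> ball z (A * \<rho> z)} \<le> P"
    "\<And>(f :: 'a \<Rightarrow> 'x::banach) q z x. poisson_admissible f \<Longrightarrow> 2 \<le> q \<Longrightarrow> x \<in> ball z (\<rho> z) \<Longrightarrow>
      lq_norm q (local_t_deriv_poisson V f x)
      \<le> square_fun q (\<lambda>y. indicat_real (ball z (A * \<rho> z)) y *\<^sub>R f y) x
        + ennreal M * (ennreal (1 / (unit_ball_vol DIM('a) * (A * \<rho> z) ^ DIM('a))) *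
            (\<integral>\<^sup>+y. ennreal (norm (f y)) * indicator (ball z (A * \<rho> z)) y \<partial>lebesgue))"
proof -
  have comparable: "\<exists>K\<ge>1. \<forall>x y. norm (x - y) \<le> A * \<rho> x \<longrightarrow> \<rho> y \<le> K * \<rho> x \<and> \<rho> x \<le> K * \<rho> y" if "0 \<le> A" for A
    by (rule critical_radius_comparable[OF that]) blast
  obtain Z A K P where Z: "countable Z" "1 \<le> A" "1 \<le> K"
    "\<And>x. \<exists>z\<in>Z. x \<in> ball z (\<rho> z)"
    "\<And>z x. x \<in> ball z (\<rho> z) \<Longrightarrow> cball x (\<rho> x) \<subseteq> ball z (A * \<rho> z) \<and> \<rho> z \<le> K * \<rho> x"
    "\<And>y. finite {z\<in>Z. y \<in> ball z (A * \<rho> z)} \<and> card {z\<in>Z. y \<in> ball z (A * \<rho> z)} \<le> P"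
    using slowly_varying_cover[of \<rho>, OF critical_radius_pos comparable] by blast
  define b where "b = unit_ball_vol (real DIM('a))"
  have b: "0 < b" by (simp add: b_def)
  \<comment> \<open>\<open>K ^ d\<close> comes from comparing \<open>\<rho> z\<close> with
    \<open>\<rho> x\<close>, and \<open>b * A ^ d\<close> turns the factor
    \<open>(\<rho> z)^(-d)\<close> into the reciprocal volume of the dilated ball.\<close>
  define M where "M = kernel_const TYPE('a) * K ^ DIM('a) * (b * A ^ DIM('a))"
  have M: "0 \<le> M" using Z(2,3) b kernel_const_nonneg[where 'a='a] by (simp add: M_def)
  show ?thesis
  proof (rule that[OF Z(1,2) M Z(4,6)])
    fix f :: "'a \<Rightarrow> 'x" and q :: real and z x :: 'a
    assume f: "poisson_admissible f" and q: "2 \<le> q" and x: "x \<in> ball z (\<rho> z)"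
    have r: "0 < \<rho> z" by (rule critical_radius_pos)
    have "kernel_const TYPE('a) * K ^ DIM('a) / \<rho> z ^ DIM('a) = M * (1 / (b * (A * \<rho> z) ^ DIM('a)))"
      using b Z(2) r by (simp add: M_def power_mult_distrib)
    then have "ennreal (kernel_const TYPE('a) * K ^ DIM('a) / \<rho> z ^ DIM('a))
        = ennreal M * ennreal (1 / (b * (A * \<rho> z) ^ DIM('a)))"
      by (simp only:) (rule ennreal_mult; use M b Z(2) r in simp)
    then show "lq_norm q (local_t_deriv_poisson V f x)
      \<le> square_fun q (\<lambda>y. indicat_real (ball z (A * \<rho> z)) y *\<^sub>R f y) x
        + ennreal M * (ennreal (1 / (unit_ball_vol DIM('a) * (A * \<rho> z) ^ DIM('a))) *
            (\<integral>\<^sup>+y. ennreal (norm (f y)) * indicator (ball z (A * \<rho> z)) y \<partial>lebesgue))"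
      using lq_norm_local_le[OF f q Z(3), of x "ball z (A * \<rho> z)" "\<rho> z"] Z(5)[OF x] r
      by (simp add: b_def mult.assoc)
  qed
qed

end

lemma bochner_Lp_banach:
  "f \<in> carrier_of (bochner_Lp p lebesgue banach_space) \<longleftrightarrow>
    strongly_measurable lebesgue banach_space f \<and> (\<integral>\<^sup>+y. epowr (ennreal (norm (f y))) p \<partial>lebesgue) < \<infinity>"
  "norm_of (bochner_Lp p lebesgue banach_space) f = epowr (\<integral>\<^sup>+y. epowr (ennreal (norm (f y))) p \<partial>lebesgue) (1 / p)"
  by (simp_all add: bochner_Lp_def Lp_norm_def banach_space_def)

lemma bochner_Lp_indicator:
  fixes f :: "'a::euclidean_space \<Rightarrow> 'x::banach"
  assumes p: "0 \<le> p" and f: "f \<in> carrier_of (bochner_Lp p lebesgue banach_space)" and Q: "Q \<in> sets lebesgue"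
  shows "(\<lambda>y. indicat_real Q y *\<^sub>R f y) \<in> carrier_of (bochner_Lp p lebesgue banach_space)"
    and "epowr (ennreal (norm (indicat_real Q y *\<^sub>R f y))) p = epowr (ennreal (norm (f y))) p * indicator Q y"
proof -
  show eq: "epowr (ennreal (norm (indicat_real Q y *\<^sub>R f y))) p = epowr (ennreal (norm (f y))) p * indicator Q y" for y
    by (simp add: indicator_def)
  have "(\<integral>\<^sup>+y. epowr (ennreal (norm (f y))) p * indicator Q y \<partial>lebesgue) \<le> (\<integral>\<^sup>+y. epowr (ennreal (norm (f y))) p \<partial>lebesgue)"
    by (intro nn_integral_mono) (simp add: indicator_def)
  also have "\<dots> < \<infinity>" using f by (simp add: bochner_Lp_banach)
  finally show "(\<lambda>y. indicat_real Q y *\<^sub>R f y) \<in> carrier_of (bochner_Lp p lebesgue banach_space)"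
    using f strongly_measurable_scaleR[OF borel_measurable_indicator[OF Q], of f]
    unfolding bochner_Lp_banach eq by simp
qed

section \<open>Strong type, weak type and almost everywhere finiteness\<close>

context reverse_hoelder_potential
begin

lemma local_strong_type:
  fixes q p C\<^sub>0 :: real
  assumes q: "2 \<le> q" and p: "1 \<le> p" and C\<^sub>0: "0 \<le> C\<^sub>0"
    and hyp: "\<And>f :: 'a \<Rightarrow> 'x::banach. f \<in> carrier_of (bochner_Lp p lebesgue banach_space) \<Longrightarrow>
      square_fun q f \<in> borel_measurable lebesgue \<and>
      (\<integral>\<^sup>+x. epowr (square_fun q f x) p \<partial>lebesgue) \<le> ennreal C\<^sub>0 * (\<integral>\<^sup>+y. epowr (ennreal (norm (f y))) p \<partial>lebesgue)"
  shows "\<exists>C\<ge>0. \<forall>f :: 'a \<Rightarrow> 'x. f \<in> carrier_of (bochner_Lp p lebesgue banach_space) \<longrightarrow>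
      (\<integral>\<^sup>+x. epowr (lq_norm q (local_t_deriv_poisson V f x)) p \<partial>lebesgue)
        \<le> ennreal C * (\<integral>\<^sup>+y. epowr (ennreal (norm (f y))) p \<partial>lebesgue)"
proof -
  obtain Z A M P where Z: "countable Z" "1 \<le> A" "0 \<le> M"
    "\<And>x. \<exists>z\<in>Z. x \<in> ball z (\<rho> z)"
    "\<And>y. finite {z\<in>Z. y \<in> ball z (A * \<rho> z)} \<and> card {z\<in>Z. y \<in> ball z (A * \<rho> z)} \<le> P"
    and loc: "\<And>(f :: 'a \<Rightarrow> 'x) q z x. poisson_admissible f \<Longrightarrow> 2 \<le> q \<Longrightarrow> x \<in> ball z (\<rho> z) \<Longrightarrow>
      lq_norm q (local_t_deriv_poisson V f x)
      \<le> square_fun q (\<lambda>y. indicat_real (ball z (A * \<rho> z)) y *\<^sub>R f y) x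
        + ennreal M * (ennreal (1 / (unit_ball_vol DIM('a) * (A * \<rho> z) ^ DIM('a))) *
            (\<integral>\<^sup>+y. ennreal (norm (f y)) * indicator (ball z (A * \<rho> z)) y \<partial>lebesgue))"
    by (rule local_cover[where 'x = 'x]) blast
  \<comment> \<open>\<open>2 powr (p - 1)\<close> from splitting the sum, \<open>C\<^sub>0\<close>
    from the hypothesis, and \<open>M powr p * 2 powr p\<close> from the mean.\<close>
  define C where "C = 2 powr (p - 1) * (C\<^sub>0 + M powr p * 2 powr p)"
  have C: "0 \<le> C" using C\<^sub>0 by (simp add: C_def)
  have "(\<integral>\<^sup>+x. epowr (lq_norm q (local_t_deriv_poisson V f x)) p \<partial>lebesgue)
      \<le> ennreal C * of_nat P * (\<integral>\<^sup>+y. epowr (ennreal (norm (f y))) p \<partial>lebesgue)"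
    if f: "f \<in> carrier_of (bochner_Lp p lebesgue banach_space)" for f :: "'a \<Rightarrow> 'x"
  proof -
    have adm: "poisson_admissible f" by (rule poisson_admissible_bochner_Lp[OF p f])
    note [measurable] = poisson_admissibleD(2)[OF adm] lq_norm_local_measurable[OF adm]
    show ?thesis
    proof (rule nn_integral_cover_le[OF Z(1) _ _ _ _ Z(4) Z(5)])
      fix z
      define Q where "Q = ball z (A * \<rho> z)"
      define B where "B = ball z (\<rho> z)"
      define m where "m = unit_ball_vol (real DIM('a)) * (A * \<rho> z) ^ DIM('a)"
      define J where "J = (\<integral>\<^sup>+y. epowr (ennreal (norm (f y))) p * indicator Q y \<partial>lebesgue)"
      define a where "a = ennreal (1 / m) * (\<integral>\<^sup>+y. ennreal (norm (f y)) * indicator Q y \<partial>lebesgue)"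
      define g where "g = (\<lambda>y. indicat_real Q y *\<^sub>R f y)"
      have r: "0 < A * \<rho> z" using Z(2) critical_radius_pos[of z] by (intro mult_pos_pos) auto
      have m: "0 < m" using r by (simp add: m_def)
      have Q: "Q \<in> sets lebesgue" and [measurable]: "B \<in> sets lebesgue" by (simp_all add: Q_def B_def)
      have Qm: "emeasure lebesgue Q = ennreal m"
        unfolding Q_def m_def using r by (intro emeasure_lebesgue_ball) simp
      have Bm: "emeasure lebesgue B \<le> ennreal m"
      proof -
        have "1 * \<rho> z \<le> A * \<rho> z" using Z(2) critical_radius_pos[of z] by (intro mult_right_mono) auto
        then have "B \<subseteq> Q" unfolding B_def Q_def by (intro subset_ball) simp
        then show ?thesis unfolding Qm[symmetric] using Q by (rule emeasure_mono)
      qed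
      have g: "g \<in> carrier_of (bochner_Lp p lebesgue banach_space)"
        unfolding g_def using p by (intro bochner_Lp_indicator f Q) simp
      note [measurable] = hyp[OF g, THEN conjunct1]
      have gJ: "(\<integral>\<^sup>+x. epowr (square_fun q g x) p \<partial>lebesgue) \<le> ennreal C\<^sub>0 * J"
      proof -
        have "epowr (ennreal (norm (g y))) p = epowr (ennreal (norm (f y))) p * indicator Q y" for y
          unfolding g_def using p by (intro bochner_Lp_indicator(2)[OF _ f Q]) simp
        then show ?thesis using hyp[OF g, THEN conjunct2] by (simp only: J_def)
      qed
      have aJ: "ennreal m * epowr a p \<le> ennreal (2 powr p) * J"
        unfolding a_def J_def by (rule mean_epowr_le[OF p _ Q Qm m]) measurable
      have le: "epowr (lq_norm q (local_t_deriv_poisson V f x)) p * indicator B x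
          \<le> ennreal (2 powr (p - 1)) * (epowr (square_fun q g x) p + epowr (ennreal M * a) p * indicator B x)" for x
      proof (cases "x \<in> B")
        case True
        then have "lq_norm q (local_t_deriv_poisson V f x) \<le> square_fun q g x + ennreal M * a"
          using loc[OF adm q] by (simp add: B_def g_def Q_def a_def m_def)
        then have "epowr (lq_norm q (local_t_deriv_poisson V f x)) p \<le> epowr (square_fun q g x + ennreal M * a) p"
          using p by (intro epowr_mono) auto
        also have "\<dots> \<le> ennreal (2 powr (p - 1)) * (epowr (square_fun q g x) p + epowr (ennreal M * a) p)"
          by (rule epowr_add_le2[OF p])
        finally show ?thesis using True by simp
      qed simp
      have "(\<integral>\<^sup>+x. epowr (lq_norm q (local_t_deriv_poisson V f x)) p * indicator B x \<partial>lebesgue)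
          \<le> (\<integral>\<^sup>+x. ennreal (2 powr (p - 1)) * (epowr (square_fun q g x) p + epowr (ennreal M * a) p * indicator B x) \<partial>lebesgue)"
        by (intro nn_integral_mono le)
      also have "\<dots> = ennreal (2 powr (p - 1)) * ((\<integral>\<^sup>+x. epowr (square_fun q g x) p \<partial>lebesgue)
          + epowr (ennreal M * a) p * emeasure lebesgue B)"
        by (simp add: nn_integral_cmult nn_integral_add nn_integral_cmult_indicator)
      also have "\<dots> \<le> ennreal (2 powr (p - 1)) * (ennreal C\<^sub>0 * J + ennreal (M powr p) * (ennreal (2 powr p) * J))"
      proof (intro mult_left_mono add_mono gJ)
        have "epowr (ennreal M * a) p * emeasure lebesgue B \<le> epowr (ennreal M * a) p * ennreal m"
          by (intro mult_left_mono Bm) simp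
        also have "\<dots> = ennreal (M powr p) * (ennreal m * epowr a p)"
          using Z(3) by (simp add: epowr_mult epowr_ennreal mult_ac)
        also have "\<dots> \<le> ennreal (M powr p) * (ennreal (2 powr p) * J)"
          by (intro mult_left_mono aJ) simp
        finally show "epowr (ennreal M * a) p * emeasure lebesgue B \<le> ennreal (M powr p) * (ennreal (2 powr p) * J)" .
      qed simp
      also have "\<dots> = ennreal C * J"
        using C\<^sub>0 by (simp add: C_def ennreal_mult ennreal_plus distrib_left distrib_right mult.assoc)
      finally show "(\<integral>\<^sup>+x. epowr (lq_norm q (local_t_deriv_poisson V f x)) p * indicator (ball z (\<rho> z)) x \<partial>lebesgue)
          \<le> ennreal C * (\<integral>\<^sup>+y. epowr (ennreal (norm (f y))) p * indicator (ball z (A * \<rho> z)) y \<partial>lebesgue)"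
        by (simp add: J_def B_def Q_def)
    qed (auto intro: measurable_compose[OF _ measurable_epowr])
  qed
  then show ?thesis
    using C by (intro exI[of _ "C * real P"]) (simp add: ennreal_mult ennreal_of_nat_eq_real_of_nat)
qed

text \<open>The weak quasi-norm is not additive over pieces, but at a fixed level the measure of the
  level set is. Each piece is bounded by an integral of \<open>norm (f y)\<close>, which is additive
  too, so the cover lemma applies for every \<open>l\<close> separately.\<close>

lemma local_weak_type:
  fixes q C\<^sub>0 :: real
  assumes q: "2 \<le> q" and C\<^sub>0: "0 \<le> C\<^sub>0"
    and hyp: "\<And>(f :: 'a \<Rightarrow> 'x::banach) l. f \<in> carrier_of (bochner_Lp 1 lebesgue banach_space) \<Longrightarrow> 0 < l \<Longrightarrow>
      square_fun q f \<in> borel_measurable lebesgue \<and>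
      ennreal l * emeasure lebesgue {x. square_fun q f x > ennreal l} \<le> ennreal C\<^sub>0 * (\<integral>\<^sup>+y. ennreal (norm (f y)) \<partial>lebesgue)"
  shows "\<exists>C\<ge>0. \<forall>(f :: 'a \<Rightarrow> 'x) l. f \<in> carrier_of (bochner_Lp 1 lebesgue banach_space) \<longrightarrow> 0 < l \<longrightarrow>
      ennreal l * emeasure lebesgue {x. lq_norm q (local_t_deriv_poisson V f x) > ennreal l}
        \<le> ennreal C * (\<integral>\<^sup>+y. ennreal (norm (f y)) \<partial>lebesgue)"
proof -
  obtain Z A M P where Z: "countable Z" "1 \<le> A" "0 \<le> M"
    "\<And>x. \<exists>z\<in>Z. x \<in> ball z (\<rho> z)"
    "\<And>y. finite {z\<in>Z. y \<in> ball z (A * \<rho> z)} \<and> card {z\<in>Z. y \<in> ball z (A * \<rho> z)} \<le> P"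
    and loc: "\<And>(f :: 'a \<Rightarrow> 'x) q z x. poisson_admissible f \<Longrightarrow> 2 \<le> q \<Longrightarrow> x \<in> ball z (\<rho> z) \<Longrightarrow>
      lq_norm q (local_t_deriv_poisson V f x)
      \<le> square_fun q (\<lambda>y. indicat_real (ball z (A * \<rho> z)) y *\<^sub>R f y) x
        + ennreal M * (ennreal (1 / (unit_ball_vol DIM('a) * (A * \<rho> z) ^ DIM('a))) *
            (\<integral>\<^sup>+y. ennreal (norm (f y)) * indicator (ball z (A * \<rho> z)) y \<partial>lebesgue))"
    by (rule local_cover[where 'x = 'x]) blast
  define C where "C = 2 * (M + C\<^sub>0)"
  have C: "0 \<le> C" using C\<^sub>0 Z(3) by (simp add: C_def)
  have "ennreal l * emeasure lebesgue {x. lq_norm q (local_t_deriv_poisson V f x) > ennreal l}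
      \<le> ennreal C * of_nat P * (\<integral>\<^sup>+y. ennreal (norm (f y)) \<partial>lebesgue)"
    if f: "f \<in> carrier_of (bochner_Lp 1 lebesgue banach_space)" and l: "0 < l" for f :: "'a \<Rightarrow> 'x" and l :: real
  proof -
    have adm: "poisson_admissible f" by (rule poisson_admissible_bochner_Lp[OF _ f]) simp
    note [measurable] = poisson_admissibleD(2)[OF adm] lq_norm_local_measurable[OF adm]
    define E where "E = {x. lq_norm q (local_t_deriv_poisson V f x) > ennreal l}"
    have "{x \<in> space lebesgue. lq_norm q (local_t_deriv_poisson V f x) > ennreal l} \<in> sets lebesgue" by measurable
    then have E: "E \<in> sets lebesgue" by (simp add: E_def)
    have "ennreal l * emeasure lebesgue E = (\<integral>\<^sup>+x. ennreal l * indicator E x \<partial>lebesgue)"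
      using E by (simp add: nn_integral_cmult_indicator)
    also have "\<dots> \<le> ennreal C * of_nat P * (\<integral>\<^sup>+y. ennreal (norm (f y)) \<partial>lebesgue)"
    proof (rule nn_integral_cover_le[OF Z(1) _ _ _ _ Z(4) Z(5)])
      show "(\<lambda>x. ennreal l * indicator E x) \<in> borel_measurable lebesgue" using E by simp
      fix z
      define Q where "Q = ball z (A * \<rho> z)"
      define B where "B = ball z (\<rho> z)"
      define m where "m = unit_ball_vol (real DIM('a)) * (A * \<rho> z) ^ DIM('a)"
      define J where "J = (\<integral>\<^sup>+y. ennreal (norm (f y)) * indicator Q y \<partial>lebesgue)"
      define g where "g = (\<lambda>y. indicat_real Q y *\<^sub>R f y)"
      have r: "0 < A * \<rho> z" using Z(2) critical_radius_pos[of z] by (intro mult_pos_pos) auto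
      have m: "0 < m" using r by (simp add: m_def)
      have Q: "Q \<in> sets lebesgue" and B: "B \<in> sets lebesgue" by (simp_all add: Q_def B_def)
      have Qm: "emeasure lebesgue Q = ennreal m"
        unfolding Q_def m_def using r by (intro emeasure_lebesgue_ball) simp
      have Bm: "emeasure lebesgue B \<le> ennreal m"
      proof -
        have "1 * \<rho> z \<le> A * \<rho> z" using Z(2) critical_radius_pos[of z] by (intro mult_right_mono) auto
        then have "B \<subseteq> Q" unfolding B_def Q_def by (intro subset_ball) simp
        then show ?thesis unfolding Qm[symmetric] using Q by (rule emeasure_mono)
      qed
      have g: "g \<in> carrier_of (bochner_Lp 1 lebesgue banach_space)"
        unfolding g_def by (intro bochner_Lp_indicator f Q) simp
      have gJ: "(\<integral>\<^sup>+y. ennreal (norm (g y)) \<partial>lebesgue) = J"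
        using bochner_Lp_indicator(2)[OF _ f Q] unfolding J_def g_def by simp
      define a where "a = ennreal M * (ennreal (1 / m) * J)"
      have am: "a * ennreal m = ennreal M * J"
      proof -
        have "ennreal (1 / m) * ennreal m = 1" using m by (simp flip: ennreal_mult)
        then show ?thesis unfolding a_def by (metis mult.assoc mult.commute mult_1)
      qed
      have le: "lq_norm q (local_t_deriv_poisson V f x) \<le> square_fun q g x + a" if "x \<in> B" for x
        using loc[OF adm q, of x z] that by (simp add: B_def g_def Q_def J_def a_def m_def)
      have half: "2 * ennreal (l / 2) = ennreal l"
        using l by (simp add: ennreal_mult[symmetric] flip: ennreal_numeral)
      have "ennreal l * emeasure lebesgue (E \<inter> B) \<le> ennreal C * J"
      \<comment> \<open>If the error \<open>a\<close> exceeds half the level, the whole ball may be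
        counted, since \<open>l\<close> times its measure is then at most twice the error times
        \<open>m\<close>. Otherwise the square function itself exceeds \<open>l / 2\<close> on the
        level set.\<close>
      proof (cases "ennreal (l / 2) < a")
        case True
        have "ennreal l * emeasure lebesgue (E \<inter> B) \<le> ennreal l * emeasure lebesgue B"
          using B by (intro mult_left_mono emeasure_mono) auto
        also have "\<dots> \<le> ennreal l * ennreal m" by (intro mult_left_mono Bm) simp
        also have "\<dots> \<le> 2 * a * ennreal m"
          unfolding half[symmetric] using True by (intro mult_right_mono mult_left_mono) auto
        also have "\<dots> = ennreal (2 * M) * J" using am Z(3) by (simp add: mult.assoc ennreal_mult)
        also have "\<dots> \<le> ennreal C * J" using C\<^sub>0 by (intro mult_right_mono ennreal_leI) (auto simp: C_def)
        finally show ?thesis .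
      next
        case False
        let ?G = "{x. square_fun q g x > ennreal (l / 2)}"
        have hg: "square_fun q g \<in> borel_measurable lebesgue"
          "ennreal (l / 2) * emeasure lebesgue ?G \<le> ennreal C\<^sub>0 * J"
          using hyp[OF g, of "l / 2"] l gJ by auto
        note [measurable] = hg(1)
        have "{x \<in> space lebesgue. square_fun q g x > ennreal (l / 2)} \<in> sets lebesgue" by measurable
        then have G: "?G \<in> sets lebesgue" by simp
        have "E \<inter> B \<subseteq> ?G"
        proof
          fix x assume x: "x \<in> E \<inter> B"
          show "x \<in> ?G"
          proof (rule ccontr)
            assume "x \<notin> ?G"
            then have "square_fun q g x + a \<le> ennreal (l / 2) + ennreal (l / 2)"
              using False by (intro add_mono) auto
            also have "\<dots> = ennreal l" using l by (simp flip: ennreal_plus)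
            finally show False using x le[of x] by (auto simp: E_def)
          qed
        qed
        then have "ennreal l * emeasure lebesgue (E \<inter> B) \<le> ennreal l * emeasure lebesgue ?G"
          using G by (intro mult_left_mono emeasure_mono) auto
        also have "\<dots> \<le> 2 * (ennreal C\<^sub>0 * J)"
          unfolding half[symmetric] mult.assoc by (intro mult_left_mono hg(2)) simp
        also have "\<dots> = ennreal (2 * C\<^sub>0) * J" using C\<^sub>0 by (simp add: mult.assoc ennreal_mult)
        also have "\<dots> \<le> ennreal C * J" using Z(3) by (intro mult_right_mono ennreal_leI) (auto simp: C_def)
        finally show ?thesis .
      qed
      moreover have "(\<integral>\<^sup>+x. ennreal l * indicator E x * indicator B x \<partial>lebesgue) = ennreal l * emeasure lebesgue (E \<inter> B)"
        using E B by (simp add: mult.assoc nn_integral_cmult flip: indicator_inter_arith)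
      ultimately show "(\<integral>\<^sup>+x. ennreal l * indicator E x * indicator (ball z (\<rho> z)) x \<partial>lebesgue)
          \<le> ennreal C * (\<integral>\<^sup>+y. ennreal (norm (f y)) * indicator (ball z (A * \<rho> z)) y \<partial>lebesgue)"
        by (simp add: J_def B_def Q_def)
    qed auto
    finally show ?thesis by (simp add: E_def)
  qed
  then show ?thesis
    using C by (intro exI[of _ "C * real P"]) (simp add: ennreal_mult ennreal_of_nat_eq_real_of_nat)
qed

text \<open>The hypothesis leaves one exceptional null set for each ball of the cover; as the cover
  is countable, their union is null. The error term is finite because \<open>f\<close> is
  integrable.\<close>

lemma local_AE_finite:
  fixes q :: real and f :: "'a \<Rightarrow> 'x::banach"
  assumes q: "2 \<le> q"
    and hyp: "\<And>f :: 'a \<Rightarrow> 'x. f \<in> carrier_of (bochner_Lp 1 lebesgue banach_space) \<Longrightarrow>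
      AE x in lebesgue. square_fun q f x < \<infinity>"
    and f: "f \<in> carrier_of (bochner_Lp 1 lebesgue banach_space)"
  shows "AE x in lebesgue. lq_norm q (local_t_deriv_poisson V f x) < \<infinity>"
proof -
  obtain Z A M P where Z: "countable Z" "1 \<le> A" "0 \<le> M"
    "\<And>x. \<exists>z\<in>Z. x \<in> ball z (\<rho> z)"
    "\<And>y. finite {z\<in>Z. y \<in> ball z (A * \<rho> z)} \<and> card {z\<in>Z. y \<in> ball z (A * \<rho> z)} \<le> P"
    and loc: "\<And>(f :: 'a \<Rightarrow> 'x) q z x. poisson_admissible f \<Longrightarrow> 2 \<le> q \<Longrightarrow> x \<in> ball z (\<rho> z) \<Longrightarrow>
      lq_norm q (local_t_deriv_poisson V f x)
      \<le> square_fun q (\<lambda>y. indicat_real (ball z (A * \<rho> z)) y *\<^sub>R f y) x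
        + ennreal M * (ennreal (1 / (unit_ball_vol DIM('a) * (A * \<rho> z) ^ DIM('a))) *
            (\<integral>\<^sup>+y. ennreal (norm (f y)) * indicator (ball z (A * \<rho> z)) y \<partial>lebesgue))"
    by (rule local_cover[where 'x = 'x]) blast
  have adm: "poisson_admissible f" by (rule poisson_admissible_bochner_Lp[OF _ f]) simp
  have fin: "(\<integral>\<^sup>+y. ennreal (norm (f y)) * indicator Q y \<partial>lebesgue) < top" for Q
  proof -
    have "(\<integral>\<^sup>+y. ennreal (norm (f y)) * indicator Q y \<partial>lebesgue) \<le> (\<integral>\<^sup>+y. ennreal (norm (f y)) \<partial>lebesgue)"
      by (intro nn_integral_mono) (simp add: indicator_def)
    also have "\<dots> < top" using f by (simp add: bochner_Lp_banach)
    finally show ?thesis .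
  qed
  have "AE x in lebesgue. \<forall>z\<in>Z. square_fun q (\<lambda>y. indicat_real (ball z (A * \<rho> z)) y *\<^sub>R f y) x < \<infinity>"
    using Z(1) by (intro AE_ball_countable[THEN iffD2] ballI hyp bochner_Lp_indicator(1)[OF _ f]) auto
  then show ?thesis
  proof eventually_elim
    case (elim x)
    obtain z where z: "z \<in> Z" "x \<in> ball z (\<rho> z)" using Z(4) by blast
    show ?case
      by (rule le_less_trans[OF loc[OF adm q z(2)]]) (use elim z(1) fin in \<open>simp add: ennreal_mult_less_top\<close>)
  qed
qed

end

section \<open>Transfer to mapping properties between function spaces\<close>

lemma measurable_enn2ereal_iff:
  "(\<lambda>x. enn2ereal (g x)) \<in> borel_measurable M \<longleftrightarrow> g \<in> borel_measurable M"
proof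
  assume "(\<lambda>x. enn2ereal (g x)) \<in> borel_measurable M"
  then have "(\<lambda>x. e2ennreal (enn2ereal (g x))) \<in> borel_measurable M" by measurable
  then show "g \<in> borel_measurable M" by simp
qed measurable

context reverse_hoelder_potential
begin

lemma square_fun_loc_measurable:
  assumes "poisson_admissible f" "square_fun q f \<in> borel_measurable lebesgue"
  shows "square_fun_loc V q f \<in> borel_measurable lebesgue"
  using assms(2) square_fun_glob_measurable[OF assms(1), of q]
  by (simp add: square_fun_loc_def[abs_def])

text \<open>Besides the norm bounds, almost everywhere finiteness is needed: of the local norm, to
  place the values in \<open>LqX q\<close> and obtain strong measurability, and of
  \<open>square_fun\<close> as well, so that the difference defining \<open>square_fun_loc\<close>
  is a genuine one almost everywhere.\<close>

lemma local_strong_maps_into: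
  assumes q: "2 \<le> q" and p: "1 \<le> p"
    and hyp: "maps_into (\<lambda>(f :: 'a \<Rightarrow> 'x::banach) x. enn2ereal (square_fun q f x))
      (bochner_Lp p lebesgue banach_space) (scalar_Lp p lebesgue)"
  shows "maps_into (local_t_deriv_poisson V :: ('a \<Rightarrow> 'x) \<Rightarrow> _)
      (bochner_Lp p lebesgue banach_space) (bochner_Lp p lebesgue (LqX q))"
    and "maps_into (square_fun_loc V q :: ('a \<Rightarrow> 'x) \<Rightarrow> _)
      (bochner_Lp p lebesgue banach_space) (scalar_Lp p lebesgue)"
proof -
  let ?L = "bochner_Lp p lebesgue banach_space :: ('a \<Rightarrow> 'x) nspace"
  have p0: "0 < p" using p by simp
  obtain C0 where C0: "0 \<le> C0" "\<And>f :: 'a \<Rightarrow> 'x. f \<in> carrier_of ?L \<Longrightarrow>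
      norm_of (scalar_Lp p lebesgue) (\<lambda>x. enn2ereal (square_fun q f x)) \<le> ennreal C0 * norm_of ?L f"
    using hyp unfolding maps_into_def by blast
  have meas: "square_fun q f \<in> borel_measurable lebesgue"
    and fin: "(\<integral>\<^sup>+x. epowr (square_fun q f x) p \<partial>lebesgue) < \<infinity>" if "f \<in> carrier_of ?L" for f
    using hyp that unfolding maps_into_def
    by (auto simp: scalar_Lp_def Lp_norm_def measurable_enn2ereal_iff)
  have bound: "(\<integral>\<^sup>+x. epowr (square_fun q f x) p \<partial>lebesgue)
      \<le> ennreal (C0 powr p) * (\<integral>\<^sup>+y. epowr (ennreal (norm (f y))) p \<partial>lebesgue)" if f: "f \<in> carrier_of ?L" for f
  proof -
    have "epowr (\<integral>\<^sup>+x. epowr (square_fun q f x) p \<partial>lebesgue) (1 / p)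
        \<le> ennreal C0 * epowr (\<integral>\<^sup>+y. epowr (ennreal (norm (f y))) p \<partial>lebesgue) (1 / p)"
      using C0(2)[OF f] by (simp add: scalar_Lp_def Lp_norm_def bochner_Lp_banach)
    then have "epowr (epowr (\<integral>\<^sup>+x. epowr (square_fun q f x) p \<partial>lebesgue) (1 / p)) p
        \<le> epowr (ennreal C0 * epowr (\<integral>\<^sup>+y. epowr (ennreal (norm (f y))) p \<partial>lebesgue) (1 / p)) p"
      using p0 by (intro epowr_mono) auto
    then show ?thesis using p0 C0(1) by (simp add: epowr_mult epowr_ennreal)
  qed
  obtain C where C: "0 \<le> C" "\<And>f :: 'a \<Rightarrow> 'x. f \<in> carrier_of ?L \<Longrightarrow>
      (\<integral>\<^sup>+x. epowr (lq_norm q (local_t_deriv_poisson V f x)) p \<partial>lebesgue)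
        \<le> ennreal C * (\<integral>\<^sup>+y. epowr (ennreal (norm (f y))) p \<partial>lebesgue)"
    using local_strong_type[OF q p, of "C0 powr p"] meas bound by (metis powr_ge_zero)
  have norm_L: "Lp_norm p lebesgue (norm_of (LqX q)) (local_t_deriv_poisson V f)
      = epowr (\<integral>\<^sup>+x. epowr (lq_norm q (local_t_deriv_poisson V f x)) p \<partial>lebesgue) (1 / p)" for f :: "'a \<Rightarrow> 'x"
    by (simp add: Lp_norm_def lq_norm_def)
  have norm_le: "Lp_norm p lebesgue (norm_of (LqX q)) (local_t_deriv_poisson V f)
      \<le> ennreal (C powr (1 / p)) * norm_of ?L f" if f: "f \<in> carrier_of ?L" for f
  proof -
    have "Lp_norm p lebesgue (norm_of (LqX q)) (local_t_deriv_poisson V f)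
        \<le> epowr (ennreal C * (\<integral>\<^sup>+y. epowr (ennreal (norm (f y))) p \<partial>lebesgue)) (1 / p)"
      unfolding norm_L using C(2)[OF f] p0 by (intro epowr_mono) auto
    then show ?thesis using C(1) by (simp add: epowr_mult epowr_ennreal bochner_Lp_banach)
  qed
  have norm_fin: "Lp_norm p lebesgue (norm_of (LqX q)) (local_t_deriv_poisson V f) < \<infinity>" if f: "f \<in> carrier_of ?L" for f
  proof -
    have "norm_of ?L f < top" using f by (simp add: bochner_Lp_banach)
    then have "ennreal (C powr (1 / p)) * norm_of ?L f < \<infinity>" by (simp add: ennreal_mult_less_top)
    then show ?thesis using norm_le[OF f] by (rule le_less_trans[rotated])
  qed
  have adm: "poisson_admissible f" if "f \<in> carrier_of ?L" for f
    by (rule poisson_admissible_bochner_Lp[OF p that])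
  have AE_fin: "AE x in lebesgue. lq_norm q (local_t_deriv_poisson V f x) < \<infinity>" if f: "f \<in> carrier_of ?L" for f
  proof -
    note [measurable] = lq_norm_local_measurable[OF adm[OF f], of q]
    have "(\<integral>\<^sup>+x. epowr (lq_norm q (local_t_deriv_poisson V f x)) p \<partial>lebesgue) \<noteq> \<infinity>"
      using norm_fin[OF f] unfolding norm_L by (simp add: less_top)
    then have "AE x in lebesgue. epowr (lq_norm q (local_t_deriv_poisson V f x)) p \<noteq> \<infinity>"
      by (intro nn_integral_noteq_infinite) measurable
    then show ?thesis
      by eventually_elim (metis epowr_less_top infinity_ennreal_def less_top)
  qed
  show "maps_into (local_t_deriv_poisson V) ?L (bochner_Lp p lebesgue (LqX q))"
    unfolding maps_into_def
  proof (intro conjI ballI exI)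
    show "local_t_deriv_poisson V f \<in> carrier_of (bochner_Lp p lebesgue (LqX q))" if f: "f \<in> carrier_of ?L" for f
      using norm_fin[OF f] q
        lq_strongly_measurable[OF _ local_strongly_measurable[OF adm[OF f]] local_continuous[OF adm[OF f]] AE_fin[OF f]]
      by (simp add: bochner_Lp_def[of p])
    show "norm_of (bochner_Lp p lebesgue (LqX q)) (local_t_deriv_poisson V f) \<le> ennreal (C powr (1 / p)) * norm_of ?L f"
      if f: "f \<in> carrier_of ?L" for f
      using norm_le[OF f] by (simp add: bochner_Lp_def[of p lebesgue "LqX q"])
  qed simp
  have loc_le: "Lp_norm p lebesgue (\<lambda>z. e2ennreal \<bar>z\<bar>) (square_fun_loc V q f)
      \<le> Lp_norm p lebesgue (norm_of (LqX q)) (local_t_deriv_poisson V f)" if f: "f \<in> carrier_of ?L" for f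
  proof -
    note [measurable] = meas[OF f]
    have "AE x in lebesgue. epowr (square_fun q f x) p \<noteq> \<infinity>"
      using fin[OF f] by (intro nn_integral_noteq_infinite) auto
    then have "AE x in lebesgue. epowr (e2ennreal \<bar>square_fun_loc V q f x\<bar>) p
        \<le> epowr (lq_norm q (local_t_deriv_poisson V f x)) p"
      using AE_fin[OF f]
    proof eventually_elim
      case (elim x)
      then have "square_fun q f x < \<infinity>" by (metis epowr_less_top infinity_ennreal_def less_top)
      then show ?case using elim(2) q p0
        by (intro epowr_mono square_fun_loc_le[OF adm[OF f]]) auto
    qed
    then show ?thesis
      unfolding norm_L unfolding Lp_norm_def using p0 by (intro epowr_mono nn_integral_mono_AE) auto
  qed
  show "maps_into (square_fun_loc V q) ?L (scalar_Lp p lebesgue)"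
    unfolding maps_into_def
  proof (intro conjI ballI exI)
    show "square_fun_loc V q f \<in> carrier_of (scalar_Lp p lebesgue)" if f: "f \<in> carrier_of ?L" for f
      using le_less_trans[OF loc_le[OF f] norm_fin[OF f]] square_fun_loc_measurable[OF adm[OF f] meas[OF f]]
      by (simp add: scalar_Lp_def)
    show "norm_of (scalar_Lp p lebesgue) (square_fun_loc V q f) \<le> ennreal (C powr (1 / p)) * norm_of ?L f"
      if f: "f \<in> carrier_of ?L" for f
      using order.trans[OF loc_le[OF f] norm_le[OF f]] by (simp add: scalar_Lp_def)
  qed simp
qed

lemma local_weak_maps_into:
  assumes q: "2 \<le> q"
    and hyp: "maps_into (\<lambda>(f :: 'a \<Rightarrow> 'x::banach) x. enn2ereal (square_fun q f x))
      (bochner_Lp 1 lebesgue banach_space) (scalar_weak_L1 lebesgue)"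
  shows "maps_into (local_t_deriv_poisson V :: ('a \<Rightarrow> 'x) \<Rightarrow> _)
      (bochner_Lp 1 lebesgue banach_space) (bochner_weak_L1 lebesgue (LqX q))"
    and "maps_into (square_fun_loc V q :: ('a \<Rightarrow> 'x) \<Rightarrow> _)
      (bochner_Lp 1 lebesgue banach_space) (scalar_weak_L1 lebesgue)"
proof -
  let ?L = "bochner_Lp 1 lebesgue banach_space :: ('a \<Rightarrow> 'x) nspace"
  have norm_1: "norm_of ?L f = (\<integral>\<^sup>+y. ennreal (norm (f y)) \<partial>lebesgue)" for f
    by (simp add: bochner_Lp_banach)
  have norm_1_fin: "norm_of ?L f < \<infinity>" if "f \<in> carrier_of ?L" for f
    using that by (simp add: bochner_Lp_banach)
  obtain C0 where C0: "0 \<le> C0" "\<And>f :: 'a \<Rightarrow> 'x. f \<in> carrier_of ?L \<Longrightarrow>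
      norm_of (scalar_weak_L1 lebesgue) (\<lambda>x. enn2ereal (square_fun q f x)) \<le> ennreal C0 * norm_of ?L f"
    using hyp unfolding maps_into_def by blast
  have meas: "square_fun q f \<in> borel_measurable lebesgue" if "f \<in> carrier_of ?L" for f
    using hyp that unfolding maps_into_def by (auto simp: scalar_weak_L1_def measurable_enn2ereal_iff)
  have bound: "ennreal l * emeasure lebesgue {x. square_fun q f x > ennreal l}
      \<le> ennreal C0 * (\<integral>\<^sup>+y. ennreal (norm (f y)) \<partial>lebesgue)" if f: "f \<in> carrier_of ?L" and l: "0 < l" for f l
  proof -
    have "ennreal l * emeasure lebesgue {x. square_fun q f x > ennreal l}
        \<le> norm_of (scalar_weak_L1 lebesgue) (\<lambda>x. enn2ereal (square_fun q f x))"
      unfolding scalar_weak_L1_def weak_L1_norm_def using l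
      by (simp del: emeasure_completion) (rule SUP_upper2[of l]; simp)
    then show ?thesis using C0(2)[OF f] unfolding norm_1 by (rule order.trans)
  qed
  obtain C where C: "0 \<le> C" "\<And>(f :: 'a \<Rightarrow> 'x) l. f \<in> carrier_of ?L \<Longrightarrow> 0 < l \<Longrightarrow>
      ennreal l * emeasure lebesgue {x. lq_norm q (local_t_deriv_poisson V f x) > ennreal l}
        \<le> ennreal C * (\<integral>\<^sup>+y. ennreal (norm (f y)) \<partial>lebesgue)"
    using local_weak_type[OF q C0(1)] meas bound by blast
  have norm_le: "weak_L1_norm lebesgue (norm_of (LqX q)) (local_t_deriv_poisson V f) \<le> ennreal C * norm_of ?L f"
    if f: "f \<in> carrier_of ?L" for f
    unfolding weak_L1_norm_def norm_1
    by (rule SUP_least) (use C(2)[OF f] in \<open>simp add: lq_norm_def del: emeasure_completion\<close>)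
  have norm_fin: "ennreal C * norm_of ?L f < \<infinity>" if f: "f \<in> carrier_of ?L" for f
    using norm_1_fin[OF f] by (simp add: ennreal_mult_less_top)
  have adm: "poisson_admissible f" if "f \<in> carrier_of ?L" for f
    by (rule poisson_admissible_bochner_Lp[OF _ that]) simp
  have AE_fin: "AE x in lebesgue. lq_norm q (local_t_deriv_poisson V f x) < \<infinity>" if f: "f \<in> carrier_of ?L" for f
    using C(2)[OF f] norm_fin[OF f] unfolding norm_1
    by (intro weak_type_AE_finite[OF lq_norm_local_measurable[OF adm[OF f]]]) (auto simp del: emeasure_completion)
  have AE_fin': "AE x in lebesgue. square_fun q f x < \<infinity>" if f: "f \<in> carrier_of ?L" for f
  proof (rule weak_type_AE_finite[OF meas[OF f]])
    show "ennreal C0 * norm_of ?L f < \<infinity>" using norm_1_fin[OF f] by (simp add: ennreal_mult_less_top)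
    show "ennreal l * emeasure lebesgue {x \<in> space lebesgue. square_fun q f x > ennreal l} \<le> ennreal C0 * norm_of ?L f"
      if "0 < l" for l
      using bound[OF f that] unfolding norm_1 by (simp del: emeasure_completion)
  qed
  show "maps_into (local_t_deriv_poisson V) ?L (bochner_weak_L1 lebesgue (LqX q))"
    unfolding maps_into_def
  proof (intro conjI ballI exI)
    show "local_t_deriv_poisson V f \<in> carrier_of (bochner_weak_L1 lebesgue (LqX q))" if f: "f \<in> carrier_of ?L" for f
      using le_less_trans[OF norm_le[OF f] norm_fin[OF f]] q
        lq_strongly_measurable[OF _ local_strongly_measurable[OF adm[OF f]] local_continuous[OF adm[OF f]] AE_fin[OF f]]
      by (simp add: bochner_weak_L1_def)
    show "norm_of (bochner_weak_L1 lebesgue (LqX q)) (local_t_deriv_poisson V f) \<le> ennreal C * norm_of ?L f"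
      if f: "f \<in> carrier_of ?L" for f
      using norm_le[OF f] by (simp add: bochner_weak_L1_def)
  qed (rule C(1))
  have loc_le: "weak_L1_norm lebesgue (\<lambda>z. e2ennreal \<bar>z\<bar>) (square_fun_loc V q f) \<le> ennreal C * norm_of ?L f"
    if f: "f \<in> carrier_of ?L" for f
    unfolding weak_L1_norm_def
  proof (rule SUP_least)
    fix l :: real assume "l \<in> {0<..}"
    then have l: "0 < l" by simp
    note [measurable] = lq_norm_local_measurable[OF adm[OF f], of q]
    \<comment> \<open>The domination of \<open>square_fun_loc\<close> is available only where the
      local norm and \<open>square_fun\<close> are both finite, so the level sets are compared up to
      a null set.\<close>
    have "emeasure lebesgue {x \<in> space lebesgue. ennreal l < e2ennreal \<bar>square_fun_loc V q f x\<bar>}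
        \<le> emeasure lebesgue {x \<in> space lebesgue. lq_norm q (local_t_deriv_poisson V f x) > ennreal l}"
    proof (rule emeasure_mono_AE)
      show "AE x in lebesgue. x \<in> {x \<in> space lebesgue. ennreal l < e2ennreal \<bar>square_fun_loc V q f x\<bar>} \<longrightarrow>
          x \<in> {x \<in> space lebesgue. lq_norm q (local_t_deriv_poisson V f x) > ennreal l}"
        using AE_fin[OF f] AE_fin'[OF f]
      proof eventually_elim
        case (elim x)
        have "e2ennreal \<bar>square_fun_loc V q f x\<bar> \<le> lq_norm q (local_t_deriv_poisson V f x)"
          using q by (intro square_fun_loc_le[OF adm[OF f]] elim) simp
        then show ?case by auto
      qed
    qed measurable
    then have "ennreal l * emeasure lebesgue {x \<in> space lebesgue. ennreal l < e2ennreal \<bar>square_fun_loc V q f x\<bar>}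
        \<le> ennreal l * emeasure lebesgue {x. lq_norm q (local_t_deriv_poisson V f x) > ennreal l}"
      by (intro mult_left_mono) (simp_all del: emeasure_completion)
    also have "\<dots> \<le> ennreal C * norm_of ?L f" unfolding norm_1 by (rule C(2)[OF f l])
    finally show "ennreal l * emeasure lebesgue {x \<in> space lebesgue. ennreal l < e2ennreal \<bar>square_fun_loc V q f x\<bar>}
        \<le> ennreal C * norm_of ?L f" .
  qed
  show "maps_into (square_fun_loc V q) ?L (scalar_weak_L1 lebesgue)"
    unfolding maps_into_def
  proof (intro conjI ballI exI)
    show "square_fun_loc V q f \<in> carrier_of (scalar_weak_L1 lebesgue)" if f: "f \<in> carrier_of ?L" for f
      using le_less_trans[OF loc_le[OF f] norm_fin[OF f]] square_fun_loc_measurable[OF adm[OF f] meas[OF f]]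
      by (simp add: scalar_weak_L1_def)
    show "norm_of (scalar_weak_L1 lebesgue) (square_fun_loc V q f) \<le> ennreal C * norm_of ?L f"
      if f: "f \<in> carrier_of ?L" for f
      using loc_le[OF f] by (simp add: scalar_weak_L1_def)
  qed (rule C(1))
qed

end

lemma reverse_hoelder_imp_potential:
  fixes V :: "'a::euclidean_space \<Rightarrow> real"
  assumes dim: "2 \<le> DIM('a)" and s: "real DIM('a) / 2 < s"
    and V_nonzero: "\<not> (AE x in lebesgue. V x = 0)" and RH: "reverse_hoelder s V"
  shows "\<exists>C. reverse_hoelder_potential V s C"
proof -
  have nonneg: "\<And>x. 0 \<le> V x" and loc: "locally_integrable V" using RH by (auto simp: reverse_hoelder_def)
  obtain C where C: "\<And>x r. r > 0 \<Longrightarrow> set_integrable lebesgue (ball x r) (\<lambda>y. V y powr s)"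
    "\<And>x r. r > 0 \<Longrightarrow> (1 / measure lebesgue (ball x r) * (LINT y:ball x r|lebesgue. V y powr s)) powr (1 / s)
          \<le> C / measure lebesgue (ball x r) * mass V x r"
    using RH unfolding reverse_hoelder_def mass_def by blast
  \<comment> \<open>The given constant may have any sign; enlarging it to
    \<open>\<bar>C\<bar> + 1\<close> preserves the inequality because masses are
    nonnegative.\<close>
  have "reverse_hoelder_potential V s (\<bar>C\<bar> + 1)"
  proof
    show "set_integrable lebesgue (ball x r) V" for x r
      using loc unfolding locally_integrable_def
      by (intro set_integrable_subset[of lebesgue "cball x r" V "ball x r"]) auto
    fix x :: 'a and r :: real assume r: "0 < r"
    have "0 \<le> mass V x r" by (simp add: mass_def set_lebesgue_integral_def nonneg)
    then have "C / measure lebesgue (ball x r) * mass V x r \<le> (\<bar>C\<bar> + 1) / measure lebesgue (ball x r) * mass V x r"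
      by (intro mult_right_mono divide_right_mono) auto
    then show "(1 / measure lebesgue (ball x r) * (LINT y:ball x r|lebesgue. V y powr s)) powr (1 / s)
          \<le> (\<bar>C\<bar> + 1) / measure lebesgue (ball x r) * mass V x r"
      using C(2)[OF r, of x] by linarith
  qed (use assms nonneg C(1) in auto)
  then show ?thesis ..
qed

theorem theorem3p7:
  fixes V :: "'a::euclidean_space \<Rightarrow> real" and s q :: real
  assumes dim: "DIM('a) \<ge> 3"
    and V_nonzero: "\<not> (AE x in lebesgue. V x = 0)"
    and s: "s > real DIM('a) / 2"
    and RH: "reverse_hoelder s V"
    and q: "2 \<le> q"
  shows
    "(\<forall>p>1.
        maps_into (\<lambda>(f :: 'a \<Rightarrow> 'x::banach) x. enn2ereal (square_fun q f x))
          (bochner_Lp p lebesgue banach_space) (scalar_Lp p lebesgue) \<longrightarrow>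
        maps_into (local_t_deriv_poisson V :: ('a \<Rightarrow> 'x) \<Rightarrow> _)
          (bochner_Lp p lebesgue banach_space) (bochner_Lp p lebesgue (LqX q)) \<and>
        maps_into (square_fun_loc V q :: ('a \<Rightarrow> 'x) \<Rightarrow> _)
          (bochner_Lp p lebesgue banach_space) (scalar_Lp p lebesgue)) \<and>
     (maps_into (\<lambda>(f :: 'a \<Rightarrow> 'x) x. enn2ereal (square_fun q f x))
        (bochner_Lp 1 lebesgue banach_space) (scalar_weak_L1 lebesgue) \<longrightarrow>
      maps_into (local_t_deriv_poisson V :: ('a \<Rightarrow> 'x) \<Rightarrow> _)
        (bochner_Lp 1 lebesgue banach_space) (bochner_weak_L1 lebesgue (LqX q)) \<and>
      maps_into (square_fun_loc V q :: ('a \<Rightarrow> 'x) \<Rightarrow> _)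
        (bochner_Lp 1 lebesgue banach_space) (scalar_weak_L1 lebesgue)) \<and>
     ((\<forall>f :: 'a \<Rightarrow> 'x. f \<in> carrier_of (bochner_Lp 1 lebesgue banach_space) \<longrightarrow>
         (AE x in lebesgue. square_fun q f x < \<infinity>)) \<longrightarrow>
      (\<forall>f :: 'a \<Rightarrow> 'x. f \<in> carrier_of (bochner_Lp 1 lebesgue banach_space) \<longrightarrow>
         (AE x in lebesgue. norm_of (LqX q) (local_t_deriv_poisson V f x) < \<infinity>)))"
proof -
  obtain C where "reverse_hoelder_potential V s C"
    using reverse_hoelder_imp_potential[of s V] dim s V_nonzero RH by auto
  then interpret reverse_hoelder_potential V s C .
  show ?thesis
  proof (intro conjI allI impI)
    fix p :: real assume "1 < p"
      and hyp: "maps_into (\<lambda>(f :: 'a \<Rightarrow> 'x) x. enn2ereal (square_fun q f x))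
        (bochner_Lp p lebesgue banach_space) (scalar_Lp p lebesgue)"
    then have p: "1 \<le> p" by simp
    show "maps_into (local_t_deriv_poisson V :: ('a \<Rightarrow> 'x) \<Rightarrow> _)
        (bochner_Lp p lebesgue banach_space) (bochner_Lp p lebesgue (LqX q))"
      "maps_into (square_fun_loc V q :: ('a \<Rightarrow> 'x) \<Rightarrow> _)
        (bochner_Lp p lebesgue banach_space) (scalar_Lp p lebesgue)"
      by (fact local_strong_maps_into[OF q p hyp])+
  next
    assume hyp: "maps_into (\<lambda>(f :: 'a \<Rightarrow> 'x) x. enn2ereal (square_fun q f x))
        (bochner_Lp 1 lebesgue banach_space) (scalar_weak_L1 lebesgue)"
    show "maps_into (local_t_deriv_poisson V :: ('a \<Rightarrow> 'x) \<Rightarrow> _)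
        (bochner_Lp 1 lebesgue banach_space) (bochner_weak_L1 lebesgue (LqX q))"
      "maps_into (square_fun_loc V q :: ('a \<Rightarrow> 'x) \<Rightarrow> _)
        (bochner_Lp 1 lebesgue banach_space) (scalar_weak_L1 lebesgue)"
      by (fact local_weak_maps_into[OF q hyp])+
  next
    fix f :: "'a \<Rightarrow> 'x"
    assume hyp: "\<forall>f :: 'a \<Rightarrow> 'x. f \<in> carrier_of (bochner_Lp 1 lebesgue banach_space) \<longrightarrow>
        (AE x in lebesgue. square_fun q f x < \<infinity>)"
      and f: "f \<in> carrier_of (bochner_Lp 1 lebesgue banach_space)"
    show "AE x in lebesgue. norm_of (LqX q) (local_t_deriv_poisson V f x) < \<infinity>"
      using local_AE_finite[OF q _ f] hyp unfolding lq_norm_def by blast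
  qed
qed

end
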